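(* Let $I_r=[p_r,q_r]$, $0\le r\le m$, and $K=I_0\cup I_1\cup\dots\cup I_m$, with $0<p_0<q_0<p_1<q_1<\dots<p_m<q_m$. Then $K$ is a wavelet set for $H^2(\mathbb R)$ if and only if both of the following hold: (i) there are a permutation $\rho$ of $\{1,\dots,m\}$ and $k_i\in\mathbb N_0$, $1\le i\le m$, such that $$I_0\cup(I_{\rho(1)}-k_1)\cup(I_{\rho(2)}-k_2)\cup\dots\cup(I_{\rho(m)}-k_m)=[p_0,p_0+1],$$ where, in the order listed, the right endpoint of each interval is equal to the left endpoint of the next interval; (ii) there are a permutation $\sigma$ of $\{1,\dots,m\}$ and $r_i\in\mathbb N_0$, $1\le i\le m$, such that $$I_0\cup(2^{-r_1}I_{\sigma(1)})\cup(2^{-r_2}I_{\sigma(2)})\cup\dots\cup(2^{-r_m}I_{\sigma(m)})=[p_0,2p_0],$$ where, in the order listed, the right endpoint of each interval is equal to the left endpoint of the next interval.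
   Context: Notation: $\mathbb N_0=\{0,1,2,\dots\}$, $\mathbb R^+=(0,\infty)$. Fourier transform: $\widehat f(\xi)=\int_{\mathbb R}f(x)e^{-2\pi i x\xi}\,dx$. $H^2(\mathbb R)=\{f\in L^2(\mathbb R):\widehat f(\xi)=0\text{ for a.e. }\xi\le 0\}$. A function $\psi\in H^2(\mathbb R)$ is an $H^2$-wavelet if $\{2^{j/2}\psi(2^j\cdot-k):j,k\in\mathbb Z\}$ is an orthonormal basis of $H^2(\mathbb R)$. A measurable set $K\subset\mathbb R^+$ is a wavelet set for $H^2(\mathbb R)$ ($H^2$-wavelet set) if there is an $H^2$-wavelet $\psi$ with $|\widehat\psi|=\chi_K$ a.e. *)

theory Defs
  imports "HOL-Analysis.Analysis" "HOL-Combinatorics.Permutations"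
begin

text \<open>Elements of \<open>L\<^sup>2(\<real>)\<close> are represented by functions rather than by classes modulo null sets;
  every notion below is invariant under changes on null sets.\<close>

definition L2 :: "(real \<Rightarrow> complex) set" where
  "L2 = {f. f \<in> borel_measurable lebesgue \<and> integrable lebesgue (\<lambda>x. (cmod (f x))\<^sup>2)}"

definition L2_inner :: "(real \<Rightarrow> complex) \<Rightarrow> (real \<Rightarrow> complex) \<Rightarrow> complex" where
  "L2_inner f g = (LINT x|lebesgue. f x * cnj (g x))"

definition L2_norm :: "(real \<Rightarrow> complex) \<Rightarrow> real" where
  "L2_norm f = sqrt (LINT x|lebesgue. (cmod (f x))\<^sup>2)"

definition fourier_integral :: "(real \<Rightarrow> complex) \<Rightarrow> real \<Rightarrow> complex" where
  "fourier_integral f \<xi> = (LINT x|lebesgue. f x * exp (- (2 * of_real pi * \<i> * of_real x * of_real \<xi>)))"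

text \<open>The Fourier integral need not converge for \<open>f\<close> in \<open>L\<^sup>2(\<real>)\<close>. As usual, the Fourier transform of
  \<open>f\<close> is the limit in \<open>L\<^sup>2\<close> of the Fourier integrals of the truncations of \<open>f\<close> to \<open>[-n, n]\<close>.
  By Plancherel's theorem it exists for each \<open>f\<close> in \<open>L\<^sup>2(\<real>)\<close>, and it is unique up to null sets.
  The squared distance is an extended nonnegative integral, so that it is
  \<open>\<infinity>\<close> (and not \<open>0\<close>) when the difference is not square integrable.\<close>

definition has_fourier_transform :: "(real \<Rightarrow> complex) \<Rightarrow> (real \<Rightarrow> complex) \<Rightarrow> bool"
    (infix "has'_fourier'_transform" 50) where
  "f has_fourier_transform g \<longleftrightarrow> f \<in> L2 \<and> g \<in> L2 \<and>
    (\<lambda>n::nat. \<integral>\<^sup>+\<xi>. ennreal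
        ((cmod (g \<xi> - fourier_integral (\<lambda>x. indicator {- real n..real n} x * f x) \<xi>))\<^sup>2) \<partial>lebesgue)
      \<longlonglongrightarrow> 0"

definition H2 :: "(real \<Rightarrow> complex) set" where
  "H2 = {f \<in> L2. \<exists>g. f has_fourier_transform g \<and> (AE \<xi> in lebesgue. \<xi> \<le> 0 \<longrightarrow> g \<xi> = 0)}"

text \<open>A family is an orthonormal basis of \<open>V\<close> if it is an orthonormal family in \<open>V\<close> whose finite
  linear combinations are dense in \<open>V\<close>.\<close>

definition L2_orthonormal_basis :: "('i \<Rightarrow> real \<Rightarrow> complex) \<Rightarrow> (real \<Rightarrow> complex) set \<Rightarrow> bool" where
  "L2_orthonormal_basis e V \<longleftrightarrow>
    (\<forall>i. e i \<in> V) \<and>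
    (\<forall>i j. L2_inner (e i) (e j) = (if i = j then 1 else 0)) \<and>
    (\<forall>f\<in>V. \<forall>\<epsilon>>0. \<exists>A c. finite A \<and> L2_norm (\<lambda>x. f x - (\<Sum>i\<in>A. c i * e i x)) < \<epsilon>)"

definition H2_wavelet :: "(real \<Rightarrow> complex) \<Rightarrow> bool" where
  "H2_wavelet \<psi> \<longleftrightarrow> \<psi> \<in> H2 \<and>
    L2_orthonormal_basis
      (\<lambda>(j::int, k::int) x. of_real (2 powr (real_of_int j / 2)) * \<psi> (2 powi j * x - real_of_int k)) H2"

definition H2_wavelet_set :: "real set \<Rightarrow> bool" where
  "H2_wavelet_set K \<longleftrightarrow> K \<in> sets lebesgue \<and> K \<subseteq> {0<..} \<and>
    (\<exists>\<psi> g. H2_wavelet \<psi> \<and> \<psi> has_fourier_transform g \<and>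
      (AE \<xi> in lebesgue. cmod (g \<xi>) = indicator K \<xi>))"

end

theory Submission imports Defs begin

text \<open>
  The set \<open>K\<close> agrees up to a null set with the union \<open>S\<close> of the half-open intervals
  \<open>[p\<^sub>r, q\<^sub>r)\<close>. The theorem splits into an analytic and a combinatorial half, which meet in two
  tiling properties of \<open>S\<close>: every real number has exactly one integer translate in \<open>S\<close>
  (\<open>integer_tile\<close>), and every positive number has exactly one multiple by an integer power of
  two in \<open>S\<close> (\<open>dyadic_tile\<close>).

  \<^emph>\<open>Tilings give wavelets.\<close> If \<open>g\<close> is the Fourier transform of
  \<open>\<psi>\<close>, the transforms of the wavelet system of \<open>\<psi>\<close> are the functions
  \<open>2\<^bsup>-j/2\<^esup> e\<^bsup>-2\<pi>ik\<xi>/2\<^sup>j\<^esup> g(\<xi>/2\<^sup>j)\<close>. For \<open>g = \<chi>\<^sub>S\<close> these are, for fixed \<open>j\<close>, the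
  exponentials on the dilate \<open>2\<^sup>jS\<close>. The exponentials with integer frequencies form an orthonormal
  basis of \<open>L\<^sup>2(S)\<close> when the integer translates of \<open>S\<close> tile the line, and the dilates \<open>2\<^sup>jS\<close>
  partition the half-line (\<open>tiles_imp_wavelet_set\<close>).

  \<^emph>\<open>Wavelets give tilings.\<close> If \<open>\<bar>g\<bar> = \<chi>\<^sub>S\<close>, orthonormality at scale \<open>j = 0\<close> determines the
  Fourier coefficients of \<open>\<bar>g\<bar>\<^sup>2 = \<chi>\<^sub>S\<close>, hence its periodization is \<open>1\<close>. Orthogonality
  between two scales says that \<open>g(2\<^sup>j\<eta>) cnj (g \<eta>)\<close> has no Fourier coefficients on \<open>S\<close>, so
  it vanishes and \<open>S\<close> is disjoint from \<open>2\<^bsup>-j\<^esup>S\<close>. Finally, a set of positive numbers that misses all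
  dilates carries the transform of a function of \<open>H\<^sup>2\<close> orthogonal to the whole system, so it is a
  null set (\<open>wavelet_set_imp_tiles\<close>).

  \<^emph>\<open>Fourier analysis.\<close> Both halves use that the exponentials are complete in \<open>L\<^sup>2(Q)\<close> for every
  bounded set \<open>Q\<close> that meets each coset of the integers at most once (\<open>exponentials_complete\<close>); this
  follows from the Stone-Weierstrass theorem on the unit circle. Parseval's identity on integer tiles,
  applied to all modulations of a function supported in the unit interval around \<open>0\<close> and integrated,
  gives Plancherel's theorem for compactly supported functions (\<open>plancherel_compact\<close>), and a limit
  gives the isometry property of the Fourier transform (\<open>fourier_transform_inner\<close>). Functions with
  prescribed transform, in particular the wavelet itself, come from the fact that a compactly supported
  function is the transform of its inverse Fourier integral (\<open>fourier_transform_inverse\<close>).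

  \<^emph>\<open>Combinatorics.\<close> If the translates of \<open>S\<close> tile, each interval has a unique translate that starts in
  \<open>[p\<^sub>0, p\<^sub>0 + 1)\<close>. It does not reach beyond \<open>p\<^sub>0 + 1\<close>, because the first interval,
  translated by \<open>1\<close>, begins there. Thus these translates partition \<open>[p\<^sub>0, p\<^sub>0 + 1)\<close>, and sorting
  them by left endpoint gives the chain. The dyadic condition is the same statement for the intervals
  with endpoints \<open>log\<^sub>2 p\<^sub>r\<close> and \<open>log\<^sub>2 q\<^sub>r\<close>.
\<close>

section \<open>Square integrable functions\<close>

lemma borel_measurable_cnj [measurable (raw)]:
  "f \<in> borel_measurable M \<Longrightarrow> (\<lambda>x. cnj (f x)) \<in> borel_measurable M"
  by (rule borel_measurable_continuous_on[where f = cnj]) (auto intro: continuous_intros)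

lemma L2_measurable [measurable_dest]: "f \<in> L2 \<Longrightarrow> f \<in> borel_measurable lebesgue"
  by (simp add: L2_def)

lemma L2_integrable: "f \<in> L2 \<Longrightarrow> integrable lebesgue (\<lambda>x. (cmod (f x))\<^sup>2)"
  by (simp add: L2_def)

lemma L2I:
  assumes "f \<in> borel_measurable lebesgue" "integrable lebesgue h" "\<And>x. (cmod (f x))\<^sup>2 \<le> h x"
  shows "f \<in> L2"
proof -
  have "integrable lebesgue (\<lambda>x. (cmod (f x))\<^sup>2)"
    by (rule Bochner_Integration.integrable_bound[OF assms(2)])
       (use assms in \<open>auto intro!: AE_I2 order.trans[OF assms(3)]\<close>)
  with assms show ?thesis by (simp add: L2_def)
qed

lemma L2_zero [simp]: "(\<lambda>x. 0) \<in> L2"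
  by (simp add: L2_def)

lemma cmod_add_square_le: "(cmod (a + b))\<^sup>2 \<le> 2 * (cmod a)\<^sup>2 + 2 * (cmod b)\<^sup>2"
proof -
  have "(cmod (a + b))\<^sup>2 \<le> (cmod a + cmod b)\<^sup>2"
    by (simp add: norm_triangle_ineq power_mono)
  also have "\<dots> \<le> 2 * (cmod a)\<^sup>2 + 2 * (cmod b)\<^sup>2"
    using sum_squares_bound[of "cmod a" "cmod b"] by (simp add: power2_sum)
  finally show ?thesis .
qed

lemma L2_add [intro]:
  assumes "f \<in> L2" "g \<in> L2" shows "(\<lambda>x. f x + g x) \<in> L2"
  by (rule L2I[where h = "\<lambda>x. 2 * (cmod (f x))\<^sup>2 + 2 * (cmod (g x))\<^sup>2"])
     (use assms L2_measurable L2_integrable in \<open>auto intro!: cmod_add_square_le\<close>)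

lemma L2_mult_bounded:
  assumes "f \<in> L2" "h \<in> borel_measurable lebesgue" "\<And>x. cmod (h x) \<le> B"
  shows "(\<lambda>x. h x * f x) \<in> L2"
proof (rule L2I[where h = "\<lambda>x. B\<^sup>2 * (cmod (f x))\<^sup>2"])
  show "(cmod (h x * f x))\<^sup>2 \<le> B\<^sup>2 * (cmod (f x))\<^sup>2" for x
    using assms(3)[of x] by (simp add: norm_mult power_mult_distrib mult_right_mono power_mono)
qed (use assms L2_measurable L2_integrable in auto)

lemma L2_scale [intro]: "f \<in> L2 \<Longrightarrow> (\<lambda>x. c * f x) \<in> L2"
  by (rule L2_mult_bounded[where B = "cmod c"]) auto

lemma L2_diff [intro]: "f \<in> L2 \<Longrightarrow> g \<in> L2 \<Longrightarrow> (\<lambda>x. f x - g x) \<in> L2"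
  using L2_add[of f "\<lambda>x. - 1 * g x"] L2_scale[of g "- 1"] by simp

lemma L2_sum [intro]: "(\<And>i. i \<in> A \<Longrightarrow> f i \<in> L2) \<Longrightarrow> (\<lambda>x. \<Sum>i\<in>A. f i x) \<in> L2"
  by (induction A rule: infinite_finite_induct) auto

lemma L2_indicator_mult:
  "f \<in> L2 \<Longrightarrow> S \<in> sets lebesgue \<Longrightarrow> (\<lambda>x. indicator S x * f x) \<in> L2"
  by (rule L2_mult_bounded[where B = 1]) (auto simp: indicator_def)

lemma L2_indicator: 
  assumes "S \<in> lmeasurable" shows "indicator S \<in> L2"
proof -
  have "(\<lambda>x. (cmod (indicator S x))\<^sup>2) = (indicator S :: real \<Rightarrow> real)"
    by (auto simp: indicator_def)
  then show ?thesis
    using assms by (auto simp: L2_def fmeasurable_def)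
qed

lemma L2_inner_integrable:
  assumes "f \<in> L2" "g \<in> L2"
  shows "integrable lebesgue (\<lambda>x. f x * cnj (g x))"
proof (rule Bochner_Integration.integrable_bound[where f = "\<lambda>x. (cmod (f x))\<^sup>2 + (cmod (g x))\<^sup>2"])
  have "cmod (f x) * cmod (g x) \<le> (cmod (f x))\<^sup>2 + (cmod (g x))\<^sup>2" for x
    using sum_squares_bound[of "cmod (f x)" "cmod (g x)"]
      mult_nonneg_nonneg[OF norm_ge_zero[of "f x"] norm_ge_zero[of "g x"]] by linarith
  then show "AE x in lebesgue. norm (f x * cnj (g x)) \<le> norm ((cmod (f x))\<^sup>2 + (cmod (g x))\<^sup>2)"
    by (auto simp: norm_mult)
qed (use assms L2_measurable L2_integrable in auto)

lemma L2_inner_add_left: 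
  "f \<in> L2 \<Longrightarrow> g \<in> L2 \<Longrightarrow> h \<in> L2 \<Longrightarrow> L2_inner (\<lambda>x. f x + g x) h = L2_inner f h + L2_inner g h"
  by (simp add: L2_inner_def distrib_right L2_inner_integrable)

lemma L2_inner_diff_left: 
  "f \<in> L2 \<Longrightarrow> g \<in> L2 \<Longrightarrow> h \<in> L2 \<Longrightarrow> L2_inner (\<lambda>x. f x - g x) h = L2_inner f h - L2_inner g h"
  by (simp add: L2_inner_def left_diff_distrib L2_inner_integrable)

lemma L2_inner_scale_left: "L2_inner (\<lambda>x. c * f x) g = c * L2_inner f g"
  by (simp add: L2_inner_def mult.assoc)

lemma L2_inner_commute: "L2_inner g f = cnj (L2_inner f g)"
  unfolding L2_inner_def by (simp flip: Bochner_Integration.integral_cnj add: mult.commute)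

lemma L2_inner_scale_right: "L2_inner f (\<lambda>x. c * g x) = cnj c * L2_inner f g"
  by (subst L2_inner_commute) (simp add: L2_inner_scale_left L2_inner_commute[of g f])

lemma L2_inner_sum_left: 
  assumes "\<And>i. i \<in> A \<Longrightarrow> f i \<in> L2" "g \<in> L2"
  shows "L2_inner (\<lambda>x. \<Sum>i\<in>A. f i x) g = (\<Sum>i\<in>A. L2_inner (f i) g)"
proof -
  have "L2_inner (\<lambda>x. \<Sum>i\<in>A. f i x) g = (LINT x|lebesgue. (\<Sum>i\<in>A. f i x * cnj (g x)))"
    by (simp add: L2_inner_def sum_distrib_right)
  also have "\<dots> = (\<Sum>i\<in>A. L2_inner (f i) g)"
    unfolding L2_inner_def by (rule Bochner_Integration.integral_sum) (use assms L2_inner_integrable in auto)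
  finally show ?thesis .
qed

lemma L2_norm_nonneg [simp]: "0 \<le> L2_norm f"
  by (simp add: L2_norm_def)

lemma L2_norm_square: "(L2_norm f)\<^sup>2 = (LINT x|lebesgue. (cmod (f x))\<^sup>2)"
  by (simp add: L2_norm_def)

lemma L2_norm_zero [simp]: "L2_norm (\<lambda>x. 0) = 0"
  by (simp add: L2_norm_def)

lemma L2_inner_self: "L2_inner f f = of_real ((L2_norm f)\<^sup>2)"
proof -
  have "f x * cnj (f x) = of_real ((cmod (f x))\<^sup>2)" for x
    by (simp only: complex_norm_square)
  then show ?thesis
    unfolding L2_inner_def L2_norm_square by (simp only: integral_complex_of_real)
qed

lemma L2_norm_scale: "L2_norm (\<lambda>x. c * f x) = cmod c * L2_norm f"
  by (simp add: L2_norm_def norm_mult power_mult_distrib real_sqrt_mult)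

lemma L2_norm_commute: "L2_norm (\<lambda>x. f x - g x) = L2_norm (\<lambda>x. g x - f x)"
  by (simp add: L2_norm_def norm_minus_commute)

lemma L2_norm_add_square:
  assumes "f \<in> L2" "g \<in> L2"
  shows "(L2_norm (\<lambda>x. f x + g x))\<^sup>2 = (L2_norm f)\<^sup>2 + 2 * Re (L2_inner f g) + (L2_norm g)\<^sup>2"
proof -
  have fg: "(\<lambda>x. f x + g x) \<in> L2" using assms by auto
  have "complex_of_real ((L2_norm (\<lambda>x. f x + g x))\<^sup>2)
      = L2_inner f (\<lambda>x. f x + g x) + L2_inner g (\<lambda>x. f x + g x)"
    using L2_inner_add_left[OF assms fg] by (simp only: L2_inner_self)
  also have "\<dots> = cnj (L2_inner f f + L2_inner g f) + cnj (L2_inner f g + L2_inner g g)"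
    by (subst (1 2) L2_inner_commute) (use assms in \<open>simp add: L2_inner_add_left\<close>)
  also have "\<dots> = of_real ((L2_norm f)\<^sup>2 + (L2_norm g)\<^sup>2) + (L2_inner f g + cnj (L2_inner f g))"
    by (subst L2_inner_commute[of g f]) (simp add: L2_inner_self)
  also have "L2_inner f g + cnj (L2_inner f g) = of_real (2 * Re (L2_inner f g))"
    by (simp add: complex_add_cnj)
  finally show ?thesis
    by (simp only: of_real_add[symmetric] of_real_eq_iff)
qed

lemma L2_norm_diff_square:
  assumes "f \<in> L2" "g \<in> L2"
  shows "(L2_norm (\<lambda>x. f x - g x))\<^sup>2 = (L2_norm f)\<^sup>2 - 2 * Re (L2_inner f g) + (L2_norm g)\<^sup>2"
proof -
  have "Re (L2_inner f (\<lambda>x. - 1 * g x)) = - Re (L2_inner f g)"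
    by (subst L2_inner_commute, subst L2_inner_scale_left) (simp add: L2_inner_commute[of g f])
  then show ?thesis
    using L2_norm_add_square[OF assms(1) L2_scale[OF assms(2), of "- 1"]] L2_norm_scale[of "- 1" g]
    by simp
qed

text \<open>Optimizing over \<open>t\<close> turns the inequality \<open>0 \<le> \<parallel>\<surd>t f - g/\<surd>t\<parallel>\<^sup>2\<close> into the
  Cauchy-Schwarz inequality, without a separate case for functions of norm \<open>0\<close>.\<close>
lemma real_le_mult_of_AM_GM:
  fixes X a b :: real
  assumes le: "\<And>t. t > 0 \<Longrightarrow> 2 * X \<le> t * a\<^sup>2 + b\<^sup>2 / t" and "0 \<le> a" "0 \<le> b"
  shows "X \<le> a * b"
proof (rule field_le_epsilon)
  fix e :: real assume "e > 0"
  define d where "d = e / (a + b + 1)"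
  have "d > 0" using assms \<open>e > 0\<close> by (simp add: d_def)
  \<comment> \<open>The minimizer is \<open>b / a\<close>; the shift by \<open>d\<close> keeps \<open>t\<close> positive and defined if \<open>a\<close> or \<open>b\<close> vanishes.\<close>
  define t where "t = (b + d) / (a + d)"
  have "t > 0" using assms \<open>d > 0\<close> by (simp add: t_def)
  have "t * a\<^sup>2 \<le> t * (a * (a + d))"
    using \<open>t > 0\<close> \<open>0 \<le> a\<close> \<open>d > 0\<close> by (simp add: power2_eq_square mult_left_mono)
  also have "\<dots> = a * (b + d)" using \<open>0 \<le> a\<close> \<open>d > 0\<close> by (simp add: t_def)
  finally have 1: "t * a\<^sup>2 \<le> a * (b + d)" .
  have "b\<^sup>2 / t \<le> b * (b + d) / t"
    using \<open>t > 0\<close> \<open>0 \<le> b\<close> \<open>d > 0\<close> by (intro divide_right_mono) (auto simp: power2_eq_square mult_left_mono)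
  also have "\<dots> = b * (a + d)" using \<open>0 \<le> b\<close> \<open>d > 0\<close> by (simp add: t_def)
  finally have 2: "b\<^sup>2 / t \<le> b * (a + d)" .
  have "(a + b) * d \<le> e"
    using assms \<open>e > 0\<close> by (simp add: d_def field_simps)
  then have "2 * (a * b) + (a + b) * d \<le> 2 * (a * b + e)"
    using \<open>e > 0\<close> by simp
  moreover have "2 * X \<le> a * (b + d) + b * (a + d)"
    using le[OF \<open>t > 0\<close>] 1 2 by linarith
  ultimately show "X \<le> a * b + e"
    by (simp add: algebra_simps)
qed

lemma Re_L2_inner_le:
  assumes "f \<in> L2" "g \<in> L2"
  shows "Re (L2_inner f g) \<le> L2_norm f * L2_norm g"
proof (rule real_le_mult_of_AM_GM)
  fix t :: real assume "t > 0"
  have s: "sqrt t > 0" "(sqrt t)\<^sup>2 = t" using \<open>t > 0\<close> by auto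
  have "0 \<le> (L2_norm (\<lambda>x. of_real (sqrt t) * f x - of_real (1 / sqrt t) * g x))\<^sup>2" by simp
  also have "\<dots> = t * (L2_norm f)\<^sup>2 - 2 * Re (L2_inner f g) + (L2_norm g)\<^sup>2 / t"
  proof -
    have "L2_inner (\<lambda>x. of_real (sqrt t) * f x) (\<lambda>x. of_real (1 / sqrt t) * g x) = L2_inner f g"
      by (subst L2_inner_scale_left, subst L2_inner_commute, subst L2_inner_scale_left)
         (use s in \<open>simp add: L2_inner_commute[of g f]\<close>)
    then show ?thesis
      using s \<open>t > 0\<close> L2_norm_diff_square[OF L2_scale[OF assms(1)] L2_scale[OF assms(2)],
        of "of_real (sqrt t)" "of_real (1 / sqrt t)"]
        L2_norm_scale[of "of_real (sqrt t)" f] L2_norm_scale[of "of_real (1 / sqrt t)" g]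
      by (simp add: power_mult_distrib power_divide norm_divide)
  qed
  finally show "2 * Re (L2_inner f g) \<le> t * (L2_norm f)\<^sup>2 + (L2_norm g)\<^sup>2 / t" by simp
qed simp_all

lemma L2_norm_triangle:
  assumes "f \<in> L2" "g \<in> L2"
  shows "L2_norm (\<lambda>x. f x + g x) \<le> L2_norm f + L2_norm g"
proof (rule power2_le_imp_le)
  show "(L2_norm (\<lambda>x. f x + g x))\<^sup>2 \<le> (L2_norm f + L2_norm g)\<^sup>2"
    using Re_L2_inner_le[OF assms] L2_norm_add_square[OF assms] by (simp add: power2_sum)
qed simp

lemma L2_norm_triangle_diff:
  assumes "f \<in> L2" "g \<in> L2" "h \<in> L2"
  shows "L2_norm (\<lambda>x. f x - h x) \<le> L2_norm (\<lambda>x. f x - g x) + L2_norm (\<lambda>x. g x - h x)"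
  using L2_norm_triangle[OF L2_diff[OF assms(1,2)] L2_diff[OF assms(2,3)]] by simp

lemma L2_norm_diff_ge: 
  assumes "f \<in> L2" "g \<in> L2"
  shows "\<bar>L2_norm f - L2_norm g\<bar> \<le> L2_norm (\<lambda>x. f x - g x)"
  using L2_norm_triangle[OF L2_diff[OF assms] assms(2)]
    L2_norm_triangle[OF L2_diff[OF assms(2,1)] assms(1)] L2_norm_commute[of f g]
  by auto

lemma L2_norm_eq_0_iff:
  assumes "f \<in> L2" shows "L2_norm f = 0 \<longleftrightarrow> (AE x in lebesgue. f x = 0)"
  using integral_nonneg_eq_0_iff_AE[OF L2_integrable[OF assms]] by (simp add: L2_norm_def)

lemma L2_norm_cong_AE:
  assumes "f \<in> L2" "g \<in> L2" "AE x in lebesgue. f x = g x" shows "L2_norm f = L2_norm g"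
proof -
  have "(LINT x|lebesgue. (cmod (f x))\<^sup>2) = (LINT x|lebesgue. (cmod (g x))\<^sup>2)"
    by (rule integral_cong_AE) (use assms L2_measurable L2_integrable in auto)
  then show ?thesis by (simp add: L2_norm_def)
qed

lemma nn_integral_L2_norm:
  "f \<in> L2 \<Longrightarrow> (\<integral>\<^sup>+x. ennreal ((cmod (f x))\<^sup>2) \<partial>lebesgue) = ennreal ((L2_norm f)\<^sup>2)"
  by (simp add: L2_norm_square nn_integral_eq_integral L2_integrable)

text \<open>Finiteness of the extended integral yields membership in \<open>L\<^sup>2\<close>, so that an isometry proved with
  nonnegative integrals also shows that its values are square integrable.\<close>
lemma L2_of_nn_integral:
  assumes "f \<in> borel_measurable lebesgue" "(\<integral>\<^sup>+x. ennreal ((cmod (f x))\<^sup>2) \<partial>lebesgue) = ennreal (c\<^sup>2)" "0 \<le> c"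
  shows "f \<in> L2" "L2_norm f = c"
proof -
  show *: "f \<in> L2"
    using assms by (auto simp: L2_def integrable_iff_bounded)
  show "L2_norm f = c"
    using nn_integral_L2_norm[OF *] assms by (simp add: power2_eq_iff_nonneg)
qed

lemma L2_dominated_convergence:
  assumes f: "f \<in> L2" and W: "W \<in> L2" and s: "\<And>n. s n \<in> borel_measurable lebesgue"
    and bound: "\<And>n x. cmod (s n x) \<le> cmod (W x)"
    and lim: "\<And>x. (\<lambda>n. s n x) \<longlonglongrightarrow> f x"
  shows "(\<lambda>n. L2_norm (\<lambda>x. f x - s n x)) \<longlonglongrightarrow> 0"
proof -
  have f_le: "cmod (f x) \<le> cmod (W x)" for x
    by (rule LIMSEQ_le_const2[OF tendsto_norm[OF lim]]) (use bound in auto)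
  have "(\<lambda>n. LINT x|lebesgue. (cmod (f x - s n x))\<^sup>2) \<longlonglongrightarrow> (LINT x::real|lebesgue. 0 :: real)"
  proof (rule integral_dominated_convergence[where w = "\<lambda>x. 4 * (cmod (W x))\<^sup>2"])
    show "integrable lebesgue (\<lambda>x. 4 * (cmod (W x))\<^sup>2)"
      using W by (simp add: L2_integrable)
    show "AE x in lebesgue. (\<lambda>n. (cmod (f x - s n x))\<^sup>2) \<longlonglongrightarrow> 0"
    proof (rule AE_I2)
      fix x
      have "(\<lambda>n. (cmod (f x - s n x))\<^sup>2) \<longlonglongrightarrow> (cmod (f x - f x))\<^sup>2"
        by (intro tendsto_intros lim)
      then show "(\<lambda>n. (cmod (f x - s n x))\<^sup>2) \<longlonglongrightarrow> 0" by simp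
    qed
    show "AE x in lebesgue. norm ((cmod (f x - s n x))\<^sup>2) \<le> 4 * (cmod (W x))\<^sup>2" for n
    proof (rule AE_I2)
      fix x
      have "cmod (f x - s n x) \<le> 2 * cmod (W x)"
        using norm_triangle_ineq4[of "f x" "s n x"] bound[of n x] f_le[of x] by simp
      then have "(cmod (f x - s n x))\<^sup>2 \<le> (2 * cmod (W x))\<^sup>2"
        by (rule power_mono) simp
      then show "norm ((cmod (f x - s n x))\<^sup>2) \<le> 4 * (cmod (W x))\<^sup>2"
        by (simp add: power_mult_distrib)
    qed
  qed (use f s L2_measurable in auto)
  then have "(\<lambda>n. sqrt (LINT x|lebesgue. (cmod (f x - s n x))\<^sup>2)) \<longlonglongrightarrow> sqrt 0"
    by (intro tendsto_real_sqrt) simp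
  then show ?thesis by (simp add: L2_norm_def)
qed

section \<open>Closed spans and Parseval's identity\<close>

text \<open>The density condition in \<open>L2_orthonormal_basis e V\<close> says, for \<open>V \<subseteq> L2\<close>, that
  \<open>V\<close> is contained in this set.
  Membership is proved with closure under sums, multiples and limits, which avoids explicit
  coefficients.\<close>
definition L2_closed_span :: "('i \<Rightarrow> real \<Rightarrow> complex) \<Rightarrow> (real \<Rightarrow> complex) set" where
  "L2_closed_span e =
    {f \<in> L2. \<forall>\<epsilon>>0. \<exists>A c. finite A \<and> L2_norm (\<lambda>x. f x - (\<Sum>i\<in>A. c i * e i x)) < \<epsilon>}"

definition L2_orthonormal :: "('i \<Rightarrow> real \<Rightarrow> complex) \<Rightarrow> bool" where
  "L2_orthonormal e \<longleftrightarrow>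
    (\<forall>i. e i \<in> L2) \<and> (\<forall>i j. L2_inner (e i) (e j) = (if i = j then 1 else 0))"

lemma closed_span_L2: "f \<in> L2_closed_span e \<Longrightarrow> f \<in> L2"
  by (simp add: L2_closed_span_def)

lemma closed_span_approx:
  assumes "f \<in> L2_closed_span e" "\<epsilon> > 0"
  obtains A c where "finite A" "L2_norm (\<lambda>x. f x - (\<Sum>i\<in>A. c i * e i x)) < \<epsilon>"
  using assms unfolding L2_closed_span_def by blast

lemma closed_spanI:
  assumes "f \<in> L2" "\<And>\<epsilon>. \<epsilon> > 0 \<Longrightarrow> \<exists>A c. finite A \<and> L2_norm (\<lambda>x. f x - (\<Sum>i\<in>A. c i * e i x)) < \<epsilon>"
  shows "f \<in> L2_closed_span e"
  using assms by (simp add: L2_closed_span_def)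

lemma closed_span_generator:
  assumes "e i \<in> L2" shows "e i \<in> L2_closed_span e"
proof (rule closed_spanI[OF assms])
  show "\<exists>A c. finite A \<and> L2_norm (\<lambda>x. e i x - (\<Sum>j\<in>A. c j * e j x)) < \<epsilon>" if "\<epsilon> > 0" for \<epsilon>
    using that by (intro exI[of _ "{i}"] exI[of _ "\<lambda>_. 1"]) simp
qed

lemma closed_span_scale:
  assumes f: "f \<in> L2_closed_span e"
  shows "(\<lambda>x. a * f x) \<in> L2_closed_span e"
proof (rule closed_spanI)
  fix \<epsilon> :: real assume "\<epsilon> > 0"
  obtain A c where A: "finite A" "L2_norm (\<lambda>x. f x - (\<Sum>i\<in>A. c i * e i x)) < \<epsilon> / (cmod a + 1)"
    using closed_span_approx[OF f, of "\<epsilon> / (cmod a + 1)"] \<open>\<epsilon> > 0\<close>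
    by (auto simp: add_nonneg_pos)
  have eq: "(\<lambda>x. a * f x - (\<Sum>i\<in>A. a * c i * e i x)) = (\<lambda>x. a * (f x - (\<Sum>i\<in>A. c i * e i x)))"
    by (simp add: algebra_simps sum_distrib_left)
  have "L2_norm (\<lambda>x. a * f x - (\<Sum>i\<in>A. a * c i * e i x))
      = cmod a * L2_norm (\<lambda>x. f x - (\<Sum>i\<in>A. c i * e i x))"
    unfolding eq by (rule L2_norm_scale)
  also have "\<dots> \<le> (cmod a + 1) * L2_norm (\<lambda>x. f x - (\<Sum>i\<in>A. c i * e i x))"
    by (intro mult_right_mono) auto
  also have "\<dots> < \<epsilon>"
    using A(2) pos_less_divide_eq[of "cmod a + 1"] norm_ge_zero[of a]
    by (simp add: add_nonneg_pos mult.commute)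
  finally show "\<exists>A c. finite A \<and> L2_norm (\<lambda>x. a * f x - (\<Sum>i\<in>A. c i * e i x)) < \<epsilon>"
    using A(1) by (intro exI[of _ A] exI[of _ "\<lambda>i. a * c i"]) simp
qed (use closed_span_L2[OF f] in auto)

lemma closed_span_add:
  assumes e: "\<And>i. e i \<in> L2" and f: "f \<in> L2_closed_span e" and g: "g \<in> L2_closed_span e"
  shows "(\<lambda>x. f x + g x) \<in> L2_closed_span e"
proof (rule closed_spanI)
  fix \<epsilon> :: real assume "\<epsilon> > 0"
  obtain A c where A: "finite A" "L2_norm (\<lambda>x. f x - (\<Sum>i\<in>A. c i * e i x)) < \<epsilon> / 2"
    using closed_span_approx[OF f, of "\<epsilon> / 2"] \<open>\<epsilon> > 0\<close> by auto
  obtain B d where B: "finite B" "L2_norm (\<lambda>x. g x - (\<Sum>i\<in>B. d i * e i x)) < \<epsilon> / 2"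
    using closed_span_approx[OF g, of "\<epsilon> / 2"] \<open>\<epsilon> > 0\<close> by auto
  define b where "b i = (if i \<in> A then c i else 0) + (if i \<in> B then d i else 0)" for i
  have b: "(\<Sum>i\<in>A \<union> B. b i * e i x) = (\<Sum>i\<in>A. c i * e i x) + (\<Sum>i\<in>B. d i * e i x)" for x
  proof -
    have "(\<Sum>i\<in>A \<union> B. (if i \<in> A then c i else 0) * e i x) = (\<Sum>i\<in>A. c i * e i x)"
      using A(1) B(1) by (intro sum.mono_neutral_cong_right) auto
    moreover have "(\<Sum>i\<in>A \<union> B. (if i \<in> B then d i else 0) * e i x) = (\<Sum>i\<in>B. d i * e i x)"
      using A(1) B(1) by (intro sum.mono_neutral_cong_right) auto
    ultimately show ?thesis by (simp only: b_def distrib_right sum.distrib)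
  qed
  have "(\<lambda>x. f x - (\<Sum>i\<in>A. c i * e i x)) \<in> L2" "(\<lambda>x. g x - (\<Sum>i\<in>B. d i * e i x)) \<in> L2"
    by (intro L2_diff L2_sum L2_scale e closed_span_L2[OF f] closed_span_L2[OF g])+
  from L2_norm_triangle[OF this]
  have "L2_norm (\<lambda>x. (f x - (\<Sum>i\<in>A. c i * e i x)) + (g x - (\<Sum>i\<in>B. d i * e i x))) < \<epsilon>"
    using A(2) B(2) by linarith
  then have "L2_norm (\<lambda>x. f x + g x - (\<Sum>i\<in>A \<union> B. b i * e i x)) < \<epsilon>"
    by (simp add: b algebra_simps)
  then show "\<exists>A c. finite A \<and> L2_norm (\<lambda>x. f x + g x - (\<Sum>i\<in>A. c i * e i x)) < \<epsilon>"
    using A(1) B(1) by (intro exI[of _ "A \<union> B"] exI[of _ b]) simp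
qed (use closed_span_L2[OF f] closed_span_L2[OF g] in auto)

lemma closed_span_zero: "(\<lambda>x. 0) \<in> L2_closed_span e"
proof (rule closed_spanI)
  show "\<exists>A c. finite A \<and> L2_norm (\<lambda>x. 0 - (\<Sum>i\<in>A. c i * e i x)) < \<epsilon>" if "\<epsilon> > 0" for \<epsilon>
    using that by (intro exI[of _ "{}"] exI[of _ "\<lambda>_. 0"]) simp
qed simp

lemma closed_span_sum:
  assumes "\<And>i. e i \<in> L2" "\<And>j. j \<in> J \<Longrightarrow> f j \<in> L2_closed_span e"
  shows "(\<lambda>x. \<Sum>j\<in>J. f j x) \<in> L2_closed_span e"
  using assms(2) 
  by (induction J rule: infinite_finite_induct) (auto simp: closed_span_zero intro!: closed_span_add assms(1))

lemma closed_span_closed: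
  assumes e: "\<And>i. e i \<in> L2" and f: "f \<in> L2"
    and lim: "\<And>\<epsilon>. \<epsilon> > 0 \<Longrightarrow> \<exists>h\<in>L2_closed_span e. L2_norm (\<lambda>x. f x - h x) < \<epsilon>"
  shows "f \<in> L2_closed_span e"
proof (rule closed_spanI[OF f])
  fix \<epsilon> :: real assume "\<epsilon> > 0"
  obtain h where h: "h \<in> L2_closed_span e" "L2_norm (\<lambda>x. f x - h x) < \<epsilon> / 2"
    using lim[of "\<epsilon> / 2"] \<open>\<epsilon> > 0\<close> by auto
  obtain A c where A: "finite A" "L2_norm (\<lambda>x. h x - (\<Sum>i\<in>A. c i * e i x)) < \<epsilon> / 2"
    using closed_span_approx[OF h(1), of "\<epsilon> / 2"] \<open>\<epsilon> > 0\<close> by auto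
  have "(\<lambda>x. \<Sum>i\<in>A. c i * e i x) \<in> L2" by (intro L2_sum L2_scale e)
  from L2_norm_triangle_diff[OF f closed_span_L2[OF h(1)] this]
  have "L2_norm (\<lambda>x. f x - (\<Sum>i\<in>A. c i * e i x)) < \<epsilon>"
    using h(2) A(2) by linarith
  with A(1) show "\<exists>A c. finite A \<and> L2_norm (\<lambda>x. f x - (\<Sum>i\<in>A. c i * e i x)) < \<epsilon>" by blast
qed

lemma closed_span_limit:
  assumes e: "\<And>i. e i \<in> L2" and s: "\<And>n. s n \<in> L2_closed_span e" and f: "f \<in> L2"
    and lim: "(\<lambda>n. L2_norm (\<lambda>x. f x - s n x)) \<longlonglongrightarrow> 0"
  shows "f \<in> L2_closed_span e"
proof (rule closed_span_closed[OF e f])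
  fix \<epsilon> :: real assume "\<epsilon> > 0"
  obtain n where "L2_norm (\<lambda>x. f x - s n x) < \<epsilon>"
    using order_tendstoD(2)[OF lim \<open>\<epsilon> > 0\<close>] by (auto simp: eventually_sequentially)
  then show "\<exists>h\<in>L2_closed_span e. L2_norm (\<lambda>x. f x - h x) < \<epsilon>" using s by blast
qed

lemma L2_inner_sum_right:
  assumes "\<And>i. i \<in> A \<Longrightarrow> e i \<in> L2" "f \<in> L2"
  shows "L2_inner f (\<lambda>x. \<Sum>i\<in>A. c i * e i x) = (\<Sum>i\<in>A. cnj (c i) * L2_inner f (e i))"
proof -
  have "L2_inner (\<lambda>x. \<Sum>i\<in>A. c i * e i x) f = (\<Sum>i\<in>A. c i * L2_inner (e i) f)"
    using assms L2_inner_sum_left[of A "\<lambda>i x. c i * e i x" f]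
    by (auto simp: L2_inner_scale_left intro: L2_scale)
  then show ?thesis
    by (subst L2_inner_commute) (simp add: L2_inner_commute[of _ f])
qed

text \<open>If \<open>f\<close> is orthogonal to a finite combination \<open>P\<close>, then \<open>\<parallel>f - P\<parallel>\<^sup>2 = \<parallel>f\<parallel>\<^sup>2 + \<parallel>P\<parallel>\<^sup>2\<close>; so no such
  \<open>P\<close> is closer to \<open>f\<close> than \<open>0\<close> is.\<close>
lemma orthogonal_to_closed_span:
  assumes e: "\<And>i. e i \<in> L2" and f: "f \<in> L2_closed_span e" and orth: "\<And>i. L2_inner f (e i) = 0"
  shows "L2_norm f = 0"
proof -
  note fL = closed_span_L2[OF f]
  have "L2_norm f \<le> 0 + \<epsilon>" if "\<epsilon> > 0" for \<epsilon>
  proof -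
    obtain A c where A: "finite A" "L2_norm (\<lambda>x. f x - (\<Sum>i\<in>A. c i * e i x)) < \<epsilon>"
      using closed_span_approx[OF f \<open>\<epsilon> > 0\<close>] by blast
    have P: "(\<lambda>x. \<Sum>i\<in>A. c i * e i x) \<in> L2" by (intro L2_sum L2_scale e)
    have "(L2_norm f)\<^sup>2 \<le> (L2_norm (\<lambda>x. f x - (\<Sum>i\<in>A. c i * e i x)))\<^sup>2"
      using L2_norm_diff_square[OF fL P] L2_inner_sum_right[of A e f c] e fL orth by simp
    then have "L2_norm f \<le> L2_norm (\<lambda>x. f x - (\<Sum>i\<in>A. c i * e i x))"
      by (rule power2_le_imp_le) simp
    then show ?thesis using A(2) by simp
  qed
  then have "L2_norm f \<le> 0" by (rule field_le_epsilon) 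
  then show ?thesis by (simp add: order_antisym)
qed

text \<open>Arbitrary coefficients \<open>c\<close> are needed: the coefficients \<open>\<langle>f, e\<^sub>i\<rangle>\<close> give Bessel's inequality, and those of a
  good approximation bound the Bessel sum from below.\<close>
lemma orthonormal_pythagoras:
  assumes e: "L2_orthonormal e" and f: "f \<in> L2" and A: "finite A"
  shows "(L2_norm (\<lambda>x. f x - (\<Sum>i\<in>A. c i * e i x)))\<^sup>2
      = (L2_norm f)\<^sup>2 - (\<Sum>i\<in>A. (cmod (L2_inner f (e i)))\<^sup>2) + (\<Sum>i\<in>A. (cmod (c i - L2_inner f (e i)))\<^sup>2)"
proof -
  define P where "P = (\<lambda>x. \<Sum>i\<in>A. c i * e i x)"
  have eL: "e i \<in> L2" for i using e by (simp add: L2_orthonormal_def)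
  have P: "P \<in> L2" unfolding P_def by (intro L2_sum L2_scale eL)
  have fP: "L2_inner f P = (\<Sum>i\<in>A. cnj (c i) * L2_inner f (e i))"
    unfolding P_def by (rule L2_inner_sum_right) (use eL f in auto)
  have Pe: "L2_inner (e j) P = cnj (c j)" if "j \<in> A" for j
  proof -
    have "L2_inner (e j) P = (\<Sum>i\<in>A. cnj (c i) * L2_inner (e j) (e i))"
      unfolding P_def by (rule L2_inner_sum_right) (use eL in auto)
    also have "\<dots> = (\<Sum>i\<in>A. if i = j then cnj (c i) else 0)"
      using e by (intro sum.cong) (auto simp: L2_orthonormal_def)
    also have "\<dots> = cnj (c j)" using A that by simp
    finally show ?thesis .
  qed
  have "complex_of_real ((L2_norm P)\<^sup>2) = L2_inner P P" by (simp only: L2_inner_self)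
  also have "\<dots> = (\<Sum>i\<in>A. cnj (c i) * L2_inner P (e i))"
    by (subst (2) P_def, rule L2_inner_sum_right) (use eL P in auto)
  also have "\<dots> = (\<Sum>i\<in>A. complex_of_real ((cmod (c i))\<^sup>2))"
    by (intro sum.cong refl, subst L2_inner_commute) (simp add: Pe complex_norm_square mult.commute del: of_real_power)
  finally have PP: "(L2_norm P)\<^sup>2 = (\<Sum>i\<in>A. (cmod (c i))\<^sup>2)"
    by (simp only: of_real_sum[symmetric] of_real_eq_iff)
  have expand: "(cmod (c - a))\<^sup>2 = (cmod c)\<^sup>2 - 2 * Re (cnj c * a) + (cmod a)\<^sup>2" for a c
    unfolding cmod_power2 by (simp add: power2_eq_square algebra_simps)
  have "(L2_norm (\<lambda>x. f x - P x))\<^sup>2 = (L2_norm f)\<^sup>2 - 2 * Re (L2_inner f P) + (L2_norm P)\<^sup>2"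
    by (rule L2_norm_diff_square[OF f P])
  also have "\<dots> = (L2_norm f)\<^sup>2 - (\<Sum>i\<in>A. (cmod (L2_inner f (e i)))\<^sup>2) + (\<Sum>i\<in>A. (cmod (c i - L2_inner f (e i)))\<^sup>2)"
    unfolding fP PP expand by (simp add: sum.distrib sum_subtractf Re_sum sum_distrib_left)
  finally show ?thesis unfolding P_def .
qed

lemma parseval:
  assumes e: "L2_orthonormal e" and f: "f \<in> L2_closed_span e"
  shows "((\<lambda>i. (cmod (L2_inner f (e i)))\<^sup>2) has_sum (L2_norm f)\<^sup>2) UNIV"
  unfolding has_sum_def
proof (rule tendstoI)
  note fL = closed_span_L2[OF f]
  let ?s = "\<lambda>A. \<Sum>i\<in>A. (cmod (L2_inner f (e i)))\<^sup>2"
  fix \<epsilon> :: real assume "\<epsilon> > 0"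
  obtain A c where A: "finite A" "L2_norm (\<lambda>x. f x - (\<Sum>i\<in>A. c i * e i x)) < sqrt \<epsilon>"
    using closed_span_approx[OF f, of "sqrt \<epsilon>"] \<open>\<epsilon> > 0\<close> by auto
  have "(L2_norm (\<lambda>x. f x - (\<Sum>i\<in>A. c i * e i x)))\<^sup>2 < (sqrt \<epsilon>)\<^sup>2"
    by (rule power_strict_mono[OF A(2)]) auto
  then have lower: "(L2_norm f)\<^sup>2 - ?s A < \<epsilon>"
    using \<open>\<epsilon> > 0\<close> sum_nonneg[of A "\<lambda>i. (cmod (c i - L2_inner f (e i)))\<^sup>2"]
    unfolding orthonormal_pythagoras[OF e fL A(1)] by simp
  have "dist (?s B) ((L2_norm f)\<^sup>2) < \<epsilon>" if B: "finite B" "A \<subseteq> B" for B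
  proof -
    have "0 \<le> (L2_norm (\<lambda>x. f x - (\<Sum>i\<in>B. L2_inner f (e i) * e i x)))\<^sup>2" by simp
    then have "?s B \<le> (L2_norm f)\<^sup>2"
      unfolding orthonormal_pythagoras[OF e fL B(1)] by simp
    moreover have "?s A \<le> ?s B"
      using B by (intro sum_mono2) auto
    ultimately show ?thesis using lower by (simp add: dist_real_def)
  qed
  then show "\<forall>\<^sub>F B in finite_subsets_at_top UNIV. dist (?s B) ((L2_norm f)\<^sup>2) < \<epsilon>"
    unfolding eventually_finite_subsets_at_top using A(1) by (intro exI[of _ A]) auto
qed

section \<open>Completeness of the exponentials\<close>

definition char_on :: "real set \<Rightarrow> int \<Rightarrow> real \<Rightarrow> complex" where
  "char_on S k x = indicator S x * cis (2 * pi * of_int k * x)"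

text \<open>Generating trigonometric polynomials from monomials by sums makes closure under products a double
  induction, with no bookkeeping of convolved coefficients.\<close>
inductive trig_poly :: "(real \<Rightarrow> complex) \<Rightarrow> bool" where
  monom: "trig_poly (\<lambda>x. c * cis (2 * pi * of_int k * x))"
| add: "trig_poly f \<Longrightarrow> trig_poly g \<Longrightarrow> trig_poly (\<lambda>x. f x + g x)"

lemma trig_poly_mult:
  assumes "trig_poly f" "trig_poly g" shows "trig_poly (\<lambda>x. f x * g x)"
proof -
  have *: "trig_poly (\<lambda>x. c * cis (2 * pi * of_int k * x) * g x)" for c k
    using assms(2)
  proof induction
    case (monom d l)
    have "(\<lambda>x. c * cis (2 * pi * of_int k * x) * (d * cis (2 * pi * of_int l * x)))
        = (\<lambda>x. (c * d) * cis (2 * pi * of_int (k + l) * x))"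
      by (auto simp: cis_mult algebra_simps)
    then show ?case by (simp only: trig_poly.monom)
  next
    case (add f g)
    then show ?case using trig_poly.add by (simp add: distrib_left)
  qed
  show ?thesis
    using assms(1) by induction (use * trig_poly.add in \<open>auto simp: distrib_right\<close>)
qed

text \<open>A real-linear functional on the plane, restricted to the unit circle, is a combination of
  \<open>cos t\<close> and \<open>sin t\<close>, hence of \<open>cis t\<close> and \<open>cis (-t)\<close>; polynomials are generated by
  such functionals.\<close>
lemma trig_poly_of_polynomial:
  assumes "real_polynomial_function g"
  shows "trig_poly (\<lambda>x. of_real (g (cis (2 * pi * x))))"
  using assms
proof induction
  case (linear g)
  interpret g: bounded_linear g by fact
  have "g (cis t) = g (cos t *\<^sub>R 1 + sin t *\<^sub>R \<i>)" for t
    by (rule arg_cong[where f = g]) (simp add: complex_eq_iff)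
  then have "g (cis t) = cos t * g 1 + sin t * g \<i>" for t
    by (simp add: g.add g.scaleR)
  then have "complex_of_real (g (cis t))
     = (of_real (g 1) - \<i> * of_real (g \<i>)) / 2 * cis t + (of_real (g 1) + \<i> * of_real (g \<i>)) / 2 * cis (- t)" for t
    by (simp add: complex_eq_iff algebra_simps diff_divide_distrib add_divide_distrib)
  then have "(\<lambda>x. complex_of_real (g (cis (2 * pi * x))))
     = (\<lambda>x. (of_real (g 1) - \<i> * of_real (g \<i>)) / 2 * cis (2 * pi * of_int 1 * x)
        + (of_real (g 1) + \<i> * of_real (g \<i>)) / 2 * cis (2 * pi * of_int (- 1) * x))"
    by simp
  then show ?case by (simp only: trig_poly.intros)
next
  case (const c)
  then show ?case using trig_poly.monom[of "of_real c" 0] by simp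
qed (use trig_poly.add trig_poly_mult in auto)

lemma cis_measurable [measurable]: "cis \<in> borel_measurable borel"
  by (intro borel_measurable_continuous_onI continuous_intros)

lemma ident_measurable_lebesgue [measurable]: "(\<lambda>x::real. x) \<in> borel_measurable lebesgue"
  by (simp add: measurable_completion)

lemma char_on_L2:
  assumes "S \<in> lmeasurable" shows "char_on S k \<in> L2"
proof -
  have "(\<lambda>x. cis (2 * pi * of_int k * x) * indicator S x) \<in> L2"
    by (rule L2_mult_bounded[OF L2_indicator[OF assms], where B = 1]) 
       auto
  then show ?thesis unfolding char_on_def by (simp add: mult.commute)
qed

lemma trig_poly_closed_span:
  assumes "trig_poly g" "S \<in> lmeasurable"
  shows "(\<lambda>x. indicator S x * g x) \<in> L2_closed_span (char_on S)"
  using assms(1)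
proof induction
  case (monom c k)
  show ?case
    using closed_span_scale[OF closed_span_generator[of "char_on S" k, OF char_on_L2[OF assms(2)]], of c]
    by (simp add: char_on_def[of S k] mult.left_commute)
next
  case (add f g)
  then show ?case
    using closed_span_add[OF char_on_L2[OF assms(2)]] by (simp add: distrib_left)
qed

lemma cis_eq_iff_int: "cis (2 * pi * x) = cis (2 * pi * y) \<longleftrightarrow> (\<exists>k::int. x = y + of_int k)"
proof -
  have "cis (2 * pi * x) = cis (2 * pi * y) \<longleftrightarrow> (\<exists>k::int. 2 * pi * x = 2 * pi * y + 2 * pi * of_int k)"
    using sin_cos_eq_iff[of "2 * pi * x" "2 * pi * y"] by (simp only: complex_eq_iff cis.sel) blast
  also have "\<dots> \<longleftrightarrow> (\<exists>k::int. x = y + of_int k)"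
    by (simp flip: distrib_left)
  finally show ?thesis .
qed

text \<open>As \<open>x \<mapsto> e\<^bsup>2\<pi>ix\<^esup>\<close> is injective on \<open>Q\<close>, the set \<open>C\<close> is the preimage in \<open>Q\<close> of its
  compact image \<open>D\<close> in the unit circle. The continuous functions \<open>max 0 (1 - n d(z, D))\<close> decrease to the
  indicator of \<open>D\<close>, and by the Stone-Weierstrass theorem each of them is uniformly close to a
  polynomial on the circle, which pulls back to a trigonometric polynomial.\<close>
lemma compact_indicator_closed_span:
  assumes Q: "Q \<in> lmeasurable" and inj: "inj_on (\<lambda>x. cis (2 * pi * x)) Q"
    and C: "compact C" "C \<subseteq> Q"
  shows "indicator C \<in> L2_closed_span (char_on Q)"
proof (cases "C = {}")
  case True
  then show ?thesis using closed_span_zero by (simp add: indicator_def[abs_def])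
next
  case False
  define D where "D = (\<lambda>x. cis (2 * pi * x)) ` C"
  have D: "compact D" "D \<noteq> {}"
    unfolding D_def using False C by (auto intro!: compact_continuous_image continuous_intros)
  define \<phi> where "\<phi> n z = max 0 (1 - real n * infdist z D)" for n z
  have "\<exists>g. real_polynomial_function g \<and> (\<forall>z\<in>sphere 0 1. \<bar>\<phi> n z - g z\<bar> < 1 / Suc n)" for n
  proof -
    have "continuous_on (sphere 0 1) (\<phi> n)"
      unfolding \<phi>_def by (intro continuous_intros)
    then obtain g where "real_polynomial_function g" "\<And>z. z \<in> sphere 0 1 \<Longrightarrow> \<bar>\<phi> n z - g z\<bar> < 1 / Suc n"
      using Stone_Weierstrass_real_polynomial_function[OF compact_sphere, of 0 1 "\<phi> n" "1 / Suc n"] by auto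
    then show ?thesis by blast
  qed
  then obtain g where g: "\<And>n. real_polynomial_function (g n)"
    "\<And>n z. z \<in> sphere 0 1 \<Longrightarrow> \<bar>\<phi> n z - g n z\<bar> < 1 / Suc n" by metis
  define s where "s n x = indicator Q x * complex_of_real (g n (cis (2 * pi * x)))" for n x
  have s_span: "s n \<in> L2_closed_span (char_on Q)" for n
    unfolding s_def by (intro trig_poly_closed_span trig_poly_of_polynomial g Q)
  have "(\<lambda>n. L2_norm (\<lambda>x. indicator C x - s n x)) \<longlonglongrightarrow> 0"
  proof (rule L2_dominated_convergence)
    show CL: "indicator C \<in> L2" by (intro L2_indicator lmeasurable_compact C)
    \<comment> \<open>The value \<open>2\<close> bounds \<open>\<bar>\<phi>\<^sub>n\<bar> \<le> 1\<close> plus the approximation error \<open>1 / (n + 1)\<close>.\<close>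
    show "(\<lambda>x. 2 * indicator Q x) \<in> L2" by (intro L2_scale L2_indicator Q)
    show "s n \<in> borel_measurable lebesgue" for n
      using closed_span_L2[OF s_span] L2_measurable by blast
    show "cmod (s n x) \<le> cmod (2 * indicator Q x)" for n x
    proof -
      have "\<bar>\<phi> n z\<bar> \<le> 1" for z using infdist_nonneg[of z D] by (auto simp: \<phi>_def)
      moreover have "1 / real (Suc n) \<le> 1" by simp
      ultimately have "\<bar>g n z\<bar> \<le> 2" if "z \<in> sphere 0 1" for z
        using g(2)[OF that, of n] by (smt (verit) that)
      then show ?thesis by (auto simp: s_def indicator_def)
    qed
    show "(\<lambda>n. s n x) \<longlonglongrightarrow> indicator C x" for x
    proof (cases "x \<in> Q")
      case False
      then have "x \<notin> C" using C by auto
      with False show ?thesis by (simp add: s_def)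
    next
      case True
      define z where "z = cis (2 * pi * x)"
      have zD: "z \<in> D \<longleftrightarrow> x \<in> C"
        using inj True C(2) by (auto simp: D_def z_def inj_on_def)
      have "eventually (\<lambda>n. \<phi> n z = indicator C x) sequentially"
      proof (cases "x \<in> C")
        case True
        with zD show ?thesis by (simp add: \<phi>_def)
      next
        case False
        then have "infdist z D > 0"
          using zD D in_closed_iff_infdist_zero[of D z] compact_imp_closed infdist_nonneg[of z D] by force
        moreover obtain N :: nat where "real N > 1 / infdist z D" using reals_Archimedean2 by blast
        ultimately have "1 \<le> real n * infdist z D" if "n \<ge> N" for n
          using that by (smt (verit, best) divide_less_eq mult_right_mono of_nat_mono)
        then have "\<phi> n z = 0" if "n \<ge> N" for n using that by (simp add: \<phi>_def)
        with False show ?thesis by (auto simp: eventually_sequentially)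
      qed
      then have "(\<lambda>n. \<phi> n z) \<longlonglongrightarrow> indicator C x"
        by (rule tendsto_eventually)
      moreover have "(\<lambda>n. \<phi> n z - g n z) \<longlonglongrightarrow> 0"
        by (rule tendsto_norm_zero_cancel, rule tendsto_sandwich[OF _ _ tendsto_const lim_inverse_n'[THEN LIMSEQ_Suc]])
           (use g(2)[of z] in \<open>auto simp: z_def intro!: always_eventually less_imp_le simp del: of_nat_Suc\<close>)
      ultimately have "(\<lambda>n. \<phi> n z - (\<phi> n z - g n z)) \<longlonglongrightarrow> indicator C x - 0"
        by (rule tendsto_diff)
      then have "(\<lambda>n. complex_of_real (g n z)) \<longlonglongrightarrow> of_real (indicator C x)"
        by (intro tendsto_of_real) simp
      moreover have "s n x = complex_of_real (g n z)" for n using True by (simp add: s_def z_def)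
      moreover have "complex_of_real (indicator C x) = indicator C x" by (simp add: indicator_def)
      ultimately show ?thesis by simp
    qed
  qed
  then show ?thesis
    by (intro closed_span_limit[OF char_on_L2[OF Q] s_span] L2_indicator lmeasurable_compact C)
qed

lemma measurable_indicator_closed_span:
  assumes Q: "Q \<in> lmeasurable" and inj: "inj_on (\<lambda>x. cis (2 * pi * x)) Q"
    and bd: "bounded Q" and A: "A \<in> sets lebesgue" "A \<subseteq> Q"
  shows "indicator A \<in> L2_closed_span (char_on Q)"
proof -
  have AL: "A \<in> lmeasurable" using fmeasurableI2[OF Q A(2,1)] .
  have "\<exists>C. compact C \<and> C \<subseteq> A \<and> A - C \<in> lmeasurable \<and> measure lebesgue (A - C) < 1 / Suc n" for n
  proof -
    obtain C where C: "closed C" "C \<subseteq> A" "A - C \<in> lmeasurable"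
      "emeasure lebesgue (A - C) < ennreal (1 / Suc n)"
      by (rule sets_lebesgue_inner_closed[OF A(1), of "1 / Suc n"]) auto
    have "compact C"
      using C(1,2) A(2) bd by (meson bounded_subset compact_eq_bounded_closed subset_trans)
    moreover have "measure lebesgue (A - C) < 1 / Suc n"
      using C(3,4) by (simp add: emeasure_eq_measure2 ennreal_less_iff)
    ultimately have "compact C \<and> C \<subseteq> A \<and> A - C \<in> lmeasurable \<and> measure lebesgue (A - C) < 1 / Suc n"
      using C by blast
    then show ?thesis by blast
  qed
  then obtain C where C: "\<And>n. compact (C n)" "\<And>n. C n \<subseteq> A" "\<And>n. A - C n \<in> lmeasurable"
    "\<And>n. measure lebesgue (A - C n) < 1 / Suc n" by metis
  have "L2_norm (\<lambda>x. indicator A x - indicator (C n) x) = sqrt (measure lebesgue (A - C n))" for n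
  proof -
    have "(cmod (indicator A x - indicator (C n) x))\<^sup>2 = indicat_real (A - C n) x" for x
      using C(2)[of n] by (auto simp: indicator_def)
    then show ?thesis by (simp add: L2_norm_def C(3) fmeasurableD)
  qed
  moreover have "(\<lambda>n. measure lebesgue (A - C n)) \<longlonglongrightarrow> 0"
    by (rule tendsto_sandwich[OF _ _ tendsto_const lim_inverse_n'[THEN LIMSEQ_Suc]])
       (use C(4) in \<open>auto intro!: always_eventually less_imp_le simp del: of_nat_Suc\<close>)
  then have "(\<lambda>n. sqrt (measure lebesgue (A - C n))) \<longlonglongrightarrow> sqrt 0"
    by (rule tendsto_real_sqrt)
  ultimately show ?thesis
    by (intro closed_span_limit[OF char_on_L2[OF Q] compact_indicator_closed_span[OF Q inj C(1)]]
        L2_indicator AL) (use C(2) A(2) in auto)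
qed

text \<open>Compact sets approximate measurable ones from inside, which gives simple functions and, by dominated
  convergence, all of \<open>L\<^sup>2(Q)\<close>. Injectivity enters because every combination of exponentials takes
  equal values at points that differ by an integer.\<close>
proposition exponentials_complete:
  assumes Q: "Q \<in> lmeasurable" and inj: "inj_on (\<lambda>x. cis (2 * pi * x)) Q"
    and bd: "bounded Q" and f: "f \<in> L2" "\<And>x. x \<notin> Q \<Longrightarrow> f x = 0"
  shows "f \<in> L2_closed_span (char_on Q)"
proof -
  obtain s where s: "\<And>i. simple_function lebesgue (s i)" "\<And>x. (\<lambda>i. s i x) \<longlonglongrightarrow> f x"
    "\<And>i x. cmod (s i x) \<le> 2 * cmod (f x)"
    using borel_measurable_implies_sequence_metric[OF L2_measurable[OF f(1)], of 0] by auto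
  have span: "s i \<in> L2_closed_span (char_on Q)" for i
  proof -
    define Y where "Y = range (s i) - {0}"
    have "finite Y" using simple_functionD(1)[OF s(1), of i] by (simp add: Y_def)
    have "s i x = (\<Sum>y\<in>Y. y * indicator (s i -` {y}) x)" for x
    proof (cases "s i x = 0")
      case True
      then show ?thesis by (auto simp: Y_def indicator_def intro!: sum.neutral[symmetric])
    next
      case False
      have "(\<Sum>y\<in>Y. y * indicator (s i -` {y}) x) = (\<Sum>y\<in>Y. if y = s i x then y else 0)"
        by (intro sum.cong) (auto simp: indicator_def)
      also have "\<dots> = s i x" using False \<open>finite Y\<close> by (simp add: Y_def)
      finally show ?thesis by simp
    qed
    then have "s i = (\<lambda>x. \<Sum>y\<in>Y. y * indicator (s i -` {y}) x)" by blast
    moreover have "(\<lambda>x. \<Sum>y\<in>Y. y * indicator (s i -` {y}) x) \<in> L2_closed_span (char_on Q)"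
    proof (intro closed_span_sum closed_span_scale char_on_L2 Q measurable_indicator_closed_span inj bd)
      fix y assume "y \<in> Y"
      show "s i -` {y} \<in> sets lebesgue" using simple_functionD(2)[OF s(1), of i "{y}"] by simp
      show "s i -` {y} \<subseteq> Q"
      proof
        fix x assume "x \<in> s i -` {y}"
        then have "s i x \<noteq> 0" using \<open>y \<in> Y\<close> by (simp add: Y_def)
        with s(3)[of i x] have "f x \<noteq> 0" by auto
        with f(2) show "x \<in> Q" by blast
      qed
    qed
    ultimately show ?thesis by simp
  qed
  have "(\<lambda>i. L2_norm (\<lambda>x. f x - s i x)) \<longlonglongrightarrow> 0"
    by (rule L2_dominated_convergence[where W = "\<lambda>x. 2 * f x"])
       (use f s L2_measurable[OF closed_span_L2[OF span]] in \<open>auto simp: norm_mult\<close>)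
  then show ?thesis
    by (rule closed_span_limit[OF char_on_L2[OF Q] span f(1)])
qed

section \<open>Integer tiles and Parseval's identity for Fourier coefficients\<close>

definition integer_tile :: "real set \<Rightarrow> bool" where
  "integer_tile S \<longleftrightarrow> (\<forall>x. \<exists>!k::int. x + of_int k \<in> S)"

lemma integer_tile_ex:
  assumes "integer_tile S" shows "\<exists>k::int. x + of_int k \<in> S"
proof -
  have "\<exists>!k::int. x + of_int k \<in> S" using assms unfolding integer_tile_def by (rule spec)
  then show ?thesis by (rule ex1_implies_ex)
qed

lemma integer_tile_unique:
  assumes "integer_tile S" "x + of_int k \<in> S" "x + of_int l \<in> S" shows "k = l"
proof -
  have "\<exists>!k::int. x + of_int k \<in> S" using assms(1) unfolding integer_tile_def by (rule spec)
  then show ?thesis using assms(2,3) by (elim ex1E) blast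
qed

lemma unit_interval_tile: "integer_tile {a..<a + 1}"
  unfolding integer_tile_def
proof
  fix x :: real
  show "\<exists>!k::int. x + of_int k \<in> {a..<a + 1}"
  proof (rule ex1I[of _ "- \<lfloor>x - a\<rfloor>"])
    show "x + of_int (- \<lfloor>x - a\<rfloor>) \<in> {a..<a + 1}"
      by simp linarith
    show "k = - \<lfloor>x - a\<rfloor>" if "x + of_int k \<in> {a..<a + 1}" for k
    proof -
      have "\<lfloor>x - a\<rfloor> = - k" using that by (intro floor_unique) auto
      then show ?thesis by simp
    qed
  qed
qed

lemma integer_tile_inj:
  assumes "integer_tile S" shows "inj_on (\<lambda>x. cis (2 * pi * x)) S"
proof (rule inj_onI)
  fix x y assume xy: "x \<in> S" "y \<in> S" "cis (2 * pi * x) = cis (2 * pi * y)"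
  then obtain k :: int where k: "x = y + of_int k" by (auto simp: cis_eq_iff_int)
  have "k = 0" by (rule integer_tile_unique[OF assms, of y]) (use xy k in simp_all)
  then show "x = y" using k by simp
qed

lemma indicator_unit_interval_sum:
  fixes M :: nat
  assumes "x \<in> {- real M..<real M}"
  shows "(\<Sum>l\<in>{- int M..<int M}. indicator {of_int l..<of_int l + 1} x) = (1 :: complex)"
proof -
  have "(\<Sum>l\<in>{- int M..<int M}. indicator {of_int l..<of_int l + 1} x :: complex)
      = (\<Sum>l\<in>{- int M..<int M}. if l = \<lfloor>x\<rfloor> then 1 else 0)"
    by (intro sum.cong) (auto simp: indicator_def of_bool_def floor_eq_iff floor_unique)
  also have "\<lfloor>x\<rfloor> \<in> {- int M..<int M}"
    using assms by (auto simp: le_floor_iff floor_less_iff)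
  then have "(\<Sum>l\<in>{- int M..<int M}. if l = \<lfloor>x\<rfloor> then 1 else (0 :: complex)) = 1"
    by simp
  finally show ?thesis .
qed

lemma integrable_indicator_cis:
  assumes "S \<in> lmeasurable"
  shows "integrable lebesgue (\<lambda>x. indicator S x * cis (2 * pi * of_int k * x))"
proof (rule Bochner_Integration.integrable_bound[where f = "\<lambda>x. indicator S x :: real"])
  show "(\<lambda>x. indicator S x * cis (2 * pi * of_int k * x)) \<in> borel_measurable lebesgue"
    using assms[THEN fmeasurableD] by measurable
  show "integrable lebesgue (indicat_real S)"
    using assms by (intro integrable_real_indicator) (auto simp: fmeasurable_def)
qed (auto simp: norm_mult indicator_def)

text \<open>The line is cut into the intervals \<open>[l, l + 1)\<close> and each piece is translated to \<open>[0, 1)\<close>, which leaves the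
  exponential unchanged. The bounded set \<open>S\<close> makes the sum finite.\<close>
lemma integral_periodize:
  fixes M :: nat
  assumes S: "S \<in> sets lebesgue" "S \<subseteq> {- real M..<real M}"
  shows "(LINT x|lebesgue. indicator S x * cis (2 * pi * of_int k * x))
    = (LINT x|lebesgue. (\<Sum>l\<in>{- int M..<int M}. indicator S (x + of_int l))
          * (indicator {0..<1} x * cis (2 * pi * of_int k * x)))"
proof -
  let ?e = "\<lambda>x. cis (2 * pi * of_int k * x)"
  let ?I = "\<lambda>l::int. {of_int l..<of_int l + 1} :: real set"
  let ?L = "{- int M..<int M}"
  have SI: "S \<inter> ?I l \<in> lmeasurable" for l
    using S by (intro bounded_set_imp_lmeasurable) (auto intro: bounded_subset[of "?I l"])
  have shift: "(LINT x|lebesgue. indicator (S \<inter> ?I l) x * ?e x)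
      = (LINT x|lebesgue. indicator S (x + of_int l) * (indicator {0..<1} x * ?e x))"
    and int: "integrable lebesgue (\<lambda>x. indicator S (x + of_int l) * (indicator {0..<1} x * ?e x))" for l
  proof -
    have per: "?e (of_int l + 1 * x) = ?e x" for x
      using cis_eq_iff_int[of "of_int k * (of_int l + x)" "of_int k * x"]
      by (auto simp: algebra_simps intro!: exI[of _ "k * l"])
    have ind: "indicator (S \<inter> ?I l) (of_int l + 1 * x)
        = (indicator S (x + of_int l) * indicator {0..<1} x :: complex)" for x
      by (auto simp: indicator_def add.commute)
    have eq: "(\<lambda>x. indicator S (x + of_int l) * (indicator {0..<1} x * ?e x))
      = (\<lambda>x. indicator (S \<inter> ?I l) (of_int l + 1 * x) * ?e (of_int l + 1 * x))"
      unfolding per ind by (simp add: mult.assoc)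
    show "(LINT x|lebesgue. indicator (S \<inter> ?I l) x * ?e x)
      = (LINT x|lebesgue. indicator S (x + of_int l) * (indicator {0..<1} x * ?e x))"
      unfolding eq by (subst lebesgue_integral_real_affine[of 1 _ "of_int l"]) simp_all
    show "integrable lebesgue (\<lambda>x. indicator S (x + of_int l) * (indicator {0..<1} x * ?e x))"
      unfolding eq using lebesgue_integrable_real_affine_iff[of 1 "\<lambda>x. indicator (S \<inter> ?I l) x * ?e x" "of_int l"]
        integrable_indicator_cis[OF SI, of l k] by simp
  qed
  have "indicator S x * ?e x = (\<Sum>l\<in>?L. indicator (S \<inter> ?I l) x * ?e x)" for x
  proof (cases "x \<in> S")
    case True
    then have "x \<in> {- real M..<real M}" using S by auto
    from indicator_unit_interval_sum[OF this] True show ?thesis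
      by (simp add: indicator_inter_arith flip: sum_distrib_right)
  qed simp
  then have "(LINT x|lebesgue. indicator S x * ?e x)
      = (LINT x|lebesgue. (\<Sum>l\<in>?L. indicator (S \<inter> ?I l) x * ?e x))"
    by (rule Bochner_Integration.integral_cong[OF refl])
  also have "\<dots> = (\<Sum>l\<in>?L. LINT x|lebesgue. indicator (S \<inter> ?I l) x * ?e x)"
    by (rule Bochner_Integration.integral_sum) (rule integrable_indicator_cis[OF SI])
  also have "\<dots> = (LINT x|lebesgue. (\<Sum>l\<in>?L. indicator S (x + of_int l) * (indicator {0..<1} x * ?e x)))"
    unfolding shift by (rule Bochner_Integration.integral_sum[symmetric]) (rule int)
  finally show ?thesis by (simp only: sum_distrib_right)
qed

lemma integer_tile_sum:
  fixes M :: nat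
  assumes S: "integer_tile S" "S \<subseteq> {- real M..<real M}" and x: "x \<in> {0..<1}"
  shows "(\<Sum>l\<in>{- int M..<int M}. indicator S (x + of_int l)) = (1 :: complex)"
proof -
  obtain k :: int where kS: "x + of_int k \<in> S" using integer_tile_ex[OF S(1)] by blast
  then have k: "x + of_int l \<in> S \<longleftrightarrow> l = k" for l :: int
    using integer_tile_unique[OF S(1)] by blast
  have "x + of_int k \<in> {- real M..<real M}" using S(2) kS by auto
  with x have "real_of_int k < real_of_int (int M)" "real_of_int (- int M - 1) < real_of_int k"
    by auto
  then have "k < int M" "- int M - 1 < k" by (simp_all only: of_int_less_iff)
  then have kM: "k \<in> {- int M..<int M}" by simp
  have "(\<Sum>l\<in>{- int M..<int M}. indicator S (x + of_int l) :: complex)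
      = (\<Sum>l\<in>{- int M..<int M}. if l = k then 1 else 0)"
    using k by (intro sum.cong) (auto simp: indicator_def)
  with kM show ?thesis by simp
qed

lemma bounded_subset_nat_interval:
  assumes "bounded (S :: real set)" obtains M :: nat where "S \<subseteq> {- real M..<real M}"
proof -
  obtain B where B: "\<And>x. x \<in> S \<Longrightarrow> \<bar>x\<bar> \<le> B" using assms by (auto simp: bounded_iff)
  obtain M :: nat where "B < real M" using reals_Archimedean2 by blast
  with B have "S \<subseteq> {- real M..<real M}" by force
  then show ?thesis by (rule that)
qed

lemma integral_tile:
  assumes S: "S \<in> sets lebesgue" "bounded S" "integer_tile S"
  shows "(LINT x|lebesgue. indicator S x * cis (2 * pi * of_int k * x))
    = (LINT x|lebesgue. indicator {0..<1} x * cis (2 * pi * of_int k * x))"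
proof -
  obtain M :: nat where M: "S \<subseteq> {- real M..<real M}"
    using bounded_subset_nat_interval[OF S(2)] .
  have "(\<Sum>l\<in>{- int M..<int M}. indicator S (x + of_int l)) * (indicator {0..<1} x * z)
      = indicator {0..<1} x * z" for x and z :: complex
    using integer_tile_sum[OF S(3) M, of x] by (cases "x \<in> {0..<1}") (auto simp: indicator_def)
  then show ?thesis by (simp only: integral_periodize[OF S(1) M])
qed

text \<open>The translation by \<open>t = 1/(2k)\<close> changes the sign of the exponential, while \<open>[t, t + 1)\<close> and \<open>[0, 1)\<close> give
  the same integral, both being integer tiles; so the integral equals its own negative.\<close>
lemma integral_unit_interval_cis:
  "(LINT x|lebesgue. indicator {0..<1} x * cis (2 * pi * of_int k * x)) = (if k = 0 then 1 else 0)"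
proof (cases "k = 0")
  case True
  have "(LINT x|lebesgue. complex_of_real (indicator {0..<1::real} x)) = 1"
    by (subst integral_complex_of_real) simp
  then show ?thesis using True by (simp add: of_real_indicator)
next
  case False
  define t where "t = 1 / (2 * real_of_int k)"
  let ?I = "LINT x|lebesgue. indicator {0..<1} x * cis (2 * pi * of_int k * x)"
  have half: "cis (2 * pi * of_int k * (t + 1 * x)) = - cis (2 * pi * of_int k * x)" for x
  proof -
    have "2 * pi * of_int k * (t + 1 * x) = pi + 2 * pi * of_int k * x"
      using False by (simp add: t_def field_simps)
    then show ?thesis by (simp only: flip: cis_mult) simp
  qed
  have "?I = (LINT x|lebesgue. indicator {t..<t + 1} x * cis (2 * pi * of_int k * x))"
    by (rule integral_tile[symmetric]) (auto simp: unit_interval_tile)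
  also have "\<dots> = (LINT x|lebesgue. indicator {t..<t + 1} (t + 1 * x) * cis (2 * pi * of_int k * (t + 1 * x)))"
    by (subst lebesgue_integral_real_affine[of 1 _ t]) simp_all
  also have "\<dots> = (LINT x|lebesgue. - (indicator {0..<1} x * cis (2 * pi * of_int k * x)))"
    unfolding half by (intro Bochner_Integration.integral_cong) (auto simp: indicator_def)
  also have "\<dots> = - ?I" by simp
  finally show ?thesis using False by simp
qed

lemma L2_inner_char_on:
  "L2_inner (char_on S k) (char_on S l) = (LINT x|lebesgue. indicator S x * cis (2 * pi * of_int (k - l) * x))"
  unfolding L2_inner_def char_on_def
  by (intro Bochner_Integration.integral_cong)
     (auto simp: indicator_def cis_cnj cis_mult algebra_simps)

lemma char_on_orthonormal:
  assumes "S \<in> sets lebesgue" "bounded S" "integer_tile S"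
  shows "L2_orthonormal (char_on S)"
proof -
  have "L2_inner (char_on S k) (char_on S l) = (if k = l then 1 else 0)" for k l
    unfolding L2_inner_char_on integral_tile[OF assms] integral_unit_interval_cis by simp
  moreover have "char_on S k \<in> L2" for k
    using assms by (intro char_on_L2 bounded_set_imp_lmeasurable)
  ultimately show ?thesis by (simp add: L2_orthonormal_def)
qed

lemma fourier_kernel: "exp (- (2 * of_real pi * \<i> * of_real x * of_real \<xi>)) = cis (- (2 * pi * x * \<xi>))"
  by (simp add: cis_conv_exp algebra_simps)

lemma fourier_integral_cis: "fourier_integral f \<xi> = (LINT x|lebesgue. f x * cis (- (2 * pi * x * \<xi>)))"
  by (simp only: fourier_integral_def fourier_kernel)

lemma L2_inner_char_on_eq_fourier:
  assumes "\<And>x. x \<notin> S \<Longrightarrow> f x = 0"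
  shows "L2_inner f (char_on S k) = fourier_integral f (of_int k)"
  unfolding L2_inner_def char_on_def fourier_integral_cis
  by (intro Bochner_Integration.integral_cong) (use assms in \<open>auto simp: indicator_def cis_cnj algebra_simps\<close>)

text \<open>On a tile the exponentials are both orthonormal and complete, and the coefficients of \<open>f\<close> are the
  values of its Fourier integral at the integers.\<close>
lemma parseval_tile:
  assumes S: "S \<in> sets lebesgue" "bounded S" "integer_tile S"
    and f: "f \<in> L2" "\<And>x. x \<notin> S \<Longrightarrow> f x = 0"
  shows "((\<lambda>k::int. (cmod (fourier_integral f (of_int k)))\<^sup>2) has_sum (L2_norm f)\<^sup>2) UNIV"
proof -
  have span: "f \<in> L2_closed_span (char_on S)"
    using S f by (intro exponentials_complete integer_tile_inj bounded_set_imp_lmeasurable)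
  have "L2_inner f (char_on S k) = fourier_integral f (of_int k)" for k
    by (rule L2_inner_char_on_eq_fourier) (rule f(2))
  with parseval[OF char_on_orthonormal[OF S] span] show ?thesis by simp
qed

section \<open>Plancherel's theorem for compactly supported functions\<close>

lemma sigma_finite_lebesgue: "sigma_finite_measure (lebesgue :: real measure)"
proof
  obtain A :: "real set set" where A: "countable A" "A \<subseteq> sets lborel" "\<Union>A = space lborel"
    "\<forall>a\<in>A. emeasure lborel a \<noteq> \<infinity>"
    using lborel.sigma_finite_countable by blast
  then show "\<exists>A::real set set. countable A \<and> A \<subseteq> sets lebesgue \<and> \<Union>A = space lebesgue \<and>
      (\<forall>a\<in>A. emeasure lebesgue a \<noteq> \<infinity>)"
    by (intro exI[of _ A]) (auto simp: emeasure_completion)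
qed

interpretation lebesgue: sigma_finite_measure "lebesgue :: real measure"
  by (rule sigma_finite_lebesgue)

interpretation lebesgue_pair: pair_sigma_finite "lebesgue :: real measure" "lebesgue :: real measure" ..

lemma fourier_integral_measurable [measurable]:
  assumes [measurable]: "f \<in> borel_measurable lebesgue"
  shows "fourier_integral f \<in> borel_measurable lebesgue"
  unfolding fourier_integral_cis[abs_def] by measurable

lemma affine_measurable_lebesgue:
  "c \<noteq> 0 \<Longrightarrow> (\<lambda>x::real. t + c * x) \<in> lebesgue \<rightarrow>\<^sub>M lebesgue"
  using lebesgue_affine_measurable[where c = "\<lambda>x::real. c"] by simp

lemma L2_affine:
  assumes "f \<in> L2" "c \<noteq> 0" shows "(\<lambda>x. f (t + c * x)) \<in> L2"
  using assms measurable_compose[OF affine_measurable_lebesgue[OF assms(2)] L2_measurable[OF assms(1)]]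
    lebesgue_integrable_real_affine_iff[of c "\<lambda>x. (cmod (f x))\<^sup>2" t]
  by (simp add: L2_def)

lemma L2_norm_affine:
  assumes "c \<noteq> 0" shows "(L2_norm f)\<^sup>2 = \<bar>c\<bar> * (L2_norm (\<lambda>x. f (t + c * x)))\<^sup>2"
  using assms lebesgue_integral_real_affine[of c "\<lambda>x. (cmod (f x))\<^sup>2" t]
  by (simp add: L2_norm_square)

lemma fourier_integral_affine:
  assumes "c > 0"
  shows "fourier_integral (\<lambda>x. f (t + c * x)) \<xi>
     = of_real (1 / c) * cis (2 * pi * t * (\<xi> / c)) * fourier_integral f (\<xi> / c)"
proof -
  have "fourier_integral f (\<xi> / c) = c *\<^sub>R (LINT x|lebesgue. f (t + c * x) * cis (- (2 * pi * (t + c * x) * (\<xi> / c))))"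
    unfolding fourier_integral_cis
    using assms by (subst lebesgue_integral_real_affine[of c _ t]) simp_all
  also have "(LINT x|lebesgue. f (t + c * x) * cis (- (2 * pi * (t + c * x) * (\<xi> / c))))
      = (LINT x|lebesgue. cis (- (2 * pi * t * (\<xi> / c))) * (f (t + c * x) * cis (- (2 * pi * x * \<xi>))))"
  proof (intro Bochner_Integration.integral_cong refl)
    fix x
    have "- (2 * pi * (t + c * x) * (\<xi> / c)) = - (2 * pi * t * (\<xi> / c)) + - (2 * pi * x * \<xi>)"
      using assms by (simp add: field_simps)
    then show "f (t + c * x) * cis (- (2 * pi * (t + c * x) * (\<xi> / c)))
        = cis (- (2 * pi * t * (\<xi> / c))) * (f (t + c * x) * cis (- (2 * pi * x * \<xi>)))"
      by (simp only: mult.left_commute flip: cis_mult)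
  qed
  also have "\<dots> = cis (- (2 * pi * t * (\<xi> / c))) * fourier_integral (\<lambda>x. f (t + c * x)) \<xi>"
    by (simp add: fourier_integral_cis)
  finally have "of_real (1 / c) * cis (2 * pi * t * (\<xi> / c)) * fourier_integral f (\<xi> / c)
      = cis (2 * pi * t * (\<xi> / c)) * cis (- (2 * pi * t * (\<xi> / c))) * fourier_integral (\<lambda>x. f (t + c * x)) \<xi>"
    using assms by (simp add: scaleR_conv_of_real)
  then show ?thesis by (simp add: cis_mult)
qed

text \<open>Modulation shifts the transform, so Parseval's identity for integer frequencies yields one for
  each coset of the integers.\<close>
lemma fourier_integral_modulate:
  "fourier_integral (\<lambda>x. cis (- (2 * pi * x * s)) * f x) \<xi> = fourier_integral f (s + \<xi>)"
  unfolding fourier_integral_cis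
  by (intro Bochner_Integration.integral_cong) (auto simp: cis_mult algebra_simps mult.left_commute)

lemma L2_norm_modulate: "L2_norm (\<lambda>x. cis (h x) * f x) = L2_norm f"
  by (simp add: L2_norm_def norm_mult)

text \<open>The integers are enumerated by \<open>int_decode\<close> because the interchange of sum and integral is
  stated for series over the natural numbers.\<close>
lemma nn_integral_periodize:
  fixes g :: "real \<Rightarrow> ennreal"
  assumes [measurable]: "g \<in> borel_measurable lebesgue"
  shows "(\<integral>\<^sup>+x. g x \<partial>lebesgue) = (\<integral>\<^sup>+s. indicator {0..<1} s * (\<Sum>n. g (s + of_int (int_decode n))) \<partial>lebesgue)"
proof -
  let ?k = "\<lambda>n. of_int (int_decode n) :: real"
  have sh [measurable]: "(\<lambda>x. g (x + of_int k)) \<in> borel_measurable lebesgue" for k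
    using measurable_compose[OF affine_measurable_lebesgue[of 1 "of_int k"] assms] by (simp add: add.commute)
  have "g x = (\<Sum>n. indicator {?k n..<?k n + 1} x * g x)" for x
  proof -
    have "(\<lambda>n. indicator {?k n..<?k n + 1} x * g x) = (\<lambda>n. if n = int_encode \<lfloor>x\<rfloor> then g x else 0)"
    proof
      fix n
      have "x \<in> {?k n..<?k n + 1} \<longleftrightarrow> \<lfloor>x\<rfloor> = int_decode n"
        by (simp add: floor_eq_iff)
      also have "\<dots> \<longleftrightarrow> n = int_encode \<lfloor>x\<rfloor>" by auto
      finally show "indicator {?k n..<?k n + 1} x * g x = (if n = int_encode \<lfloor>x\<rfloor> then g x else 0)"
        by (auto simp: indicator_def)
    qed
    then show ?thesis using sums_single[of "int_encode \<lfloor>x\<rfloor>" "\<lambda>_. g x"] by (simp add: sums_iff)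
  qed
  then have "(\<integral>\<^sup>+x. g x \<partial>lebesgue) = (\<integral>\<^sup>+x. (\<Sum>n. indicator {?k n..<?k n + 1} x * g x) \<partial>lebesgue)"
    by simp
  also have "\<dots> = (\<Sum>n. \<integral>\<^sup>+x. indicator {?k n..<?k n + 1} x * g x \<partial>lebesgue)"
    by (rule nn_integral_suminf) measurable
  also have "\<dots> = (\<Sum>n. \<integral>\<^sup>+s. indicator {0..<1} s * g (s + ?k n) \<partial>lebesgue)"
  proof (rule suminf_cong)
    fix n
    have "(\<integral>\<^sup>+x. indicator {?k n..<?k n + 1} x * g x \<partial>lebesgue)
       = (\<integral>\<^sup>+s. indicator {?k n..<?k n + 1} (?k n + 1 * s) * g (?k n + 1 * s) \<partial>lebesgue)"
      by (subst nn_integral_real_affine_lebesgue[where c = 1 and t = "?k n"]) auto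
    also have "\<dots> = (\<integral>\<^sup>+s. indicator {0..<1} s * g (s + ?k n) \<partial>lebesgue)"
      by (intro nn_integral_cong) (auto simp: indicator_def add.commute)
    finally show "(\<integral>\<^sup>+x. indicator {?k n..<?k n + 1} x * g x \<partial>lebesgue)
      = (\<integral>\<^sup>+s. indicator {0..<1} s * g (s + ?k n) \<partial>lebesgue)" .
  qed
  also have "\<dots> = (\<integral>\<^sup>+s. (\<Sum>n. indicator {0..<1} s * g (s + ?k n)) \<partial>lebesgue)"
    by (rule nn_integral_suminf[symmetric]) measurable
  also have "\<dots> = (\<integral>\<^sup>+s. indicator {0..<1} s * (\<Sum>n. g (s + ?k n)) \<partial>lebesgue)"
    by simp
  finally show ?thesis .
qed

text \<open>Parseval's identity for the modulations of \<open>f\<close> says that the sum over all integers \<open>k\<close> of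
  \<open>\<bar>F f (s + k)\<bar>\<^sup>2\<close> is \<open>\<parallel>f\<parallel>\<^sup>2\<close> for every \<open>s\<close>, where \<open>F\<close> denotes the Fourier integral. Integration over \<open>s\<close> from
  \<open>0\<close> to \<open>1\<close> assembles the integral of \<open>\<bar>F f\<bar>\<^sup>2\<close> over the line.\<close>
lemma plancherel_unit:
  assumes f: "f \<in> L2" "\<And>x. x \<notin> {-1/2..<1/2} \<Longrightarrow> f x = 0"
  shows "(\<integral>\<^sup>+\<xi>. ennreal ((cmod (fourier_integral f \<xi>))\<^sup>2) \<partial>lebesgue) = ennreal ((L2_norm f)\<^sup>2)"
proof -
  have tile: "integer_tile {-1/2..<1/2::real}" using unit_interval_tile[of "-1/2"] by simp
  have sum: "(\<Sum>n. ennreal ((cmod (fourier_integral f (s + of_int (int_decode n))))\<^sup>2)) = ennreal ((L2_norm f)\<^sup>2)" for s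
  proof -
    define h where "h x = cis (- (2 * pi * x * s)) * f x" for x
    have "h \<in> L2" unfolding h_def by (rule L2_mult_bounded[OF f(1), where B = 1]) auto
    then have "((\<lambda>k::int. (cmod (fourier_integral h (of_int k)))\<^sup>2) has_sum (L2_norm h)\<^sup>2) UNIV"
      using f(2) by (intro parseval_tile[of "{-1/2..<1/2}"] tile) (auto simp: h_def)
    then have "((\<lambda>k::int. (cmod (fourier_integral f (s + of_int k)))\<^sup>2) has_sum (L2_norm f)\<^sup>2) UNIV"
      unfolding h_def by (simp only: fourier_integral_modulate L2_norm_modulate)
    then have "((\<lambda>n. (cmod (fourier_integral f (s + of_int (int_decode n))))\<^sup>2) has_sum (L2_norm f)\<^sup>2) UNIV"
      by (subst has_sum_reindex_bij_betw[OF bij_int_decode, of "\<lambda>k. (cmod (fourier_integral f (s + of_int k)))\<^sup>2"])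
    then show ?thesis
      by (intro suminf_ennreal_eq has_sum_imp_sums) auto
  qed
  show ?thesis
    using f(1) by (subst nn_integral_periodize) (auto simp: sum nn_integral_multc)
qed

text \<open>On this dense class the Fourier integral converges absolutely; it contains all truncations that
  occur in the definition of the Fourier transform.\<close>
definition L2_compact :: "(real \<Rightarrow> complex) set" where
  "L2_compact = {f \<in> L2. \<exists>R. \<forall>x. R < \<bar>x\<bar> \<longrightarrow> f x = 0}"

proposition plancherel_compact:
  assumes "f \<in> L2_compact"
  shows "fourier_integral f \<in> L2" "L2_norm (fourier_integral f) = L2_norm f"
proof -
  obtain R where f: "f \<in> L2" and R: "\<And>x. R < \<bar>x\<bar> \<Longrightarrow> f x = 0"
    using assms by (auto simp: L2_compact_def)
  \<comment> \<open>Dilation by \<open>a\<close> moves the support of \<open>f\<close> into \<open>[-1/4, 1/4]\<close>.\<close>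
  define a where "a = 4 * (\<bar>R\<bar> + 1)"
  have "a > 0" by (simp add: a_def)
  define u where "u x = f (0 + a * x)" for x
  have u: "u \<in> L2" unfolding u_def using f \<open>a > 0\<close> by (intro L2_affine) auto
  have "u x = 0" if "x \<notin> {-1/2..<1/2}" for x
  proof -
    have "\<bar>x\<bar> \<ge> 1/2" using that by auto
    then have "a * \<bar>x\<bar> \<ge> a * (1/2)" using \<open>a > 0\<close> by (intro mult_left_mono) auto
    moreover have "a * (1/2) > R" by (simp add: a_def)
    moreover have "\<bar>a * x\<bar> = a * \<bar>x\<bar>" using \<open>a > 0\<close> by (simp add: abs_mult)
    ultimately have "\<bar>a * x\<bar> > R" by linarith
    then show ?thesis by (simp add: u_def R)
  qed
  then have pu: "(\<integral>\<^sup>+\<xi>. ennreal ((cmod (fourier_integral u \<xi>))\<^sup>2) \<partial>lebesgue) = ennreal ((L2_norm u)\<^sup>2)"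
    by (rule plancherel_unit[OF u])
  have Fu: "fourier_integral u \<xi> = of_real (1 / a) * fourier_integral f (\<xi> / a)" for \<xi>
    unfolding u_def using \<open>a > 0\<close> by (subst fourier_integral_affine) auto
  have meas [measurable]: "fourier_integral f \<in> borel_measurable lebesgue" "fourier_integral u \<in> borel_measurable lebesgue"
    using f u L2_measurable by (auto intro!: fourier_integral_measurable)
  have "(\<integral>\<^sup>+\<xi>. ennreal ((cmod (fourier_integral f \<xi>))\<^sup>2) \<partial>lebesgue)
      = ennreal (1 / a) * (\<integral>\<^sup>+\<xi>. ennreal ((cmod (fourier_integral f (0 + (1 / a) * \<xi>)))\<^sup>2) \<partial>lebesgue)"
    using \<open>a > 0\<close> by (subst nn_integral_real_affine_lebesgue[where c = "1 / a" and t = 0]) auto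
  also have "(\<integral>\<^sup>+\<xi>. ennreal ((cmod (fourier_integral f (0 + (1 / a) * \<xi>)))\<^sup>2) \<partial>lebesgue)
      = (\<integral>\<^sup>+\<xi>. ennreal (a\<^sup>2) * ennreal ((cmod (fourier_integral u \<xi>))\<^sup>2) \<partial>lebesgue)"
    using \<open>a > 0\<close>
    by (intro nn_integral_cong) (simp add: Fu norm_mult norm_divide power_divide ennreal_mult[symmetric])
  also have "\<dots> = ennreal (a\<^sup>2) * ennreal ((L2_norm u)\<^sup>2)"
    unfolding pu[symmetric] by (rule nn_integral_cmult) measurable
  also have "ennreal (1 / a) * \<dots> = ennreal (a * (L2_norm u)\<^sup>2)"
    using \<open>a > 0\<close> by (simp add: power2_eq_square flip: ennreal_mult)
  also have "a * (L2_norm u)\<^sup>2 = (L2_norm f)\<^sup>2"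
    using L2_norm_affine[of a f 0] \<open>a > 0\<close> by (simp add: u_def[abs_def])
  finally show "fourier_integral f \<in> L2" "L2_norm (fourier_integral f) = L2_norm f"
    using L2_of_nn_integral[OF meas(1)] by auto
qed

section \<open>The Fourier transform on \<open>L\<^sup>2(\<real>)\<close>\<close>

lemma L2_compactI: "f \<in> L2 \<Longrightarrow> (\<And>x. R < \<bar>x\<bar> \<Longrightarrow> f x = 0) \<Longrightarrow> f \<in> L2_compact"
  by (auto simp: L2_compact_def)

lemma L2_compact_L2: "f \<in> L2_compact \<Longrightarrow> f \<in> L2"
  by (auto simp: L2_compact_def)

lemma L2_compact_integrable:
  assumes "f \<in> L2_compact" shows "integrable lebesgue f"
proof -
  obtain R where f: "f \<in> L2" "\<And>x. R < \<bar>x\<bar> \<Longrightarrow> f x = 0" using assms by (auto simp: L2_compact_def)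
  have "integrable lebesgue (\<lambda>x. f x * cnj (indicator {-R..R} x))"
    by (intro L2_inner_integrable f L2_indicator) simp
  also have "(\<lambda>x. f x * cnj (indicator {-R..R} x)) = f"
    using f(2) by (force simp: indicator_def abs_le_iff not_le)
  finally show ?thesis .
qed

lemma L2_compact_add:
  assumes "f \<in> L2_compact" "g \<in> L2_compact" shows "(\<lambda>x. f x + g x) \<in> L2_compact"
proof -
  obtain R where f: "f \<in> L2" "\<And>x. R < \<bar>x\<bar> \<Longrightarrow> f x = 0" using assms(1) by (auto simp: L2_compact_def)
  obtain Q where g: "g \<in> L2" "\<And>x. Q < \<bar>x\<bar> \<Longrightarrow> g x = 0" using assms(2) by (auto simp: L2_compact_def)
  show ?thesis
    by (rule L2_compactI[where R = "max R Q"]) (use f g in auto)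
qed

lemma L2_compact_scale: "f \<in> L2_compact \<Longrightarrow> (\<lambda>x. c * f x) \<in> L2_compact"
  by (auto simp: L2_compact_def)

lemma L2_compact_diff: "f \<in> L2_compact \<Longrightarrow> g \<in> L2_compact \<Longrightarrow> (\<lambda>x. f x - g x) \<in> L2_compact"
  using L2_compact_add[OF _ L2_compact_scale[of g "- 1"], of f] by simp

lemma L2_compact_affine:
  assumes "f \<in> L2_compact" "c > 0" shows "(\<lambda>x. f (t + c * x)) \<in> L2_compact"
proof -
  obtain R where f: "f \<in> L2" "\<And>x. R < \<bar>x\<bar> \<Longrightarrow> f x = 0" using assms(1) by (auto simp: L2_compact_def)
  show ?thesis
  proof (rule L2_compactI[where R = "(R + \<bar>t\<bar>) / c"])
    fix x assume "(R + \<bar>t\<bar>) / c < \<bar>x\<bar>"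
    then have "R + \<bar>t\<bar> < c * \<bar>x\<bar>" using assms(2) by (simp add: divide_less_eq mult.commute)
    moreover have "c * \<bar>x\<bar> = \<bar>c * x\<bar>" using assms(2) by (simp add: abs_mult)
    ultimately have "R < \<bar>t + c * x\<bar>" by linarith
    then show "f (t + c * x) = 0" by (rule f(2))
  qed (use L2_affine[OF f(1)] assms(2) in auto)
qed

lemma fourier_integrand_integrable:
  assumes "f \<in> L2_compact"
  shows "integrable lebesgue (\<lambda>x. f x * cis (- (2 * pi * x * \<xi>)))"
  by (rule Bochner_Integration.integrable_bound[OF L2_compact_integrable[OF assms]])
     (use L2_measurable[OF L2_compact_L2[OF assms]] in \<open>auto simp: norm_mult\<close>)

lemma fourier_integral_add:
  assumes "f \<in> L2_compact" "g \<in> L2_compact"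
  shows "fourier_integral (\<lambda>x. f x + g x) \<xi> = fourier_integral f \<xi> + fourier_integral g \<xi>"
  using assms by (simp add: fourier_integral_cis distrib_right fourier_integrand_integrable)

lemma fourier_integral_scale:
  "fourier_integral (\<lambda>x. c * f x) \<xi> = c * fourier_integral f \<xi>"
  by (simp add: fourier_integral_cis mult.assoc)

lemma fourier_integral_diff:
  assumes "f \<in> L2_compact" "g \<in> L2_compact"
  shows "fourier_integral (\<lambda>x. f x - g x) \<xi> = fourier_integral f \<xi> - fourier_integral g \<xi>"
  using fourier_integral_add[OF assms(1) L2_compact_scale[OF assms(2)], of "- 1"]
    fourier_integral_scale[of "- 1" g] by simp

lemma truncation_L2_compact:
  assumes "f \<in> L2" shows "(\<lambda>x. indicator {- r..r} x * f x) \<in> L2_compact"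
  by (rule L2_compactI[where R = r]) (use assms in \<open>auto intro: L2_indicator_mult simp: indicator_eq_0_iff\<close>)

lemma truncation_tendsto:
  assumes "f \<in> L2"
  shows "(\<lambda>n. L2_norm (\<lambda>x. f x - indicator {- real n..real n} x * f x)) \<longlonglongrightarrow> 0"
proof (rule L2_dominated_convergence[OF assms assms])
  show "(\<lambda>x. indicator {- real n..real n} x * f x) \<in> borel_measurable lebesgue" for n
    using truncation_L2_compact[OF assms] L2_compact_L2 L2_measurable by blast
  show "cmod (indicator {- real n..real n} x * f x) \<le> cmod (f x)" for n x
    by (simp add: indicator_def)
  show "(\<lambda>n. indicator {- real n..real n} x * f x) \<longlonglongrightarrow> f x" for x
  proof (rule tendsto_eventually)
    obtain N :: nat where "\<bar>x\<bar> \<le> real N" using real_arch_simple by blast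
    then have "indicator {- real n..real n} x * f x = f x" if "N \<le> n" for n
      using that by (auto simp: indicator_def)
    then show "\<forall>\<^sub>F n in sequentially. indicator {- real n..real n} x * f x = f x"
      by (auto simp: eventually_sequentially)
  qed
qed

text \<open>For \<open>f\<close> in \<open>L\<^sup>2\<close>, Plancherel's theorem makes the transforms of the truncations square integrable, so
  the extended integrals in the definition are squared norms.\<close>
lemma has_fourier_transform_iff:
  "f has_fourier_transform g \<longleftrightarrow> f \<in> L2 \<and> g \<in> L2 \<and>
    (\<lambda>n. L2_norm (\<lambda>\<xi>. g \<xi> - fourier_integral (\<lambda>x. indicator {- real n..real n} x * f x) \<xi>)) \<longlonglongrightarrow> 0"
proof (cases "f \<in> L2 \<and> g \<in> L2")
  case True
  define d where "d n \<xi> = g \<xi> - fourier_integral (\<lambda>x. indicator {- real n..real n} x * f x) \<xi>" for n :: nat and \<xi>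
  have d: "d n \<in> L2" for n
    unfolding d_def[abs_def] using True by (intro L2_diff plancherel_compact truncation_L2_compact) auto
  have "(\<lambda>n. \<integral>\<^sup>+\<xi>. ennreal ((cmod (d n \<xi>))\<^sup>2) \<partial>lebesgue) \<longlonglongrightarrow> 0
      \<longleftrightarrow> (\<lambda>n. ennreal ((L2_norm (d n))\<^sup>2)) \<longlonglongrightarrow> ennreal 0"
    by (simp only: nn_integral_L2_norm[OF d] ennreal_0)
  also have "\<dots> \<longleftrightarrow> (\<lambda>n. (L2_norm (d n))\<^sup>2) \<longlonglongrightarrow> 0"
    by (rule tendsto_ennreal_iff) auto
  also have "\<dots> \<longleftrightarrow> (\<lambda>n. L2_norm (d n)) \<longlonglongrightarrow> 0"
  proof
    assume "(\<lambda>n. (L2_norm (d n))\<^sup>2) \<longlonglongrightarrow> 0"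
    then have "(\<lambda>n. sqrt ((L2_norm (d n))\<^sup>2)) \<longlonglongrightarrow> sqrt 0" by (rule tendsto_real_sqrt)
    then show "(\<lambda>n. L2_norm (d n)) \<longlonglongrightarrow> 0" by simp
  next
    assume "(\<lambda>n. L2_norm (d n)) \<longlonglongrightarrow> 0"
    from tendsto_power[OF this, of 2] show "(\<lambda>n. (L2_norm (d n))\<^sup>2) \<longlonglongrightarrow> 0" by simp
  qed
  finally show ?thesis using True by (simp add: has_fourier_transform_def d_def[abs_def])
qed (auto simp: has_fourier_transform_def)

lemma fourier_transform_L2:
  assumes "f has_fourier_transform g" shows "f \<in> L2" "g \<in> L2"
  using assms by (auto simp: has_fourier_transform_iff)

lemma fourier_transform_approx:
  assumes "f has_fourier_transform g" "\<epsilon> > 0"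
  obtains h where "h \<in> L2_compact" "L2_norm (\<lambda>x. f x - h x) < \<epsilon>"
    "L2_norm (\<lambda>\<xi>. g \<xi> - fourier_integral h \<xi>) < \<epsilon>"
proof -
  note fg = assms(1)[unfolded has_fourier_transform_iff]
  have "\<forall>\<^sub>F n in sequentially. L2_norm (\<lambda>x. f x - indicator {- real n..real n} x * f x) < \<epsilon> \<and>
     L2_norm (\<lambda>\<xi>. g \<xi> - fourier_integral (\<lambda>x. indicator {- real n..real n} x * f x) \<xi>) < \<epsilon>"
    using fg truncation_tendsto[of f] assms(2) by (intro eventually_conj order_tendstoD(2)) auto
  then obtain n where "L2_norm (\<lambda>x. f x - indicator {- real n..real n} x * f x) < \<epsilon>"
     "L2_norm (\<lambda>\<xi>. g \<xi> - fourier_integral (\<lambda>x. indicator {- real n..real n} x * f x) \<xi>) < \<epsilon>"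
    by (auto simp: eventually_sequentially)
  with fg show ?thesis using that[OF truncation_L2_compact[of f "real n"]] by blast
qed

text \<open>Together with \<open>fourier_transform_approx\<close> this describes the Fourier transform as the closure of the graph
  of the Fourier integral on \<open>L2_compact\<close>. In this form the transform is independent of the
  particular truncations, so it can be carried through translations and dilations, which do
  not preserve the intervals \<open>[-n, n]\<close>.\<close>
lemma has_fourier_transformI:
  assumes f: "f \<in> L2" and g: "g \<in> L2"
    and approx: "\<And>\<epsilon>. \<epsilon> > 0 \<Longrightarrow> \<exists>h\<in>L2_compact. L2_norm (\<lambda>x. f x - h x) < \<epsilon> \<and> L2_norm (\<lambda>\<xi>. g \<xi> - fourier_integral h \<xi>) < \<epsilon>"
  shows "f has_fourier_transform g"
  unfolding has_fourier_transform_iff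
proof (intro conjI f g tendstoI)
  fix \<epsilon> :: real assume "\<epsilon> > 0"
  define T where "T n x = indicator {- real n..real n} x * f x" for n :: nat and x
  have T: "T n \<in> L2_compact" for n unfolding T_def[abs_def] by (rule truncation_L2_compact[OF f])
  have TL: "T n \<in> L2" for n by (rule L2_compact_L2[OF T])
  obtain h where h: "h \<in> L2_compact" "L2_norm (\<lambda>x. f x - h x) < \<epsilon> / 3"
    "L2_norm (\<lambda>\<xi>. g \<xi> - fourier_integral h \<xi>) < \<epsilon> / 3"
    using approx[of "\<epsilon> / 3"] \<open>\<epsilon> > 0\<close> by auto
  note hL = L2_compact_L2[OF h(1)]
  have "\<forall>\<^sub>F n in sequentially. L2_norm (\<lambda>x. f x - T n x) < \<epsilon> / 3"
    unfolding T_def using \<open>\<epsilon> > 0\<close> by (intro order_tendstoD(2)[OF truncation_tendsto[OF f]]) simp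
  then show "\<forall>\<^sub>F n in sequentially. dist (L2_norm (\<lambda>\<xi>. g \<xi> -
      fourier_integral (\<lambda>x. indicator {- real n..real n} x * f x) \<xi>)) 0 < \<epsilon>"
  proof eventually_elim
    case (elim n)
    have "L2_norm (\<lambda>x. h x - T n x) \<le> L2_norm (\<lambda>x. h x - f x) + L2_norm (\<lambda>x. f x - T n x)"
      by (rule L2_norm_triangle_diff[OF hL f TL])
    also have "\<dots> < 2 * \<epsilon> / 3" using h(2) elim by (simp add: L2_norm_commute[of h f])
    finally have "L2_norm (fourier_integral (\<lambda>x. h x - T n x)) < 2 * \<epsilon> / 3"
      using plancherel_compact(2)[OF L2_compact_diff[OF h(1) T]] by simp
    then have "L2_norm (\<lambda>\<xi>. fourier_integral h \<xi> - fourier_integral (T n) \<xi>) < 2 * \<epsilon> / 3"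
      by (simp add: fourier_integral_diff[OF h(1) T, abs_def])
    then have "L2_norm (\<lambda>\<xi>. g \<xi> - fourier_integral (T n) \<xi>) < \<epsilon>"
      using L2_norm_triangle_diff[OF g plancherel_compact(1)[OF h(1)] plancherel_compact(1)[OF T], of n] h(3)
      by simp
    then show ?case by (simp add: T_def[abs_def])
  qed
qed

lemma fourier_transform_cong_AE:
  assumes fg: "f has_fourier_transform g" and g': "g' \<in> L2" "AE \<xi> in lebesgue. g \<xi> = g' \<xi>"
  shows "f has_fourier_transform g'"
proof -
  note fg' = fg[unfolded has_fourier_transform_iff]
  have "L2_norm (\<lambda>\<xi>. g \<xi> - fourier_integral (\<lambda>x. indicator {- real n..real n} x * f x) \<xi>)
      = L2_norm (\<lambda>\<xi>. g' \<xi> - fourier_integral (\<lambda>x. indicator {- real n..real n} x * f x) \<xi>)" for n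
    by (rule L2_norm_cong_AE) (use g' fg' plancherel_compact(1)[OF truncation_L2_compact] in auto)
  then show ?thesis using fg' g'(1) by (simp add: has_fourier_transform_iff)
qed

lemma fourier_transform_add:
  assumes "f has_fourier_transform g" "f' has_fourier_transform g'"
  shows "(\<lambda>x. f x + f' x) has_fourier_transform (\<lambda>\<xi>. g \<xi> + g' \<xi>)"
proof (rule has_fourier_transformI)
  note L = fourier_transform_L2[OF assms(1)] fourier_transform_L2[OF assms(2)]
  show "(\<lambda>x. f x + f' x) \<in> L2" "(\<lambda>\<xi>. g \<xi> + g' \<xi>) \<in> L2" using L by auto
  fix \<epsilon> :: real assume "\<epsilon> > 0"
  then have "\<epsilon> / 2 > 0" by simp
  obtain h where h: "h \<in> L2_compact" "L2_norm (\<lambda>x. f x - h x) < \<epsilon> / 2"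
    "L2_norm (\<lambda>\<xi>. g \<xi> - fourier_integral h \<xi>) < \<epsilon> / 2"
    using fourier_transform_approx[OF assms(1) \<open>\<epsilon> / 2 > 0\<close>] .
  obtain h' where h': "h' \<in> L2_compact" "L2_norm (\<lambda>x. f' x - h' x) < \<epsilon> / 2"
    "L2_norm (\<lambda>\<xi>. g' \<xi> - fourier_integral h' \<xi>) < \<epsilon> / 2"
    using fourier_transform_approx[OF assms(2) \<open>\<epsilon> / 2 > 0\<close>] .
  have "L2_norm (\<lambda>x. (f x - h x) + (f' x - h' x)) < \<epsilon>"
    using L2_norm_triangle[OF L2_diff[OF L(1) L2_compact_L2[OF h(1)]] L2_diff[OF L(3) L2_compact_L2[OF h'(1)]]]
      h(2) h'(2) by linarith
  moreover have "L2_norm (\<lambda>\<xi>. (g \<xi> - fourier_integral h \<xi>) + (g' \<xi> - fourier_integral h' \<xi>)) < \<epsilon>"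
    using L2_norm_triangle[OF L2_diff[OF L(2) plancherel_compact(1)[OF h(1)]] L2_diff[OF L(4) plancherel_compact(1)[OF h'(1)]]]
      h(3) h'(3) by linarith
  ultimately show "\<exists>h\<in>L2_compact. L2_norm (\<lambda>x. f x + f' x - h x) < \<epsilon> \<and>
      L2_norm (\<lambda>\<xi>. g \<xi> + g' \<xi> - fourier_integral h \<xi>) < \<epsilon>"
    by (intro bexI[of _ "\<lambda>x. h x + h' x"] L2_compact_add h(1) h'(1))
       (simp add: fourier_integral_add[OF h(1) h'(1)] add_diff_add)
qed

lemma fourier_transform_scale:
  assumes "f has_fourier_transform g"
  shows "(\<lambda>x. c * f x) has_fourier_transform (\<lambda>\<xi>. c * g \<xi>)"
proof (rule has_fourier_transformI)
  note L = fourier_transform_L2[OF assms]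
  show "(\<lambda>x. c * f x) \<in> L2" "(\<lambda>\<xi>. c * g \<xi>) \<in> L2" using L by auto
  fix \<epsilon> :: real assume "\<epsilon> > 0"
  have c: "cmod c + 1 > 0" by (simp add: add_nonneg_pos)
  then have "\<epsilon> / (cmod c + 1) > 0" using \<open>\<epsilon> > 0\<close> by simp
  then obtain h where h: "h \<in> L2_compact" "L2_norm (\<lambda>x. f x - h x) < \<epsilon> / (cmod c + 1)"
    "L2_norm (\<lambda>\<xi>. g \<xi> - fourier_integral h \<xi>) < \<epsilon> / (cmod c + 1)"
    by (rule fourier_transform_approx[OF assms])
  have small: "cmod c * a < \<epsilon>" if "a < \<epsilon> / (cmod c + 1)" "0 \<le> a" for a
  proof -
    have "cmod c * a \<le> (cmod c + 1) * a" using that(2) by (intro mult_right_mono) auto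
    also have "\<dots> < \<epsilon>" using that(1) c by (simp add: less_divide_eq mult.commute)
    finally show ?thesis .
  qed
  have "L2_norm (\<lambda>x. c * (f x - h x)) < \<epsilon>" "L2_norm (\<lambda>\<xi>. c * (g \<xi> - fourier_integral h \<xi>)) < \<epsilon>"
    unfolding L2_norm_scale using small h(2,3) by auto
  then show "\<exists>h\<in>L2_compact. L2_norm (\<lambda>x. c * f x - h x) < \<epsilon> \<and> L2_norm (\<lambda>\<xi>. c * g \<xi> - fourier_integral h \<xi>) < \<epsilon>"
    by (intro bexI[of _ "\<lambda>x. c * h x"] L2_compact_scale h(1))
       (simp add: fourier_integral_scale algebra_simps)
qed

lemma fourier_transform_diff:
  assumes "f has_fourier_transform g" "f' has_fourier_transform g'"
  shows "(\<lambda>x. f x - f' x) has_fourier_transform (\<lambda>\<xi>. g \<xi> - g' \<xi>)"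
  using fourier_transform_add[OF assms(1) fourier_transform_scale[OF assms(2), of "- 1"]] by simp

lemma fourier_transform_sum:
  assumes "\<And>i. i \<in> A \<Longrightarrow> f i has_fourier_transform g i"
  shows "(\<lambda>x. \<Sum>i\<in>A. f i x) has_fourier_transform (\<lambda>\<xi>. \<Sum>i\<in>A. g i \<xi>)"
proof -
  have zero: "(\<lambda>x. 0) has_fourier_transform (\<lambda>\<xi>. 0)"
    by (simp add: has_fourier_transform_iff fourier_integral_def)
  show ?thesis
    using assms by (induction A rule: infinite_finite_induct) (auto simp: zero intro!: fourier_transform_add)
qed

lemma fourier_transform_norm:
  assumes "f has_fourier_transform g" shows "L2_norm f = L2_norm g"
proof -
  note L = fourier_transform_L2[OF assms]
  have "\<bar>L2_norm f - L2_norm g\<bar> \<le> 0 + \<epsilon>" if "\<epsilon> > 0" for \<epsilon>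
  proof -
    have "\<epsilon> / 2 > 0" using that by simp
    then obtain h where h: "h \<in> L2_compact" "L2_norm (\<lambda>x. f x - h x) < \<epsilon> / 2"
      "L2_norm (\<lambda>\<xi>. g \<xi> - fourier_integral h \<xi>) < \<epsilon> / 2"
      by (rule fourier_transform_approx[OF assms])
    show ?thesis
      using L2_norm_diff_ge[OF L(1) L2_compact_L2[OF h(1)]] 
        L2_norm_diff_ge[OF L(2) plancherel_compact(1)[OF h(1)]] plancherel_compact(2)[OF h(1)] h(2,3)
      by linarith
  qed
  then have "\<bar>L2_norm f - L2_norm g\<bar> \<le> 0" by (rule field_le_epsilon)
  then show ?thesis by simp
qed

text \<open>Polarization: norms determine the real part of the inner product, and the real part for
  \<open>-\<i> f\<close> is the imaginary part for \<open>f\<close>.\<close>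
theorem fourier_transform_inner:
  assumes "f has_fourier_transform g" "f' has_fourier_transform g'"
  shows "L2_inner f f' = L2_inner g g'"
proof -
  have Re: "Re (L2_inner u v) = Re (L2_inner a b)"
    if "u has_fourier_transform a" "v has_fourier_transform b" for u v a b
    using L2_norm_add_square[OF fourier_transform_L2(1)[OF that(1)] fourier_transform_L2(1)[OF that(2)]]
      L2_norm_add_square[OF fourier_transform_L2(2)[OF that(1)] fourier_transform_L2(2)[OF that(2)]]
      fourier_transform_norm[OF that(1)] fourier_transform_norm[OF that(2)]
      fourier_transform_norm[OF fourier_transform_add[OF that]]
    by simp
  have "Re (L2_inner (\<lambda>x. - \<i> * f x) f') = Re (L2_inner (\<lambda>x. - \<i> * g x) g')"
    by (rule Re[OF fourier_transform_scale[OF assms(1)] assms(2)])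
  then have "Im (L2_inner f f') = Im (L2_inner g g')"
    by (simp only: L2_inner_scale_left) simp
  with Re[OF assms] show ?thesis by (simp add: complex_eq_iff)
qed

lemma L2_norm_affine_pos:
  assumes "c > 0" shows "L2_norm (\<lambda>x. f (t + c * x)) = L2_norm f / sqrt c"
proof -
  have "L2_norm f = sqrt (\<bar>c\<bar> * (L2_norm (\<lambda>x. f (t + c * x)))\<^sup>2)"
    using L2_norm_affine[of c f t] assms L2_norm_nonneg[of f] by (simp add: real_sqrt_unique)
  then show ?thesis using assms by (simp add: real_sqrt_mult)
qed

lemma fourier_transform_affine:
  assumes fg: "f has_fourier_transform g" and c: "c > 0"
  shows "(\<lambda>x. f (t + c * x)) has_fourier_transform
    (\<lambda>\<xi>. of_real (1 / c) * cis (2 * pi * t * (\<xi> / c)) * g (\<xi> / c))"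
proof (rule has_fourier_transformI)
  note L = fourier_transform_L2[OF fg]
  have dil: "(\<lambda>\<xi>. of_real (1 / c) * cis (2 * pi * t * (\<xi> / c)) * u (\<xi> / c)) \<in> L2" if "u \<in> L2" for u
  proof (rule L2_mult_bounded[where B = "1 / c"])
    show "(\<lambda>\<xi>. u (\<xi> / c)) \<in> L2" using L2_affine[OF that, of "1 / c" 0] c by simp
  qed (use c in \<open>auto simp: norm_mult norm_divide\<close>)
  show "(\<lambda>x. f (t + c * x)) \<in> L2" using L2_affine[OF L(1)] c by simp
  show "(\<lambda>\<xi>. of_real (1 / c) * cis (2 * pi * t * (\<xi> / c)) * g (\<xi> / c)) \<in> L2" by (rule dil[OF L(2)])
  fix \<epsilon> :: real assume "\<epsilon> > 0"
  then have "sqrt c * \<epsilon> > 0" using c by simp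
  then obtain h where h: "h \<in> L2_compact" "L2_norm (\<lambda>x. f x - h x) < sqrt c * \<epsilon>"
    "L2_norm (\<lambda>\<xi>. g \<xi> - fourier_integral h \<xi>) < sqrt c * \<epsilon>"
    by (rule fourier_transform_approx[OF fg])
  have "L2_norm (\<lambda>x. f (t + c * x) - h (t + c * x)) < \<epsilon>"
    using L2_norm_affine_pos[OF c, of "\<lambda>x. f x - h x" t] h(2) c
    by (simp add: divide_less_eq mult.commute)
  moreover have "L2_norm (\<lambda>\<xi>. of_real (1 / c) * cis (2 * pi * t * (\<xi> / c)) * g (\<xi> / c)
      - fourier_integral (\<lambda>x. h (t + c * x)) \<xi>) < \<epsilon>"
  proof -
    have "(\<lambda>\<xi>. of_real (1 / c) * cis (2 * pi * t * (\<xi> / c)) * g (\<xi> / c) - fourier_integral (\<lambda>x. h (t + c * x)) \<xi>)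
        = (\<lambda>\<xi>. of_real (1 / c) * (cis (2 * pi * t * (\<xi> / c)) * (g (0 + (1 / c) * \<xi>) - fourier_integral h (0 + (1 / c) * \<xi>))))"
      using c by (simp add: fourier_integral_affine right_diff_distrib mult.assoc diff_divide_distrib)
    then have "L2_norm (\<lambda>\<xi>. of_real (1 / c) * cis (2 * pi * t * (\<xi> / c)) * g (\<xi> / c) - fourier_integral (\<lambda>x. h (t + c * x)) \<xi>)
        = 1 / c * L2_norm (\<lambda>\<xi>. g (0 + (1 / c) * \<xi>) - fourier_integral h (0 + (1 / c) * \<xi>))"
      using c by (simp only: L2_norm_scale L2_norm_modulate) (simp add: norm_divide)
    also have "\<dots> = 1 / c * (L2_norm (\<lambda>\<xi>. g \<xi> - fourier_integral h \<xi>) / sqrt (1 / c))"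
      using c L2_norm_affine_pos[of "1 / c" "\<lambda>\<xi>. g \<xi> - fourier_integral h \<xi>" 0] by simp
    also have "\<dots> = L2_norm (\<lambda>\<xi>. g \<xi> - fourier_integral h \<xi>) / sqrt c"
      using c by (simp add: real_sqrt_divide field_simps)
    also have "\<dots> < \<epsilon>" using h(3) c by (simp add: divide_less_eq mult.commute)
    finally show ?thesis .
  qed
  ultimately show "\<exists>h\<in>L2_compact. L2_norm (\<lambda>x. f (t + c * x) - h x) < \<epsilon> \<and>
      L2_norm (\<lambda>\<xi>. of_real (1 / c) * cis (2 * pi * t * (\<xi> / c)) * g (\<xi> / c) - fourier_integral h \<xi>) < \<epsilon>"
    using L2_compact_affine[OF h(1) c, of t] by (intro bexI[of _ "\<lambda>x. h (t + c * x)"] conjI)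
qed

text \<open>Fubini's theorem applies because functions in \<open>L2_compact\<close> are integrable and the
  kernel has modulus \<open>1\<close>.\<close>
lemma fourier_integral_adjoint:
  assumes f: "f \<in> L2_compact" and g: "g \<in> L2_compact"
  shows "L2_inner (fourier_integral f) g = L2_inner f (\<lambda>x. fourier_integral g (- x))"
proof -
  have [measurable]: "f \<in> borel_measurable lebesgue" "g \<in> borel_measurable lebesgue"
    using f g L2_compact_L2 L2_measurable by blast+
  let ?H = "\<lambda>x \<xi>. f x * cis (- (2 * pi * x * \<xi>)) * cnj (g \<xi>)"
  have int: "integrable (lebesgue \<Otimes>\<^sub>M lebesgue) (case_prod ?H)"
  proof (rule lebesgue_pair.Fubini_integrable)
    show "case_prod ?H \<in> borel_measurable (lebesgue \<Otimes>\<^sub>M lebesgue)"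
      unfolding split_beta by measurable
    have "(LINT \<xi>|lebesgue. norm (case (x, \<xi>) of (x, \<xi>) \<Rightarrow> ?H x \<xi>)) = cmod (f x) * (LINT \<xi>|lebesgue. cmod (g \<xi>))" for x
      by (simp add: norm_mult)
    then show "integrable lebesgue (\<lambda>x. LINT \<xi>|lebesgue. norm (case (x, \<xi>) of (x, \<xi>) \<Rightarrow> ?H x \<xi>))"
      using L2_compact_integrable[OF f] by simp
    show "AE x in lebesgue. integrable lebesgue (\<lambda>\<xi>. case (x, \<xi>) of (x, \<xi>) \<Rightarrow> ?H x \<xi>)"
    proof (rule AE_I2)
      fix x
      have "integrable lebesgue (\<lambda>\<xi>. f x * cnj (g \<xi>))"
        using L2_compact_integrable[OF g] by simp
      then show "integrable lebesgue (\<lambda>\<xi>. case (x, \<xi>) of (x, \<xi>) \<Rightarrow> ?H x \<xi>)"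
        by (rule Bochner_Integration.integrable_bound) (auto simp: norm_mult)
    qed
  qed
  have "L2_inner (fourier_integral f) g = (LINT \<xi>|lebesgue. LINT x|lebesgue. ?H x \<xi>)"
    by (simp add: L2_inner_def fourier_integral_cis)
  also have "\<dots> = (LINT x|lebesgue. LINT \<xi>|lebesgue. ?H x \<xi>)"
    using lebesgue_pair.Fubini_integral[OF int] .
  also have "\<dots> = (LINT x|lebesgue. f x * cnj (fourier_integral g (- x)))"
  proof (intro Bochner_Integration.integral_cong refl)
    fix x
    have "cnj (fourier_integral g (- x)) = (LINT \<xi>|lebesgue. cnj (g \<xi> * cis (- (2 * pi * \<xi> * - x))))"
      unfolding fourier_integral_cis by (simp only: Bochner_Integration.integral_cnj)
    also have "\<dots> = (LINT \<xi>|lebesgue. cis (- (2 * pi * x * \<xi>)) * cnj (g \<xi>))"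
      by (intro Bochner_Integration.integral_cong refl) (simp add: cis_cnj mult.commute mult.left_commute)
    finally show "(LINT \<xi>|lebesgue. ?H x \<xi>) = f x * cnj (fourier_integral g (- x))"
      by (simp add: mult.assoc)
  qed
  finally show ?thesis by (simp add: L2_inner_def)
qed

text \<open>Let \<open>f\<close> be the inverse Fourier integral of \<open>g\<close>, with truncations \<open>f\<^sub>n\<close>. By adjointness, the inner product of
  \<open>g\<close> with the transform of \<open>f\<^sub>n\<close> is \<open>\<langle>f, f\<^sub>n\<rangle> = \<parallel>f\<^sub>n\<parallel>\<^sup>2\<close>, so the squared distance between the two is
  \<open>\<parallel>g\<parallel>\<^sup>2 - \<parallel>f\<^sub>n\<parallel>\<^sup>2\<close>, which tends to \<open>\<parallel>g\<parallel>\<^sup>2 - \<parallel>f\<parallel>\<^sup>2 = 0\<close>.\<close>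
theorem fourier_transform_inverse:
  assumes g: "g \<in> L2_compact"
  shows "(\<lambda>x. fourier_integral g (- x)) has_fourier_transform g"
proof -
  define f where "f x = fourier_integral g (- x)" for x
  have "(\<lambda>x. fourier_integral g (0 + (- 1) * x)) \<in> L2"
    by (rule L2_affine[OF plancherel_compact(1)[OF g]]) simp
  then have f: "f \<in> L2" by (simp add: f_def[abs_def])
  have "(L2_norm (fourier_integral g))\<^sup>2 = \<bar>- 1\<bar> * (L2_norm (\<lambda>x. fourier_integral g (0 + (- 1) * x)))\<^sup>2"
    by (rule L2_norm_affine) simp
  then have norm_f: "(L2_norm f)\<^sup>2 = (L2_norm g)\<^sup>2"
    by (simp add: f_def[abs_def] plancherel_compact(2)[OF g])
  define T where "T n x = indicator {- real n..real n} x * f x" for n :: nat and x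
  have T: "T n \<in> L2_compact" for n unfolding T_def[abs_def] by (rule truncation_L2_compact[OF f])
  note TL = L2_compact_L2[OF T] and FTL = plancherel_compact(1)[OF T] and gL = L2_compact_L2[OF g]
  have "L2_norm (\<lambda>\<xi>. g \<xi> - fourier_integral (T n) \<xi>) = sqrt ((L2_norm g)\<^sup>2 - (L2_norm (T n))\<^sup>2)" for n
  proof -
    have "L2_inner g (fourier_integral (T n)) = cnj (L2_inner (T n) f)"
      by (subst L2_inner_commute) (simp add: fourier_integral_adjoint[OF T g] f_def[abs_def])
    also have "L2_inner (T n) f = L2_inner (T n) (T n)"
      unfolding L2_inner_def by (intro Bochner_Integration.integral_cong) (auto simp: T_def indicator_def)
    finally have "Re (L2_inner g (fourier_integral (T n))) = (L2_norm (T n))\<^sup>2"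
      by (simp add: L2_inner_self)
    then have "(L2_norm (\<lambda>\<xi>. g \<xi> - fourier_integral (T n) \<xi>))\<^sup>2 = (L2_norm g)\<^sup>2 - (L2_norm (T n))\<^sup>2"
      unfolding L2_norm_diff_square[OF gL FTL] plancherel_compact(2)[OF T] by simp
    then show ?thesis by (metis L2_norm_nonneg real_sqrt_unique)
  qed
  moreover have "(\<lambda>n. L2_norm (T n)) \<longlonglongrightarrow> L2_norm f"
  proof (rule Lim_transform2[OF tendsto_const])
    have "(\<lambda>n. L2_norm (\<lambda>x. f x - T n x)) \<longlonglongrightarrow> 0"
      unfolding T_def by (rule truncation_tendsto[OF f])
    then show "(\<lambda>n. L2_norm f - L2_norm (T n)) \<longlonglongrightarrow> 0"
      by (rule Lim_null_comparison[rotated]) (auto intro!: always_eventually L2_norm_diff_ge f TL)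
  qed
  then have "(\<lambda>n. sqrt ((L2_norm g)\<^sup>2 - (L2_norm (T n))\<^sup>2)) \<longlonglongrightarrow> sqrt ((L2_norm g)\<^sup>2 - (L2_norm f)\<^sup>2)"
    by (intro tendsto_intros)
  ultimately have "f has_fourier_transform g"
    using f gL norm_f by (simp add: has_fourier_transform_iff T_def[abs_def])
  then show ?thesis by (simp add: f_def[abs_def])
qed

section \<open>The wavelet system and its Fourier transform\<close>

definition dyadic_tile :: "real set \<Rightarrow> bool" where
  "dyadic_tile S \<longleftrightarrow> (\<forall>x>0. \<exists>!j::int. 2 powi j * x \<in> S)"

definition wavelet_system :: "(real \<Rightarrow> complex) \<Rightarrow> int \<times> int \<Rightarrow> real \<Rightarrow> complex" where
  "wavelet_system \<psi> =
    (\<lambda>(j, k) x. of_real (2 powr (real_of_int j / 2)) * \<psi> (2 powi j * x - real_of_int k))"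

definition wavelet_system_ft :: "(real \<Rightarrow> complex) \<Rightarrow> int \<times> int \<Rightarrow> real \<Rightarrow> complex" where
  "wavelet_system_ft g = (\<lambda>(j, k) \<xi>. of_real (2 powr (- real_of_int j / 2)) *
    (cis (- (2 * pi * of_int k * (\<xi> / 2 powi j))) * g (\<xi> / 2 powi j)))"

lemma H2_wavelet_iff: "H2_wavelet \<psi> \<longleftrightarrow> \<psi> \<in> H2 \<and> L2_orthonormal_basis (wavelet_system \<psi>) H2"
  unfolding H2_wavelet_def wavelet_system_def ..

lemma fourier_transform_wavelet_system:
  assumes "\<psi> has_fourier_transform g"
  shows "wavelet_system \<psi> i has_fourier_transform wavelet_system_ft g i"
proof -
  obtain j k where i: "i = (j, k)" by (cases i)
  have c: "(2::real) powi j > 0" by simp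
  have half: "2 powr (real_of_int j / 2) * (1 / 2 powi j) = (2 powr (- real_of_int j / 2) :: real)"
  proof -
    have "(2::real) powi j = 2 powr real_of_int j" by (simp add: powr_real_of_int')
    then have "2 powr (real_of_int j / 2) * (1 / 2 powi j) = (2::real) powr (real_of_int j / 2) / 2 powr real_of_int j"
      by simp
    also have "\<dots> = 2 powr (real_of_int j / 2 - real_of_int j)" by (rule powr_diff[symmetric])
    also have "real_of_int j / 2 - real_of_int j = - real_of_int j / 2" by simp
    finally show ?thesis .
  qed
  have "(\<lambda>x. of_real (2 powr (real_of_int j / 2)) * \<psi> (- of_int k + 2 powi j * x)) has_fourier_transform
     (\<lambda>\<xi>. of_real (2 powr (real_of_int j / 2)) *
       (of_real (1 / 2 powi j) * cis (2 * pi * (- of_int k) * (\<xi> / 2 powi j)) * g (\<xi> / 2 powi j)))"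
    by (intro fourier_transform_scale fourier_transform_affine assms c)
  also have "(\<lambda>x. of_real (2 powr (real_of_int j / 2)) * \<psi> (- of_int k + 2 powi j * x)) = wavelet_system \<psi> i"
    by (simp add: i wavelet_system_def)
  also have "(\<lambda>\<xi>. of_real (2 powr (real_of_int j / 2)) *
       (of_real (1 / 2 powi j) * cis (2 * pi * (- of_int k) * (\<xi> / 2 powi j)) * g (\<xi> / 2 powi j)))
     = wavelet_system_ft g i"
  proof -
    have "complex_of_real (2 powr (- real_of_int j / 2)) = of_real (2 powr (real_of_int j / 2)) * of_real (1 / 2 powi j)"
      by (simp only: half flip: of_real_mult)
    then show ?thesis
      by (simp only: i wavelet_system_ft_def prod.case) (simp add: mult.assoc)
  qed
  finally show ?thesis .
qed

lemma L2_inner_affine: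
  assumes "c \<noteq> 0"
  shows "L2_inner (\<lambda>x. u (t + c * x)) (\<lambda>x. v (t + c * x)) = of_real (1 / \<bar>c\<bar>) * L2_inner u v"
  using assms lebesgue_integral_real_affine[of c "\<lambda>x. u x * cnj (v x)" t]
  by (simp add: L2_inner_def scaleR_conv_of_real)

lemma wavelet_system_ft_L2:
  assumes "g \<in> L2" shows "wavelet_system_ft g i \<in> L2"
proof -
  obtain j k where i: "i = (j, k)" by (cases i)
  have "(\<lambda>\<xi>. g (0 + (1 / 2 powi j) * \<xi>)) \<in> L2" using assms by (intro L2_affine) auto
  then have "(\<lambda>\<xi>. cis (- (2 * pi * of_int k * (\<xi> / 2 powi j))) * g (0 + (1 / 2 powi j) * \<xi>)) \<in> L2"
    by (rule L2_mult_bounded[where B = 1]) auto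
  from L2_scale[OF this, of "of_real (2 powr (- real_of_int j / 2))"] show ?thesis
    by (simp add: i wavelet_system_ft_def)
qed

lemma wavelet_system_ft_indicator:
  "wavelet_system_ft (indicator S) (j, k) =
    (\<lambda>\<xi>. of_real (2 powr (- real_of_int j / 2)) * char_on S (- k) (0 + (1 / 2 powi j) * \<xi>))"
  by (auto simp: wavelet_system_ft_def char_on_def mult.commute)

lemma dyadic_tile_unique:
  assumes "dyadic_tile S" "x > 0" "2 powi i * x \<in> S" "2 powi j * x \<in> S" shows "i = j"
proof -
  have "\<exists>!j::int. 2 powi j * x \<in> S" using assms(1,2) by (simp add: dyadic_tile_def)
  then show ?thesis using assms(3,4) by (elim ex1E) blast
qed

lemma divide_powi_eq: "x / 2 powi j = 2 powi (- j) * (x :: real)"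
  by (simp add: power_int_minus field_simps)

text \<open>At equal scales the inner product is one of exponentials on \<open>S\<close>, which is an integer tile; at
  different scales the supports \<open>2\<^sup>jS\<close> are disjoint.\<close>
lemma wavelet_system_ft_orthonormal:
  assumes S: "S \<in> sets lebesgue" "bounded S" "S \<subseteq> {0<..}" and tiles: "integer_tile S" "dyadic_tile S"
  shows "L2_orthonormal (wavelet_system_ft (indicator S))"
  unfolding L2_orthonormal_def
proof (intro conjI allI)
  note SL = bounded_set_imp_lmeasurable[OF S(2,1)]
  show "wavelet_system_ft (indicator S) i \<in> L2" for i
    by (rule wavelet_system_ft_L2[OF L2_indicator[OF SL]])
  show "L2_inner (wavelet_system_ft (indicator S) i) (wavelet_system_ft (indicator S) i') = (if i = i' then 1 else 0)" for i i'
  proof -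
    obtain j k j' k' where i: "i = (j, k)" "i' = (j', k')" by (cases i, cases i')
    show ?thesis
    proof (cases "j = j'")
      case True
      have "(2::real) powi j = 2 powr real_of_int j" by (simp add: powr_real_of_int')
      also have "\<dots> = 2 powr (real_of_int j / 2) * 2 powr (real_of_int j / 2)"
        by (simp flip: powr_add)
      finally have half: "(2 powr (- real_of_int j / 2)) * ((2 powr (- real_of_int j / 2)) * 2 powi j) = (1::real)"
        by (simp add: powr_minus divide_simps)
      let ?a = "of_real (2 powr (- real_of_int j / 2)) :: complex"
      have "L2_inner (wavelet_system_ft (indicator S) i) (wavelet_system_ft (indicator S) i')
         = ?a * (?a * L2_inner (\<lambda>\<xi>. char_on S (- k) (0 + (1 / 2 powi j) * \<xi>)) (\<lambda>\<xi>. char_on S (- k') (0 + (1 / 2 powi j) * \<xi>)))"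
        unfolding i True[symmetric] wavelet_system_ft_indicator L2_inner_scale_left
        by (simp only: L2_inner_scale_right complex_cnj_complex_of_real)
      also have "\<dots> = of_real (2 powr (- real_of_int j / 2) * ((2 powr (- real_of_int j / 2)) * 2 powi j))
          * L2_inner (char_on S (- k)) (char_on S (- k'))"
        by (subst L2_inner_affine) (simp_all add: abs_divide)
      also have "\<dots> = (if i = i' then 1 else 0)"
        unfolding half using char_on_orthonormal[OF S(1,2) tiles(1)] True
        by (auto simp: i L2_orthonormal_def)
      finally show ?thesis .
    next
      case False
      have "wavelet_system_ft (indicator S) i \<xi> * cnj (wavelet_system_ft (indicator S) i' \<xi>) = 0" for \<xi>
      proof (rule ccontr)
        assume "\<not> ?thesis"
        then have *: "2 powi (- j) * \<xi> \<in> S" "2 powi (- j') * \<xi> \<in> S"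
          by (auto simp: i wavelet_system_ft_def indicator_def simp flip: divide_powi_eq split: if_splits)
        then have "2 powi (- j) * \<xi> > 0" using S(3) by auto
        then have "\<xi> > 0" by (rule zero_less_mult_pos) simp
        from dyadic_tile_unique[OF tiles(2) this *] False show False by simp
      qed
      then have "L2_inner (wavelet_system_ft (indicator S) i) (wavelet_system_ft (indicator S) i') = 0"
        by (simp only: L2_inner_def) simp
      then show ?thesis using False by (simp add: i)
    qed
  qed
qed

lemma wavelet_system_ft_piece:
  assumes S: "S \<in> sets lebesgue" "bounded S" and tile: "integer_tile S"
    and h: "h \<in> L2" "\<And>\<xi>. \<xi> / 2 powi j \<notin> S \<Longrightarrow> h \<xi> = 0"
  shows "h \<in> L2_closed_span (wavelet_system_ft (indicator S))"
proof (rule closed_span_closed)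
  note SL = bounded_set_imp_lmeasurable[OF S(2,1)]
  let ?E = "wavelet_system_ft (indicator S)"
  show E: "?E i \<in> L2" for i
    by (rule wavelet_system_ft_L2[OF L2_indicator[OF SL]])
  define c :: real where "c = 2 powi j"
  have "c > 0" by (simp add: c_def)
  define u where "u \<eta> = h (0 + c * \<eta>)" for \<eta>
  have "u \<in> L2" unfolding u_def using h(1) \<open>c > 0\<close> by (intro L2_affine) auto
  moreover have "u \<eta> = 0" if "\<eta> \<notin> S" for \<eta>
    unfolding u_def using that \<open>c > 0\<close> by (intro h(2)) (simp add: c_def)
  ultimately have u: "u \<in> L2_closed_span (char_on S)"
    using SL S(2) by (intro exponentials_complete integer_tile_inj tile)
  fix \<epsilon> :: real assume "\<epsilon> > 0"
  then have "\<epsilon> / sqrt c > 0" using \<open>c > 0\<close> by simp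
  then obtain A b where A: "finite A" "L2_norm (\<lambda>\<eta>. u \<eta> - (\<Sum>k\<in>A. b k * char_on S k \<eta>)) < \<epsilon> / sqrt c"
    by (rule closed_span_approx[OF u])
  define v where "v \<xi> = (\<Sum>k\<in>A. b k * char_on S k (0 + (1 / c) * \<xi>))" for \<xi>
  have "char_on S k (0 + (1 / c) * \<xi>) = of_real (2 powr (real_of_int j / 2)) * ?E (j, - k) \<xi>" for k \<xi>
    unfolding wavelet_system_ft_indicator c_def by (simp add: powr_minus)
  then have "v = (\<lambda>\<xi>. \<Sum>k\<in>A. b k * (of_real (2 powr (real_of_int j / 2)) * ?E (j, - k) \<xi>))"
    by (simp add: v_def[abs_def])
  also have "\<dots> \<in> L2_closed_span ?E"
    by (intro closed_span_sum closed_span_scale closed_span_generator E)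
  finally have v: "v \<in> L2_closed_span ?E" .
  have "h \<xi> = u (0 + (1 / c) * \<xi>)" for \<xi> using \<open>c > 0\<close> by (simp add: u_def)
  then have "L2_norm (\<lambda>\<xi>. h \<xi> - v \<xi>) = L2_norm (\<lambda>\<eta>. u \<eta> - (\<Sum>k\<in>A. b k * char_on S k \<eta>)) / sqrt (1 / c)"
    using L2_norm_affine_pos[of "1 / c" "\<lambda>\<eta>. u \<eta> - (\<Sum>k\<in>A. b k * char_on S k \<eta>)" 0] \<open>c > 0\<close>
    by (simp only: v_def) simp
  also have "\<dots> < \<epsilon>" using A(2) \<open>c > 0\<close> by (simp add: real_sqrt_divide less_divide_eq)
  finally show "\<exists>v\<in>L2_closed_span ?E. L2_norm (\<lambda>\<xi>. h \<xi> - v \<xi>) < \<epsilon>" using v by blast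
qed (rule h(1))

text \<open>Each restriction of \<open>h\<close> to a dilate \<open>2\<^sup>jS\<close> lies in the closed span by
  \<open>wavelet_system_ft_piece\<close>. The dilates partition the positive half-line, so the sums of these
  restrictions over \<open>-n \<le> j \<le> n\<close> converge to \<open>h\<close> and are dominated by it.\<close>
lemma wavelet_system_ft_complete:
  assumes S: "S \<in> sets lebesgue" "bounded S" and tiles: "integer_tile S" "dyadic_tile S"
    and h: "h \<in> L2" "AE \<xi> in lebesgue. \<xi> \<le> 0 \<longrightarrow> h \<xi> = 0"
  shows "h \<in> L2_closed_span (wavelet_system_ft (indicator S))"
proof -
  note SL = bounded_set_imp_lmeasurable[OF S(2,1)]
  let ?E = "wavelet_system_ft (indicator S)"
  have E: "?E i \<in> L2" for i
    by (rule wavelet_system_ft_L2[OF L2_indicator[OF SL]])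
  \<comment> \<open>The values on the closed negative half-line are removed so that the partial sums below converge at every point.\<close>
  define g where "g \<xi> = indicator {0<..} \<xi> * h \<xi>" for \<xi>
  have g: "g \<in> L2" unfolding g_def by (intro L2_indicator_mult h(1)) auto
  define D where "D j = {\<xi>. \<xi> / 2 powi j \<in> S}" for j :: int
  have D: "D j \<in> sets lebesgue" for j
  proof -
    have "(\<lambda>\<xi>. 0 + (1 / 2 powi j) * \<xi>) -` S \<inter> space lebesgue \<in> sets lebesgue"
      by (rule measurable_sets[OF affine_measurable_lebesgue S(1)]) simp
    also have "(\<lambda>\<xi>. 0 + (1 / 2 powi j) * \<xi>) -` S \<inter> space lebesgue = D j" by (auto simp: D_def)
    finally show ?thesis .
  qed
  define s where "s n \<xi> = (\<Sum>j\<in>{- int n..int n}. indicator (D j) \<xi> * g \<xi>)" for n \<xi>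
  have piece: "(\<lambda>\<xi>. indicator (D j) \<xi> * g \<xi>) \<in> L2_closed_span ?E" for j
    by (rule wavelet_system_ft_piece[OF S tiles(1), of _ j])
       (auto simp: D_def intro!: L2_indicator_mult[OF g D, unfolded D_def])
  have s: "s n \<in> L2_closed_span ?E" for n
    unfolding s_def by (intro closed_span_sum E piece)
  \<comment> \<open>At most one of the restrictions is nonzero at \<open>\<xi>\<close>, so the partial sums jump at most once, from \<open>0\<close> to \<open>g \<xi>\<close>.\<close>
  have s_eq: "\<exists>j0. \<forall>n. s n \<xi> = (if j0 \<in> {- int n..int n} then g \<xi> else 0)" for \<xi>
  proof (cases "\<xi> > 0")
    case True
    then obtain j where j: "2 powi j * \<xi> \<in> S" using tiles(2) unfolding dyadic_tile_def by blast
    have "\<xi> \<in> D i \<longleftrightarrow> i = - j" for i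
      using dyadic_tile_unique[OF tiles(2) True j, of "- i"] j by (auto simp: D_def divide_powi_eq)
    then have "s n \<xi> = (\<Sum>i\<in>{- int n..int n}. if i = - j then g \<xi> else 0)" for n
      unfolding s_def by (intro sum.cong) (auto simp: indicator_def)
    then show ?thesis by (intro exI[of _ "- j"]) simp
  next
    case False
    then show ?thesis by (intro exI[of _ 0]) (simp add: s_def g_def)
  qed
  have "(\<lambda>n. L2_norm (\<lambda>\<xi>. g \<xi> - s n \<xi>)) \<longlonglongrightarrow> 0"
  proof (rule L2_dominated_convergence[OF g g])
    show "s n \<in> borel_measurable lebesgue" for n
      using closed_span_L2[OF s] L2_measurable by blast
    show "cmod (s n \<xi>) \<le> cmod (g \<xi>)" for n \<xi>
      using s_eq[of \<xi>] by (elim exE) simp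
    show "(\<lambda>n. s n \<xi>) \<longlonglongrightarrow> g \<xi>" for \<xi>
    proof (rule tendsto_eventually)
      obtain j0 where j0: "\<And>n. s n \<xi> = (if j0 \<in> {- int n..int n} then g \<xi> else 0)"
        using s_eq[of \<xi>] by blast
      have "s n \<xi> = g \<xi>" if "nat \<bar>j0\<bar> \<le> n" for n
        using that by (subst j0) auto
      then show "\<forall>\<^sub>F n in sequentially. s n \<xi> = g \<xi>"
        unfolding eventually_sequentially by blast
    qed
  qed
  then have g_span: "g \<in> L2_closed_span ?E"
    by (rule closed_span_limit[OF E s g])
  have "L2_norm (\<lambda>\<xi>. h \<xi> - g \<xi>) = 0"
    using h(2) by (subst L2_norm_eq_0_iff[OF L2_diff[OF h(1) g]]) (auto simp: g_def indicator_def elim!: eventually_mono)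
  then show ?thesis
    using g_span by (intro closed_span_closed[OF E h(1)]) (auto intro!: bexI[of _ g])
qed

lemma H2I:
  assumes "f has_fourier_transform g" "AE \<xi> in lebesgue. \<xi> \<le> 0 \<longrightarrow> g \<xi> = 0"
  shows "f \<in> H2"
  using assms fourier_transform_L2(1)[OF assms(1)] by (auto simp: H2_def)

text \<open>The wavelet is the inverse Fourier integral of \<open>\<chi>\<^sub>S\<close>. Orthonormality and density are
  statements about inner products and norms, so they can be checked on the Fourier side.\<close>
theorem tiles_imp_wavelet_set:
  assumes S: "S \<in> sets lebesgue" "bounded S" "S \<subseteq> {0<..}" and tiles: "integer_tile S" "dyadic_tile S"
    and K: "K \<in> sets lebesgue" "K \<subseteq> {0<..}" "AE x in lebesgue. x \<in> K \<longleftrightarrow> x \<in> S"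
  shows "H2_wavelet_set K"
proof -
  let ?E = "wavelet_system_ft (indicator S)"
  obtain R where R: "\<And>x. x \<in> S \<Longrightarrow> \<bar>x\<bar> \<le> R" using S(2) by (auto simp: bounded_iff)
  have ind: "indicator S \<in> L2_compact"
  proof (rule L2_compactI)
    show "indicator S \<in> L2" by (intro L2_indicator bounded_set_imp_lmeasurable S)
    show "indicator S x = 0" if "R < \<bar>x\<bar>" for x
      using R[of x] that by (auto simp: indicator_def)
  qed
  define \<psi> where "\<psi> x = fourier_integral (indicator S) (- x)" for x
  have \<psi>: "\<psi> has_fourier_transform (indicator S)"
    unfolding \<psi>_def using fourier_transform_inverse[OF ind] .
  note ft = fourier_transform_wavelet_system[OF \<psi>]
  have vanish: "\<xi> \<le> 0 \<longrightarrow> ?E i \<xi> = 0" for i \<xi>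
  proof
    assume "\<xi> \<le> 0"
    then have "\<xi> / 2 powi fst i \<le> 0" by (simp add: divide_le_0_iff)
    then have "\<xi> / 2 powi fst i \<notin> S" using S(3) by auto
    then show "?E i \<xi> = 0" by (simp add: wavelet_system_ft_def split_beta)
  qed
  have "L2_orthonormal_basis (wavelet_system \<psi>) H2"
    unfolding L2_orthonormal_basis_def
  proof (intro conjI allI ballI impI)
    show "wavelet_system \<psi> i \<in> H2" for i
      by (rule H2I[OF ft]) (use vanish in auto)
    show "L2_inner (wavelet_system \<psi> i) (wavelet_system \<psi> j) = (if i = j then 1 else 0)" for i j
      using wavelet_system_ft_orthonormal[OF S tiles]
      unfolding fourier_transform_inner[OF ft[of i] ft[of j]] L2_orthonormal_def by blast
    fix f \<epsilon> assume "f \<in> H2" "\<epsilon> > (0::real)"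
    then obtain h where h: "f has_fourier_transform h" "AE \<xi> in lebesgue. \<xi> \<le> 0 \<longrightarrow> h \<xi> = 0"
      by (auto simp: H2_def)
    have "h \<in> L2_closed_span ?E"
      by (rule wavelet_system_ft_complete[OF S(1,2) tiles fourier_transform_L2(2)[OF h(1)] h(2)])
    then obtain A c where A: "finite A" "L2_norm (\<lambda>\<xi>. h \<xi> - (\<Sum>i\<in>A. c i * ?E i \<xi>)) < \<epsilon>"
      using \<open>\<epsilon> > 0\<close> by (rule closed_span_approx)
    have "(\<lambda>x. f x - (\<Sum>i\<in>A. c i * wavelet_system \<psi> i x)) has_fourier_transform
        (\<lambda>\<xi>. h \<xi> - (\<Sum>i\<in>A. c i * ?E i \<xi>))"
      by (intro fourier_transform_diff fourier_transform_sum fourier_transform_scale h(1) ft)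
    from fourier_transform_norm[OF this] A
    show "\<exists>A c. finite A \<and> L2_norm (\<lambda>x. f x - (\<Sum>i\<in>A. c i * wavelet_system \<psi> i x)) < \<epsilon>"
      by (intro exI[of _ A] exI[of _ c]) simp
  qed
  moreover have "\<psi> \<in> H2"
    by (rule H2I[OF \<psi>], rule AE_I2) (use S(3) in \<open>auto simp: indicator_def\<close>)
  ultimately have "H2_wavelet \<psi>" by (simp add: H2_wavelet_iff)
  moreover have "AE \<xi> in lebesgue. cmod (indicator S \<xi>) = indicator K \<xi>"
    using K(3) by eventually_elim (auto simp: indicator_def)
  ultimately show ?thesis
    using K(1,2) \<psi> unfolding H2_wavelet_set_def by blast
qed

section \<open>Tilings from wavelet sets\<close>

lemma ex1_eq: "\<exists>!x. P x \<Longrightarrow> P a \<Longrightarrow> P b \<Longrightarrow> a = b"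
  by blast

text \<open>This property turns statements about almost every point into statements about every point: a
  configuration of points of \<open>S\<close> that occurs once persists on an interval to the right, hence on a set of
  positive measure.\<close>
definition right_open :: "real set \<Rightarrow> bool" where
  "right_open S \<longleftrightarrow> (\<forall>x\<in>S. \<exists>\<epsilon>>0. {x..<x + \<epsilon>} \<subseteq> S)"

lemma right_openE:
  assumes "right_open S" "x \<in> S"
  obtains \<epsilon> where "\<epsilon> > 0" "\<And>y. x \<le> y \<Longrightarrow> y < x + \<epsilon> \<Longrightarrow> y \<in> S"
proof -
  obtain \<epsilon> where "\<epsilon> > 0" "{x..<x + \<epsilon>} \<subseteq> S" using assms by (auto simp: right_open_def)
  then show ?thesis by (intro that[of \<epsilon>]) auto
qed

lemma AE_lebesgue_interval:
  assumes "AE x in lebesgue. P x" "a < (b::real)"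
  shows "\<exists>x\<in>{a<..<b}. P x"
proof (rule ccontr)
  assume none: "\<not> ?thesis"
  obtain N where N: "{x \<in> space lebesgue. \<not> P x} \<subseteq> N" "emeasure lebesgue N = 0" "N \<in> sets lebesgue"
    using assms(1) by (rule AE_E)
  have "{a<..<b} \<subseteq> N" using none N(1) by auto
  then have "emeasure lebesgue {a<..<b} \<le> emeasure lebesgue N" by (rule emeasure_mono[OF _ N(3)])
  then show False using N(2) assms(2) by simp
qed

text \<open>The assumption gives the periodization of \<open>\<chi>\<^sub>S\<close> the Fourier coefficients of the constant \<open>1\<close>, so by
  completeness of the exponentials on \<open>[0, 1)\<close> it equals \<open>1\<close> almost everywhere. Its value at \<open>x\<close> is the
  number of integer translates of \<open>x\<close> in \<open>S\<close>.\<close>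
lemma cover_of_fourier_coefficients:
  assumes S: "S \<in> sets lebesgue" "bounded S"
    and coeff: "\<And>k::int. (LINT x|lebesgue. indicator S x * cis (2 * pi * of_int k * x)) = (if k = 0 then 1 else 0)"
  shows "AE x in lebesgue. x \<in> {0..<1} \<longrightarrow> (\<exists>!k::int. x + of_int k \<in> S)"
proof -
  obtain M :: nat where M: "S \<subseteq> {- real M..<real M}"
    using bounded_subset_nat_interval[OF S(2)] .
  let ?L = "{- int M..<int M}" and ?I = "{0..<1::real}"
  define N where "N x = (\<Sum>l\<in>?L. indicator S (x + of_int l) :: complex)" for x
  have I: "?I \<in> lmeasurable" by (rule bounded_set_imp_lmeasurable) auto
  have ind: "(\<lambda>x. indicator S (x + of_int l) :: complex) \<in> borel_measurable lebesgue" for l :: int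
    using measurable_compose[OF affine_measurable_lebesgue[of 1 "of_int l"] borel_measurable_indicator[OF S(1)]]
    by (simp add: add.commute)
  define u where "u x = N x * indicator ?I x" for x
  have u: "u \<in> L2"
    unfolding u_def
  proof (rule L2_mult_bounded[OF L2_indicator[OF I], where B = "\<Sum>l\<in>?L. 1"])
    show "N \<in> borel_measurable lebesgue"
      unfolding N_def[abs_def] by (intro borel_measurable_sum ind)
    show "cmod (N x) \<le> (\<Sum>l\<in>?L. 1)" for x
      unfolding N_def by (rule sum_norm_le) (simp add: indicator_def)
  qed
  define P where "P x = u x - indicator ?I x" for x
  have P: "P \<in> L2" unfolding P_def[abs_def] by (intro L2_diff u L2_indicator I)
  have "L2_inner P (char_on ?I k) = 0" for k
  proof -
    have "L2_inner u (char_on ?I k) = (LINT x|lebesgue. N x * (indicator ?I x * cis (2 * pi * of_int (- k) * x)))"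
      unfolding L2_inner_def u_def char_on_def
      by (intro Bochner_Integration.integral_cong) (auto simp: indicator_def cis_cnj)
    also have "\<dots> = (if - k = 0 then 1 else 0)"
      unfolding N_def integral_periodize[OF S(1) M, symmetric] by (rule coeff)
    finally have 1: "L2_inner u (char_on ?I k) = (if k = 0 then 1 else 0)" by simp
    have "indicator ?I = char_on ?I 0" by (auto simp: char_on_def)
    then have 2: "L2_inner (indicator ?I) (char_on ?I k) = (if k = 0 then 1 else 0)"
      using integral_unit_interval_cis[of "0 - k"] L2_inner_char_on[of ?I 0 k] by simp
    show ?thesis
      unfolding P_def using L2_inner_diff_left[OF u L2_indicator[OF I] char_on_L2[OF I, of k]] 1 2 by simp
  qed
  moreover have "P \<in> L2_closed_span (char_on ?I)"
    using integer_tile_inj[OF unit_interval_tile[of 0]]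
    by (intro exponentials_complete I P) (auto simp: P_def u_def)
  ultimately have "L2_norm P = 0"
    by (intro orthogonal_to_closed_span[of "char_on ?I"] char_on_L2[OF I])
  then have "AE x in lebesgue. P x = 0" using L2_norm_eq_0_iff[OF P] by simp
  then show ?thesis
  proof eventually_elim
    case (elim x)
    show ?case
    proof
      assume x: "x \<in> ?I"
      have "N x = of_nat (card {l \<in> ?L. x + of_int l \<in> S})"
        unfolding N_def by (simp add: indicator_def of_bool_def sum.If_cases Int_def)
      moreover have "N x = 1" using elim x by (simp add: P_def u_def)
      ultimately have "of_nat (card {l \<in> ?L. x + of_int l \<in> S}) = (1 :: complex)" by simp
      then have "card {l \<in> ?L. x + of_int l \<in> S} = 1" by (simp only: of_nat_eq_1_iff)
      then obtain k where k: "{l \<in> ?L. x + of_int l \<in> S} = {k}" by (rule card_1_singletonE)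
      have "l \<in> ?L" if "x + of_int l \<in> S" for l :: int
      proof -
        have "x + of_int l \<in> {- real M..<real M}" using M that by auto
        with x have "real_of_int l < real_of_int (int M)" "real_of_int (- int M - 1) < real_of_int l"
          by auto
        then have "l < int M" "- int M - 1 < l" by (simp_all only: of_int_less_iff)
        then show ?thesis by simp
      qed
      then have "{l. x + of_int l \<in> S} = {k}" using k by auto
      then show "\<exists>!k::int. x + of_int k \<in> S"
        by (intro ex1I[of _ k]) auto
    qed
  qed
qed

text \<open>The transform may be changed on a null set so that its modulus is \<open>\<chi>\<^sub>S\<close> at every point; the
  value \<open>1\<close> is put on exceptional points of \<open>S\<close>.\<close>
lemma wavelet_set_phase:
  assumes "H2_wavelet_set K" and S: "S \<in> sets lebesgue" "bounded S"
    and KS: "AE x in lebesgue. x \<in> K \<longleftrightarrow> x \<in> S"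
  obtains \<psi> g where "H2_wavelet \<psi>" "\<psi> has_fourier_transform g" "\<And>\<xi>. cmod (g \<xi>) = indicator S \<xi>"
proof -
  obtain \<psi> g where \<psi>: "H2_wavelet \<psi>" "\<psi> has_fourier_transform g"
    "AE \<xi> in lebesgue. cmod (g \<xi>) = indicator K \<xi>"
    using assms(1) by (auto simp: H2_wavelet_set_def)
  have [measurable]: "g \<in> borel_measurable lebesgue" using fourier_transform_L2(2)[OF \<psi>(2)] L2_measurable by blast
  note [measurable] = S(1)
  define g' where "g' \<xi> = (if \<xi> \<in> S then if cmod (g \<xi>) = 1 then g \<xi> else 1 else 0)" for \<xi>
  have norm: "cmod (g' \<xi>) = indicator S \<xi>" for \<xi> by (simp add: g'_def)
  have meas: "g' \<in> borel_measurable lebesgue" unfolding g'_def[abs_def] by measurable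
  have "(\<lambda>\<xi>. g' \<xi> * indicator S \<xi>) \<in> L2"
  proof (rule L2_mult_bounded[OF L2_indicator meas, where B = 1])
    show "S \<in> lmeasurable" by (intro bounded_set_imp_lmeasurable S)
    show "cmod (g' \<xi>) \<le> 1" for \<xi> by (simp add: norm indicator_def)
  qed
  also have "(\<lambda>\<xi>. g' \<xi> * indicator S \<xi>) = g'" by (auto simp: g'_def)
  finally have "g' \<in> L2" .
  moreover have "AE \<xi> in lebesgue. g \<xi> = g' \<xi>"
    using \<psi>(3) KS by eventually_elim (auto simp: g'_def indicator_def split: if_splits)
  ultimately have "\<psi> has_fourier_transform g'" by (rule fourier_transform_cong_AE[OF \<psi>(2)])
  then show ?thesis using norm by (intro that[OF \<psi>(1)])
qed

lemma AE_unit_interval_imp_dense: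
  fixes x \<epsilon> :: real
  assumes AE: "AE x in lebesgue. x \<in> {0..<1} \<longrightarrow> (\<exists>!k::int. x + of_int k \<in> S)" and "\<epsilon> > 0"
  shows "\<exists>y\<in>{x<..<x + \<epsilon>}. \<exists>!k::int. y + of_int k \<in> S"
proof -
  define n where "n = \<lfloor>x\<rfloor>"
  have n: "of_int n \<le> x" "x < of_int n + 1" unfolding n_def by linarith+
  have "x - of_int n < min (x - of_int n + \<epsilon>) 1" using n \<open>\<epsilon> > 0\<close> by simp
  from AE_lebesgue_interval[OF AE this]
  obtain z where z: "z \<in> {x - of_int n<..<min (x - of_int n + \<epsilon>) 1}" "z \<in> {0..<1} \<longrightarrow> (\<exists>!k::int. z + of_int k \<in> S)"
    by (rule bexE)
  have "z \<in> {0..<1}" using z(1) n by simp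
  with z(2) have ex1: "\<exists>!k::int. z + of_int k \<in> S" by (rule mp)
  have "\<exists>!k::int. (z + of_int n) + of_int k \<in> S"
  proof -
    obtain k :: int where k: "z + of_int k \<in> S" using ex1 by (rule ex1E)
    show ?thesis
    proof (rule ex1I[of _ "k - n"])
      show "z + of_int n + of_int (k - n) \<in> S" using k by simp
      show "l = k - n" if "z + of_int n + of_int l \<in> S" for l :: int
      proof -
        have "z + of_int (n + l) \<in> S" using that by (simp add: add.assoc)
        then have "n + l = k" using k by (rule ex1_eq[OF ex1])
        then show ?thesis by simp
      qed
    qed
  qed
  moreover have "x - of_int n < z" "z < x - of_int n + \<epsilon>" using z(1) by simp_all
  then have "z + of_int n \<in> {x<..<x + \<epsilon>}" by simp
  ultimately show ?thesis by (rule bexI)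
qed

text \<open>Orthonormality within the scale \<open>j = 0\<close> gives the first claim. It makes \<open>S\<close> injective modulo the integers, so the
  exponentials are complete on \<open>S\<close>; the orthogonality relations between two scales are the vanishing
  Fourier coefficients of a function on \<open>S\<close>, and they force the dilates of \<open>S\<close> to be disjoint. Density
  of the system in \<open>H\<^sup>2\<close> leaves no room outside the dilates. Unique representation is claimed
  for some point of every interval, a form that passes easily to logarithms.\<close>
theorem wavelet_set_imp_tiles:
  assumes K: "H2_wavelet_set K" and S: "S \<in> sets lebesgue" "bounded S" "S \<subseteq> {0<..}" "right_open S"
    and KS: "AE x in lebesgue. x \<in> K \<longleftrightarrow> x \<in> S"
  shows "\<And>x \<epsilon>. \<epsilon> > 0 \<Longrightarrow> \<exists>y\<in>{x<..<x + \<epsilon>}. \<exists>!k::int. y + of_int k \<in> S" (is "PROP ?T")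
    and "\<And>x \<epsilon>. x > 0 \<Longrightarrow> \<epsilon> > 0 \<Longrightarrow> \<exists>y\<in>{x<..<x + \<epsilon>}. \<exists>!j::int. 2 powi j * y \<in> S" (is "PROP ?D")
proof -
  note SL = bounded_set_imp_lmeasurable[OF S(2,1)]
  obtain \<psi> g where \<psi>: "H2_wavelet \<psi>" "\<psi> has_fourier_transform g" and g: "\<And>\<xi>. cmod (g \<xi>) = indicator S \<xi>"
    using wavelet_set_phase[OF K S(1,2) KS] by blast
  note ft = fourier_transform_wavelet_system[OF \<psi>(2)]
  have g_L2: "g \<in> L2" by (rule fourier_transform_L2(2)[OF \<psi>(2)])
  have [measurable]: "g \<in> borel_measurable lebesgue" using g_L2 L2_measurable by blast
  have g0: "g \<xi> = 0 \<longleftrightarrow> \<xi> \<notin> S" for \<xi> 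
    using g[of \<xi>] norm_eq_zero[of "g \<xi>"] by (cases "\<xi> \<in> S") auto
  have orth: "L2_inner (wavelet_system_ft g i) (wavelet_system_ft g j) = (if i = j then 1 else 0)" for i j
    using \<psi>(1) unfolding fourier_transform_inner[OF ft[of i] ft[of j], symmetric]
      H2_wavelet_iff L2_orthonormal_basis_def by blast
  have "(LINT x|lebesgue. indicator S x * cis (2 * pi * of_int k * x)) = (if k = 0 then 1 else 0)" for k :: int
  proof -
    have "L2_inner (wavelet_system_ft g (0, - k)) (wavelet_system_ft g (0, 0))
        = (LINT x|lebesgue. indicator S x * cis (2 * pi * of_int k * x))"
      unfolding L2_inner_def
    proof (intro Bochner_Integration.integral_cong refl)
      fix x
      have "g x * cnj (g x) = indicator S x"
        using g[of x] by (simp add: complex_norm_square[symmetric] indicator_def)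
      then show "wavelet_system_ft g (0, - k) x * cnj (wavelet_system_ft g (0, 0) x) = indicator S x * cis (2 * pi * of_int k * x)"
        by (simp add: wavelet_system_ft_def mult.assoc mult.commute)
    qed
    then show ?thesis using orth[of "(0, - k)" "(0, 0)"] by simp
  qed
  then have T: "AE x in lebesgue. x \<in> {0..<1} \<longrightarrow> (\<exists>!k::int. x + of_int k \<in> S)"
    by (rule cover_of_fourier_coefficients[OF S(1,2)])
  show dense: "PROP ?T"
    by (rule AE_unit_interval_imp_dense[OF T])
  have inj: "inj_on (\<lambda>x. cis (2 * pi * x)) S"
  proof (rule inj_onI, rule ccontr)
    fix x y assume xy: "x \<in> S" "y \<in> S" "cis (2 * pi * x) = cis (2 * pi * y)" "x \<noteq> y"
    then obtain k :: int where k: "x = y + of_int k" by (auto simp: cis_eq_iff_int)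
    obtain \<epsilon> where \<epsilon>: "\<epsilon> > 0" "\<And>z. x \<le> z \<Longrightarrow> z < x + \<epsilon> \<Longrightarrow> z \<in> S" using right_openE[OF S(4) xy(1)] by blast
    obtain \<delta> where \<delta>: "\<delta> > 0" "\<And>z. y \<le> z \<Longrightarrow> z < y + \<delta> \<Longrightarrow> z \<in> S" using right_openE[OF S(4) xy(2)] by blast
    have "min \<epsilon> \<delta> > 0" using \<epsilon>(1) \<delta>(1) by simp
    from dense[OF this, of y]
    obtain z where z: "z \<in> {y<..<y + min \<epsilon> \<delta>}" "\<exists>!k::int. z + of_int k \<in> S" by (rule bexE)
    have "z + of_int 0 \<in> S" using z(1) by (intro \<delta>(2)) auto
    moreover have "z + of_int k \<in> S" using z(1) k by (intro \<epsilon>(2)) auto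
    ultimately have "k = 0" by (intro ex1_eq[OF z(2)])
    with k xy(4) show False by simp
  qed
  have disjoint: "\<not> (x \<in> S \<and> 2 powi j * x \<in> S)" if "j \<noteq> 0" for j x
  proof
    assume x: "x \<in> S \<and> 2 powi j * x \<in> S"
    define c :: real where "c = 2 powi j"
    have "c > 0" by (simp add: c_def)
    \<comment> \<open>Up to a constant, the coefficients of \<open>H\<close> on \<open>S\<close> are inner products between the scales \<open>-j\<close> and \<open>0\<close>.\<close>
    define H where "H \<eta> = g (0 + c * \<eta>) * cnj (g \<eta>)" for \<eta>
    have Hn: "cmod (H \<eta>) = indicator S (c * \<eta>) * indicator S \<eta>" for \<eta> by (simp add: H_def norm_mult g)
    have H: "H \<in> L2"
    proof (rule L2I)
      have "(\<lambda>\<eta>. g (0 + c * \<eta>)) \<in> borel_measurable lebesgue"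
        using L2_measurable[OF L2_affine[OF g_L2, of c 0]] \<open>c > 0\<close> by simp
      then show "H \<in> borel_measurable lebesgue" unfolding H_def[abs_def] by measurable
      show "integrable lebesgue (indicat_real S)"
        using SL by (intro integrable_real_indicator) (auto simp: fmeasurable_def)
      show "(cmod (H \<eta>))\<^sup>2 \<le> indicat_real S \<eta>" for \<eta> by (simp add: Hn indicator_def)
    qed
    have "L2_inner H (char_on S k) = 0" for k
    proof -
      have "of_real (2 powr (- real_of_int (- j) / 2)) * L2_inner H (char_on S k)
          = L2_inner (wavelet_system_ft g (- j, 0)) (wavelet_system_ft g (0, - k))"
        unfolding L2_inner_def Bochner_Integration.integral_mult_right_zero[symmetric]
      proof (intro Bochner_Integration.integral_cong refl)
        fix \<eta>
        show "of_real (2 powr (- real_of_int (- j) / 2)) * (H \<eta> * cnj (char_on S k \<eta>))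
          = wavelet_system_ft g (- j, 0) \<eta> * cnj (wavelet_system_ft g (0, - k) \<eta>)"
        proof (cases "\<eta> \<in> S")
          case True
          have "g (\<eta> / 2 powi (- j)) = g (0 + c * \<eta>)" by (simp add: c_def divide_powi_eq)
          then show ?thesis using True
            by (simp add: wavelet_system_ft_def H_def char_on_def mult.assoc mult.left_commute mult.commute)
        qed (simp add: wavelet_system_ft_def H_def g0)
      qed
      also have "\<dots> = 0" using orth that by simp
      finally show ?thesis by simp
    qed
    moreover have "H \<in> L2_closed_span (char_on S)"
      by (intro exponentials_complete SL inj S(2) H) (simp add: H_def g0)
    ultimately have "L2_norm H = 0"
      by (intro orthogonal_to_closed_span[of "char_on S"] char_on_L2[OF SL])
    then have AE: "AE \<eta> in lebesgue. H \<eta> = 0" using L2_norm_eq_0_iff[OF H] by simp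
    obtain \<epsilon> where \<epsilon>: "\<epsilon> > 0" "\<And>z. x \<le> z \<Longrightarrow> z < x + \<epsilon> \<Longrightarrow> z \<in> S" using right_openE[OF S(4)] x by blast
    obtain \<delta> where \<delta>: "\<delta> > 0" "\<And>z. c * x \<le> z \<Longrightarrow> z < c * x + \<delta> \<Longrightarrow> z \<in> S"
      using right_openE[OF S(4)] x c_def by blast
    obtain \<eta> where \<eta>: "\<eta> \<in> {x<..<x + min \<epsilon> (\<delta> / c)}" "H \<eta> = 0"
      using AE_lebesgue_interval[OF AE, of x "x + min \<epsilon> (\<delta> / c)"] \<epsilon>(1) \<delta>(1) \<open>c > 0\<close> by auto
    have "\<eta> \<in> S" using \<eta>(1) by (intro \<epsilon>(2)) auto
    moreover have "c * \<eta> \<in> S"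
    proof (rule \<delta>(2))
      show "c * x \<le> c * \<eta>" using \<eta>(1) \<open>c > 0\<close> by simp
      have "\<eta> < x + min \<epsilon> (\<delta> / c)" using \<eta>(1) by simp
      then have "\<eta> - x < \<delta> / c" by linarith
      then show "c * \<eta> < c * x + \<delta>" using \<open>c > 0\<close> by (simp add: less_divide_eq algebra_simps)
    qed
    ultimately have "cmod (H \<eta>) = 1" by (simp add: Hn)
    with \<eta>(2) show False by simp
  qed
  show "PROP ?D"
  proof -
    fix x \<epsilon> :: real assume "x > 0" "\<epsilon> > 0"
    \<comment> \<open>\<open>E\<close> is the part of the interval that no dilate of \<open>S\<close> covers; the function with transform \<open>\<chi>\<^sub>E\<close> is orthogonal to the whole system.\<close>
    define E where "E = {x<..<x + \<epsilon>} - (\<Union>j::int. {\<xi>. 2 powi j * \<xi> \<in> S})"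
    have "{\<xi>. 2 powi j * \<xi> \<in> S} \<in> sets lebesgue" for j :: int
      using measurable_sets[OF affine_measurable_lebesgue[of "2 powi j" 0] S(1)] by (simp add: vimage_def)
    then have E_sets: "E \<in> sets lebesgue" unfolding E_def by (intro sets.Diff sets.countable_UN) auto
    have "bounded E" unfolding E_def by (rule bounded_subset[of "{x<..<x + \<epsilon>}"]) auto
    note EL = bounded_set_imp_lmeasurable[OF \<open>bounded E\<close> E_sets]
    have EC: "indicator E \<in> L2_compact"
      by (rule L2_compactI[where R = "x + \<epsilon>"]) (use EL \<open>x > 0\<close> in \<open>auto simp: E_def indicator_def intro: L2_indicator\<close>)
    define f where "f y = fourier_integral (indicator E) (- y)" for y
    have f: "f has_fourier_transform (indicator E)"
      unfolding f_def using fourier_transform_inverse[OF EC] .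
    have "f \<in> H2" by (rule H2I[OF f], rule AE_I2) (use \<open>x > 0\<close> in \<open>auto simp: E_def\<close>)
    then have "f \<in> L2_closed_span (wavelet_system \<psi>)"
      using \<psi>(1) fourier_transform_L2(1)[OF f]
      unfolding H2_wavelet_iff L2_orthonormal_basis_def L2_closed_span_def by blast
    moreover have "L2_inner f (wavelet_system \<psi> i) = 0" for i
    proof -
      obtain j k where i: "i = (j, k)" by (cases i)
      have "indicator E \<xi> * cnj (wavelet_system_ft g i \<xi>) = 0" for \<xi>
      proof (cases "\<xi> \<in> E")
        case True
        then have "2 powi (- j) * \<xi> \<notin> S" unfolding E_def by blast
        then show ?thesis by (simp add: i wavelet_system_ft_def g0 divide_powi_eq)
      qed simp
      then have "L2_inner (indicator E) (wavelet_system_ft g i) = 0"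
        unfolding L2_inner_def by (simp only:) simp
      then show ?thesis by (simp only: fourier_transform_inner[OF f ft])
    qed
    ultimately have "L2_norm f = 0"
      by (intro orthogonal_to_closed_span[of "wavelet_system \<psi>"] fourier_transform_L2(1)[OF ft])
    then have "L2_norm (indicator E) = 0" using fourier_transform_norm[OF f] by simp
    then have "AE \<xi> in lebesgue. (indicator E \<xi> :: complex) = 0"
      by (subst (asm) L2_norm_eq_0_iff[OF L2_indicator[OF EL]])
    from AE_lebesgue_interval[OF this, of x "x + \<epsilon>"] \<open>\<epsilon> > 0\<close>
    obtain y where y: "y \<in> {x<..<x + \<epsilon>}" "y \<notin> E" by (auto simp: indicator_eq_0_iff)
    then obtain j :: int where j: "2 powi j * y \<in> S" unfolding E_def by blast
    have uniq: "i = j" if "2 powi i * y \<in> S" for i :: int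
    proof (rule ccontr)
      assume "i \<noteq> j"
      have "2 powi (i - j) * (2 powi j * y) = 2 powi i * y"
        by (simp add: power_int_diff)
      with disjoint[of "i - j" "2 powi j * y"] j that \<open>i \<noteq> j\<close> show False by simp
    qed
    have "\<exists>!j::int. 2 powi j * y \<in> S" by (rule ex1I[of "\<lambda>j::int. 2 powi j * y \<in> S", OF j uniq])
    then show "\<exists>y\<in>{x<..<x + \<epsilon>}. \<exists>!j::int. 2 powi j * y \<in> S" using y(1) by (rule bexI)
  qed
qed

section \<open>Tilings by finitely many intervals\<close>

text \<open>Half-open intervals fit together without overlap at common endpoints, so tilings can be stated for
  every point rather than almost everywhere.\<close>
definition half_open_union :: "nat \<Rightarrow> (nat \<Rightarrow> real) \<Rightarrow> (nat \<Rightarrow> real) \<Rightarrow> real set" where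
  "half_open_union m a b = (\<Union>r\<le>m. {a r..<b r})"

lemma floor_diff_right_constant:
  fixes x c :: real
  assumes "x \<le> y" "y < x + (1 - frac (x - c))" shows "\<lfloor>y - c\<rfloor> = \<lfloor>x - c\<rfloor>"
  using assms unfolding frac_def by (intro floor_unique) linarith+

text \<open>Whether \<open>y + k\<close> lies in the union depends only on \<open>k\<close> and on the floors of \<open>y - a\<^sub>r\<close> and \<open>y - b\<^sub>r\<close>. These are
  constant on an interval \<open>[x, x + d)\<close>, in which some point with a unique translate lies.\<close>
lemma integer_tile_of_dense:
  assumes dense: "\<And>x \<epsilon>::real. \<epsilon> > 0 \<Longrightarrow> \<exists>y\<in>{x<..<x + \<epsilon>}. \<exists>!k::int. y + of_int k \<in> half_open_union m a b"
  shows "integer_tile (half_open_union m a b)"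
  unfolding integer_tile_def
proof
  fix x :: real
  define D where "D = (\<lambda>r. 1 - frac (x - a r)) ` {..m} \<union> (\<lambda>r. 1 - frac (x - b r)) ` {..m}"
  have D: "finite D" "D \<noteq> {}" "\<And>d. d \<in> D \<Longrightarrow> d > 0"
    by (auto simp: D_def frac_lt_1)
  have "Min D > 0" using D by simp
  from dense[OF this, of x] obtain y where y: "y \<in> {x<..<x + Min D}"
    "\<exists>!k::int. y + of_int k \<in> half_open_union m a b" by (rule bexE)
  have near: "y < x + d" if "d \<in> D" for d
  proof -
    have "Min D \<le> d" using D(1) that by (rule Min_le)
    with y(1) show ?thesis by simp
  qed
  have iff: "z + of_int k \<in> {u..<v} \<longleftrightarrow> - k \<le> \<lfloor>z - u\<rfloor> \<and> \<lfloor>z - v\<rfloor> < - k" for z u v :: real and k :: int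
    by (auto simp: le_floor_iff floor_less_iff)
  have "y + of_int k \<in> {a r..<b r} \<longleftrightarrow> x + of_int k \<in> {a r..<b r}" if "r \<le> m" for r and k :: int
  proof -
    have "\<lfloor>y - a r\<rfloor> = \<lfloor>x - a r\<rfloor>" "\<lfloor>y - b r\<rfloor> = \<lfloor>x - b r\<rfloor>"
      using y(1) that by (auto intro!: floor_diff_right_constant near simp: D_def)
    then show ?thesis by (simp only: iff)
  qed
  then have "y + of_int k \<in> half_open_union m a b \<longleftrightarrow> x + of_int k \<in> half_open_union m a b" for k :: int
    unfolding half_open_union_def by blast
  with y(2) show "\<exists>!k::int. x + of_int k \<in> half_open_union m a b" by (simp only:)
qed

text \<open>The permutation sorts the intervals by left endpoint; the endpoint \<open>L\<close> is the smallest one, so the index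
  \<open>0\<close> stays in place. The right endpoint of an interval other than the last lies in an interval, which must come later,
  and it cannot exceed the next left endpoint without an overlap.\<close>
lemma sort_interval_partition:
  fixes A B :: "nat \<Rightarrow> real"
  assumes AB: "\<And>r. r \<le> m \<Longrightarrow> L \<le> A r" "\<And>r. r \<le> m \<Longrightarrow> A r < B r" "\<And>r. r \<le> m \<Longrightarrow> B r \<le> R"
    and L: "A 0 = L"
    and disj: "\<And>r s x. r \<le> m \<Longrightarrow> s \<le> m \<Longrightarrow> x \<in> {A r..<B r} \<Longrightarrow> x \<in> {A s..<B s} \<Longrightarrow> r = s"
    and cover: "\<And>x. L \<le> x \<Longrightarrow> x < R \<Longrightarrow> \<exists>r\<le>m. x \<in> {A r..<B r}"
  shows "\<exists>\<rho>. \<rho> permutes {1..m} \<and> (\<forall>i<m. B (\<rho> i) = A (\<rho> (i + 1))) \<and> B (\<rho> m) = R"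
proof -
  have A_inj: "r = s" if "r \<le> m" "s \<le> m" "A r = A s" for r s
    using disj[of r s "A r"] AB(2)[OF that(1)] AB(2)[OF that(2)] that by auto
  define xs where "xs = sort_key A [0..<Suc m]"
  have xs: "set xs = {..m}" "distinct xs" "sorted (map A xs)" "length xs = Suc m"
    by (auto simp: xs_def)
  define \<rho> where "\<rho> i = (if i \<le> m then xs ! i else i)" for i
  have \<rho>_le: "\<rho> i \<le> m" if "i \<le> m" for i
    using that nth_mem[of i xs] xs by (auto simp: \<rho>_def)
  have "bij_betw (\<lambda>i. xs ! i) {..<Suc m} {..m}"
    by (rule bij_betw_nth) (use xs in auto)
  then have "bij_betw \<rho> {..m} {..m}"
    by (subst bij_betw_cong[where g = "\<lambda>i. xs ! i"]) (auto simp: \<rho>_def lessThan_Suc_atMost)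
  then have perm: "\<rho> permutes {..m}"
    by (rule bij_imp_permutes) (auto simp: \<rho>_def)
  have mono: "A (\<rho> i) \<le> A (\<rho> j)" if "i \<le> j" "j \<le> m" for i j
    using sorted_nth_mono[OF xs(3), of i j] that xs(4) by (simp add: \<rho>_def)
  have surj: "\<exists>l\<le>m. \<rho> l = s" if "s \<le> m" for s
  proof -
    have "s \<in> \<rho> ` {..m}" using permutes_image[OF perm] that by simp
    then show ?thesis by auto
  qed
  have \<rho>0: "\<rho> 0 = 0"
  proof -
    obtain l where "l \<le> m" "\<rho> l = 0" using surj[of 0] by auto
    then have "A (\<rho> 0) \<le> A 0" using mono[of 0 l] by simp
    moreover have "A 0 \<le> A (\<rho> 0)" using AB(1)[of "\<rho> 0"] \<rho>_le[of 0] L by simp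
    ultimately show ?thesis by (intro A_inj \<rho>_le) auto
  qed
  have perm1: "\<rho> permutes {1..m}"
    by (rule permutes_superset[OF perm]) (use \<rho>0 in \<open>auto simp: not_le\<close>)
  have after: "\<exists>l\<le>m. i < l \<and> A (\<rho> l) \<le> B (\<rho> i)" if i: "i \<le> m" "B (\<rho> i) < R" for i
  proof -
    have i': "\<rho> i \<le> m" by (rule \<rho>_le[OF i(1)])
    have "L \<le> B (\<rho> i)" using AB(1,2)[OF i'] by simp
    then obtain s where s: "s \<le> m" "B (\<rho> i) \<in> {A s..<B s}" using cover i(2) by blast
    obtain l where l: "l \<le> m" "\<rho> l = s" using surj[OF s(1)] by blast
    have "\<not> l \<le> i"
    proof
      assume "l \<le> i"
      then have "A s \<le> A (\<rho> i)" using mono[of l i] i l by simp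
      then have "A (\<rho> i) \<in> {A s..<B s}" using s(2) AB(2)[OF i'] by auto
      moreover have "A (\<rho> i) \<in> {A (\<rho> i)..<B (\<rho> i)}" using AB(2)[OF i'] by simp
      ultimately have "s = \<rho> i" by (intro disj[OF s(1) i'])
      with s(2) show False by simp
    qed
    with l s(2) show ?thesis by auto
  qed
  have "B (\<rho> i) = A (\<rho> (i + 1))" if im: "i < m" for i
  proof -
    have i: "\<rho> i \<le> m" "\<rho> (i + 1) \<le> m" using im by (auto intro!: \<rho>_le)
    have le: "B (\<rho> i) \<le> A (\<rho> (i + 1))"
    proof (rule ccontr)
      assume "\<not> ?thesis"
      then have "A (\<rho> (i + 1)) \<in> {A (\<rho> i)..<B (\<rho> i)}" using mono[of i "i + 1"] that by simp
      moreover have "A (\<rho> (i + 1)) \<in> {A (\<rho> (i + 1))..<B (\<rho> (i + 1))}" using AB(2)[OF i(2)] by simp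
      ultimately have "\<rho> i = \<rho> (i + 1)" by (intro disj i)
      from injD[OF permutes_inj[OF perm] this] show False by simp
    qed
    then have "B (\<rho> i) < R" using AB(2,3)[OF i(2)] by simp
    then obtain l where "l \<le> m" "i < l" "A (\<rho> l) \<le> B (\<rho> i)" using after[of i] im by auto
    then have "A (\<rho> (i + 1)) \<le> B (\<rho> i)" using mono[of "i + 1" l] by simp
    with le show ?thesis by simp
  qed
  moreover have "B (\<rho> m) = R"
  proof (rule ccontr)
    assume "B (\<rho> m) \<noteq> R"
    then have "B (\<rho> m) < R" using AB(3)[OF \<rho>_le[of m]] by simp
    from after[OF _ this] show False by auto
  qed
  ultimately show ?thesis using perm1 by blast
qed

text \<open>The chain condition for translations, with general endpoints so that it also serves for logarithms of
  endpoints.\<close>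
definition translation_chain :: "nat \<Rightarrow> (nat \<Rightarrow> real) \<Rightarrow> (nat \<Rightarrow> real) \<Rightarrow> (nat \<Rightarrow> nat) \<Rightarrow> (nat \<Rightarrow> nat) \<Rightarrow> bool" where
  "translation_chain m a b \<rho> k \<longleftrightarrow> \<rho> permutes {1..m} \<and>
    {a 0..b 0} \<union> (\<Union>i\<in>{1..m}. {a (\<rho> i) - real (k i)..b (\<rho> i) - real (k i)}) = {a 0..a 0 + 1} \<and>
    (1 \<le> m \<longrightarrow> b 0 = a (\<rho> 1) - real (k 1)) \<and>
    (\<forall>i\<in>{1..<m}. b (\<rho> i) - real (k i) = a (\<rho> (i + 1)) - real (k (i + 1)))"

lemma intervals_ordered:
  fixes a b :: "nat \<Rightarrow> real"
  assumes "\<And>r. r \<le> m \<Longrightarrow> a r < b r" "\<And>r. r < m \<Longrightarrow> b r < a (r + 1)"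
    and "r < s" "s \<le> m"
  shows "b r < a s"
  using assms(3,4)
proof (induction s)
  case (Suc s)
  show ?case
  proof (cases "r = s")
    case True
    then show ?thesis using assms(2)[of s] Suc.prems by simp
  next
    case False
    then have "b r < a s" using Suc by simp
    also have "a s < b s" using assms(1)[of s] Suc.prems by simp
    also have "b s < a (Suc s)" using assms(2)[of s] Suc.prems by simp
    finally show ?thesis .
  qed
qed simp

text \<open>Each interval is translated so that it starts in \<open>[a\<^sub>0, a\<^sub>0 + 1)\<close>. If it reached beyond \<open>a\<^sub>0 + 1\<close>, the
  point \<open>a\<^sub>0\<close> would have two translates in the union. The translates of all intervals are disjoint and cover
  \<open>[a\<^sub>0, a\<^sub>0 + 1)\<close> because translates in the union are unique and exist. The translations are nonnegative, as \<open>a\<^sub>0\<close> is the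
  smallest left endpoint.\<close>
lemma integer_tile_imp_chain:
  assumes ab: "\<And>r. r \<le> m \<Longrightarrow> a r < b r" "\<And>r. r < m \<Longrightarrow> b r < a (r + 1)"
    and tile: "integer_tile (half_open_union m a b)"
  shows "\<exists>\<rho> k. translation_chain m a b \<rho> k"
proof -
  note ordered = intervals_ordered[of m a b, OF ab]
  define k where "k r = \<lfloor>a r - a 0\<rfloor>" for r
  define A where "A r = a r - of_int (k r)" for r
  define B where "B r = b r - of_int (k r)" for r
  have k0: "k 0 = 0" by (simp add: k_def)
  have a_ge: "a 0 \<le> a r" if "r \<le> m" for r
    using ordered[of 0 r] ab(1)[of 0] that by (cases "r = 0") auto
  have k_nonneg: "0 \<le> k r" if "r \<le> m" for r
    using a_ge[OF that] by (simp add: k_def)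
  have A_range: "a 0 \<le> A r" "A r < a 0 + 1" for r
    unfolding A_def k_def by linarith+
  have AB: "A r < B r" if "r \<le> m" for r using ab(1)[OF that] by (simp add: A_def B_def)
  have mem: "x + of_int (k r) \<in> half_open_union m a b" if "r \<le> m" "x \<in> {A r..<B r}" for x r
    using that by (auto simp: half_open_union_def A_def B_def intro!: bexI[of _ r])
  have B_le: "B r \<le> a 0 + 1" if "r \<le> m" for r
  proof (rule ccontr)
    assume "\<not> ?thesis"
    then have "(a 0 + 1) \<in> {A r..<B r}" using A_range(2)[of r] by simp
    from mem[OF that this] have "a 0 + of_int (k r + 1) \<in> half_open_union m a b"
      by (simp add: algebra_simps)
    moreover have "a 0 + of_int 0 \<in> half_open_union m a b"
      using ab(1)[of 0] by (auto simp: half_open_union_def intro!: bexI[of _ 0])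
    ultimately have "k r + 1 = 0" by (rule integer_tile_unique[OF tile])
    with k_nonneg[OF that] show False by simp
  qed
  have disj: "r = s" if rs: "r \<le> m" "s \<le> m" and x: "x \<in> {A r..<B r}" "x \<in> {A s..<B s}" for r s x
  proof -
    have "k r = k s"
      by (rule integer_tile_unique[OF tile mem[OF rs(1) x(1)] mem[OF rs(2) x(2)]])
    then have "a r \<le> x + of_int (k r)" "x + of_int (k r) < b r" "a s \<le> x + of_int (k r)" "x + of_int (k r) < b s"
      using x by (auto simp: A_def B_def)
    then have "\<not> b r < a s" "\<not> b s < a r" by linarith+
    then show ?thesis using ordered[of r s] ordered[of s r] rs by (cases r s rule: linorder_cases) auto
  qed
  have cover: "\<exists>r\<le>m. x \<in> {A r..<B r}" if x: "a 0 \<le> x" "x < a 0 + 1" for x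
  proof -
    obtain j :: int where "x + of_int j \<in> half_open_union m a b"
      using integer_tile_ex[OF tile, of x] by (rule exE)
    then obtain r where r: "r \<le> m" "x + of_int j \<in> {a r..<b r}" by (auto simp: half_open_union_def)
    define y where "y = x + of_int (j - k r)"
    have y: "y \<in> {A r..<B r}" using r(2) by (simp add: y_def A_def B_def)
    have "a 0 \<le> y" "y < a 0 + 1" using y A_range(1)[of r] B_le[OF r(1)] by auto
    \<comment> \<open>Both \<open>x\<close> and \<open>y\<close> lie in \<open>[a\<^sub>0, a\<^sub>0 + 1)\<close>, so the integer between them is \<open>0\<close>.\<close>
    then have "\<bar>real_of_int (j - k r)\<bar> < 1" using x unfolding y_def by linarith
    then have "j = k r" by linarith
    then show ?thesis using r y by (auto simp: y_def)
  qed
  have A0: "A 0 = a 0" by (simp add: A_def k0)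
  have "\<exists>\<rho>. \<rho> permutes {1..m} \<and> (\<forall>i<m. B (\<rho> i) = A (\<rho> (i + 1))) \<and> B (\<rho> m) = a 0 + 1"
  proof (rule sort_interval_partition)
    show "a 0 \<le> A r" for r by (rule A_range(1))
    show "A r < B r" if "r \<le> m" for r by (rule AB[OF that])
    show "B r \<le> a 0 + 1" if "r \<le> m" for r by (rule B_le[OF that])
    show "A 0 = a 0" by (rule A0)
    show "r = s" if "r \<le> m" "s \<le> m" "x \<in> {A r..<B r}" "x \<in> {A s..<B s}" for r s x
      by (rule disj[OF that])
    show "\<exists>r\<le>m. x \<in> {A r..<B r}" if "a 0 \<le> x" "x < a 0 + 1" for x by (rule cover[OF that])
  qed
  then obtain \<rho> where \<rho>: "\<rho> permutes {1..m}" "\<And>i. i < m \<Longrightarrow> B (\<rho> i) = A (\<rho> (i + 1))" "B (\<rho> m) = a 0 + 1"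
    by auto
  have \<rho>0: "\<rho> 0 = 0" using \<rho>(1) by (simp add: permutes_not_in)
  have \<rho>_le: "\<rho> i \<le> m" if "i \<le> m" for i
    using permutes_in_image[OF \<rho>(1), of i] that \<rho>0 by (cases "i = 0") auto
  define k' where "k' i = nat (k (\<rho> i))" for i
  have k': "real (k' i) = of_int (k (\<rho> i))" if "i \<le> m" for i
    using k_nonneg[OF \<rho>_le[OF that]] by (simp add: k'_def)
  have k'0: "k' 0 = 0" by (simp add: k'_def \<rho>0 k0)
  have A': "a (\<rho> i) - real (k' i) = A (\<rho> i)" and B': "b (\<rho> i) - real (k' i) = B (\<rho> i)" if "i \<le> m" for i
    using k'[OF that] by (simp_all add: A_def B_def)
  have split: "{a 0..b 0} \<union> (\<Union>i\<in>{1..m}. {a (\<rho> i) - real (k' i)..b (\<rho> i) - real (k' i)})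
      = (\<Union>i\<le>m. {A (\<rho> i)..B (\<rho> i)})"
  proof -
    have "{..m} = insert 0 {1..m}" by auto
    then have "(\<Union>i\<le>m. {A (\<rho> i)..B (\<rho> i)}) = {A (\<rho> 0)..B (\<rho> 0)} \<union> (\<Union>i\<in>{1..m}. {A (\<rho> i)..B (\<rho> i)})"
      by (simp only: UN_insert)
    moreover have "{A (\<rho> 0)..B (\<rho> 0)} = {a 0..b 0}" by (simp only: \<rho>0 A_def B_def k0) simp
    moreover have "(\<Union>i\<in>{1..m}. {a (\<rho> i) - real (k' i)..b (\<rho> i) - real (k' i)}) = (\<Union>i\<in>{1..m}. {A (\<rho> i)..B (\<rho> i)})"
      by (intro SUP_cong refl) (simp add: A' B')
    ultimately show ?thesis by (simp only:)
  qed
  have "(\<Union>i\<le>m. {A (\<rho> i)..B (\<rho> i)}) = {a 0..a 0 + 1}"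
  proof (intro equalityI subsetI)
    fix x assume "x \<in> (\<Union>i\<le>m. {A (\<rho> i)..B (\<rho> i)})"
    then obtain i where "i \<le> m" "A (\<rho> i) \<le> x" "x \<le> B (\<rho> i)" by auto
    then show "x \<in> {a 0..a 0 + 1}" using A_range(1)[of "\<rho> i"] B_le[OF \<rho>_le[of i]] by simp
  next
    fix x assume x: "x \<in> {a 0..a 0 + 1}"
    show "x \<in> (\<Union>i\<le>m. {A (\<rho> i)..B (\<rho> i)})"
    proof (cases "x = a 0 + 1")
      case True
      then have "x \<in> {A (\<rho> m)..B (\<rho> m)}" using \<rho>(3) A_range(2)[of "\<rho> m"] by simp
      then show ?thesis by blast
    next
      case False
      then obtain r where r: "r \<le> m" "x \<in> {A r..<B r}" using cover[of x] x by auto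
      obtain i where i: "r = \<rho> i" using surjD[OF permutes_surj[OF \<rho>(1)], of r] by (rule exE)
      have "i \<le> m"
        using permutes_not_in[OF \<rho>(1), of i] r(1) i by (cases "i \<le> m") auto
      then show ?thesis using r i by auto
    qed
  qed
  then have "translation_chain m a b \<rho> k'"
    unfolding translation_chain_def split
    using \<rho>(1) \<rho>(2)[of 0] \<rho>(2) A' B' by (auto simp: \<rho>0 B_def k0)
  then show ?thesis by blast
qed

text \<open>Adjacency of consecutive closed intervals makes the half-open ones a partition of \<open>[a\<^sub>0, a\<^sub>0 + 1)\<close>,
  which is a tile; moving each piece by its own integer preserves this.\<close>
lemma chain_imp_integer_tile:
  assumes ab: "\<And>r. r \<le> m \<Longrightarrow> a r < b r" and chain: "translation_chain m a b \<rho> k"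
  shows "integer_tile (half_open_union m a b)"
proof -
  have \<rho>: "\<rho> permutes {1..m}" using chain by (simp add: translation_chain_def)
  have \<rho>0: "\<rho> 0 = 0" using \<rho> by (simp add: permutes_not_in)
  have \<rho>_le: "\<rho> i \<le> m" if "i \<le> m" for i
    using permutes_in_image[OF \<rho>, of i] that \<rho>0 by (cases "i = 0") auto
  \<comment> \<open>The value \<open>k 0\<close> is not constrained by the chain, and the first interval is not translated.\<close>
  define n where "n i = (if i = 0 then 0 else int (k i))" for i
  define A where "A i = a (\<rho> i) - of_int (n i)" for i
  define B where "B i = b (\<rho> i) - of_int (n i)" for i
  have AB: "A i < B i" if "i \<le> m" for i using ab[OF \<rho>_le[OF that]] by (simp add: A_def B_def)
  have step: "B i = A (i + 1)" if "i < m" for i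
    using chain that by (cases "i = 0") (auto simp: translation_chain_def A_def B_def n_def \<rho>0)
  have A0: "A 0 = a 0" by (simp add: A_def n_def \<rho>0)
  have before: "B i \<le> A j" if "i < j" "j \<le> m" for i j
    using that
  proof (induction j)
    case (Suc j)
    show ?case
    proof (cases "i = j")
      case True
      then show ?thesis using step[of j] Suc.prems by simp
    next
      case False
      then have "B i \<le> A j" using Suc by simp
      also have "A j < B j" using AB[of j] Suc.prems by simp
      also have "B j = A (Suc j)" using step[of j] Suc.prems by simp
      finally show ?thesis by simp
    qed
  qed simp
  have U: "(\<Union>i\<le>m. {A i..B i}) = {a 0..a 0 + 1}"
  proof -
    have "{..m} = insert 0 {1..m}" by auto
    then have "(\<Union>i\<le>m. {A i..B i}) = {a 0..b 0} \<union> (\<Union>i\<in>{1..m}. {a (\<rho> i) - real (k i)..b (\<rho> i) - real (k i)})"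
      by (simp add: A_def B_def n_def \<rho>0)
    then show ?thesis using chain by (simp add: translation_chain_def)
  qed
  have in_U: "{A i..B i} \<subseteq> {a 0..a 0 + 1}" if "i \<le> m" for i
    unfolding U[symmetric] using that by blast
  have range: "a 0 \<le> A i" "B i \<le> a 0 + 1" if "i \<le> m" for i
    using in_U[OF that] AB[OF that] by auto
  have Bm: "B m = a 0 + 1"
  proof -
    have "a 0 + 1 \<in> (\<Union>i\<le>m. {A i..B i})" unfolding U by simp
    then obtain i where i: "i \<le> m" "a 0 + 1 \<le> B i" by auto
    have "B i \<le> B m"
      using before[of i m] AB[of m] i(1) by (cases "i = m") auto
    with i range(2)[of m] show ?thesis by simp
  qed
  have cover: "\<exists>i\<le>j. x \<in> {A i..<B i}" if "j \<le> m" "a 0 \<le> x" "x < B j" for x j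
    using that
  proof (induction j)
    case 0
    then show ?case using A0 by auto
  next
    case (Suc j)
    show ?case
    proof (cases "x < B j")
      case True
      then obtain i where "i \<le> j" "x \<in> {A i..<B i}" using Suc by auto
      then show ?thesis by (intro exI[of _ i]) auto
    next
      case False
      then show ?thesis using step[of j] Suc.prems by (intro exI[of _ "Suc j"]) auto
    qed
  qed
  show ?thesis
    unfolding integer_tile_def
  proof
    fix x :: real
    define l where "l = \<lfloor>x - a 0\<rfloor>"
    define y where "y = x - of_int l"
    have y: "a 0 \<le> y" "y < a 0 + 1" unfolding y_def l_def by linarith+
    obtain i where i: "i \<le> m" "y \<in> {A i..<B i}" using cover[of m y] y Bm by auto
    show "\<exists>!j::int. x + of_int j \<in> half_open_union m a b"
    proof (rule ex1I[of _ "n i - l"])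
      have "x + of_int (n i - l) \<in> {a (\<rho> i)..<b (\<rho> i)}" using i(2) by (auto simp: y_def A_def B_def)
      then show "x + of_int (n i - l) \<in> half_open_union m a b"
        using \<rho>_le[OF i(1)] by (auto simp: half_open_union_def)
    next
      fix j :: int assume "x + of_int j \<in> half_open_union m a b"
      then obtain s where s: "s \<le> m" "x + of_int j \<in> {a s..<b s}" by (auto simp: half_open_union_def)
      obtain t where t: "s = \<rho> t" using surjD[OF permutes_surj[OF \<rho>], of s] by (rule exE)
      have "t \<le> m" using permutes_not_in[OF \<rho>, of t] s(1) t by (cases "t \<le> m") auto
      define z where "z = x + of_int (j - n t)"
      have z: "z \<in> {A t..<B t}" using s(2) t by (simp add: z_def A_def B_def)
      then have "a 0 \<le> z" "z < a 0 + 1" using range[OF \<open>t \<le> m\<close>] by auto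
      then have "\<bar>real_of_int (j - n t + l)\<bar> < 1" using y unfolding y_def z_def by linarith
      then have j: "j = n t - l" by linarith
      then have "z = y" by (simp add: z_def y_def)
      have "t = i"
      proof (rule ccontr)
        assume "t \<noteq> i"
        then consider "t < i" | "i < t" by linarith
        then show False
          using before[of t i] before[of i t] i z \<open>t \<le> m\<close> \<open>z = y\<close> by cases auto
      qed
      then show "j = n i - l" using j by simp
    qed
  qed
qed

section \<open>Dyadic tilings and the characterization of wavelet sets\<close>

lemma half_open_union_sets [measurable]: "half_open_union m a b \<in> sets lebesgue"
  unfolding half_open_union_def by (intro sets.finite_UN) auto

lemma half_open_union_bounded: "bounded (half_open_union m a b)"
  unfolding half_open_union_def by (intro bounded_UN) auto

lemma half_open_union_right_open: "right_open (half_open_union m a b)"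
  unfolding right_open_def
proof
  fix x assume "x \<in> half_open_union m a b"
  then obtain r where "r \<le> m" "x \<in> {a r..<b r}" by (auto simp: half_open_union_def)
  then show "\<exists>\<epsilon>>0. {x..<x + \<epsilon>} \<subseteq> half_open_union m a b"
    by (intro exI[of _ "b r - x"]) (auto simp: half_open_union_def intro!: bexI[of _ r])
qed

text \<open>The two sets differ only in right endpoints.\<close>
lemma half_open_union_AE:
  "AE x in lebesgue. x \<in> (\<Union>r\<le>m. {a r..b r}) \<longleftrightarrow> x \<in> half_open_union m a b"
proof (rule AE_I')
  show "b ` {..m} \<in> null_sets lebesgue" by (intro null_sets_completionI finite_imp_null_set_lborel) simp
  show "{x \<in> space lebesgue. \<not> (x \<in> (\<Union>r\<le>m. {a r..b r}) \<longleftrightarrow> x \<in> half_open_union m a b)} \<subseteq> b ` {..m}"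
    by (force simp: half_open_union_def)
qed

lemma log_mem_half_open_union:
  assumes "\<forall>r\<le>m. 0 < p r" "\<forall>r\<le>m. 0 < q r" and "x > 0"
  shows "2 powi j * x \<in> half_open_union m p q
    \<longleftrightarrow> log 2 x + of_int j \<in> half_open_union m (\<lambda>r. log 2 (p r)) (\<lambda>r. log 2 (q r))"
proof -
  define y where "y = 2 powi j * x"
  have y: "y > 0" using assms(3) by (simp add: y_def)
  have "log 2 (2 powi j) = log 2 (2 powr real_of_int j)" by (simp add: powr_real_of_int')
  then have "log 2 y = of_int j + log 2 x"
    using assms(3) by (simp add: y_def log_mult)
  then have eq: "log 2 x + of_int j = log 2 y" by simp
  have "y \<in> {p r..<q r} \<longleftrightarrow> log 2 y \<in> {log 2 (p r)..<log 2 (q r)}" if "r \<le> m" for r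
    using y assms(1,2) that by simp
  then show ?thesis unfolding eq y_def[symmetric] half_open_union_def by blast
qed

text \<open>The logarithm turns multiplication by powers of two into translation by integers.\<close>
lemma dyadic_tile_iff_log:
  assumes p: "\<forall>r\<le>m. 0 < p r" "\<forall>r\<le>m. 0 < q r"
  shows "dyadic_tile (half_open_union m p q)
    \<longleftrightarrow> integer_tile (half_open_union m (\<lambda>r. log 2 (p r)) (\<lambda>r. log 2 (q r)))"
    (is "dyadic_tile ?S \<longleftrightarrow> integer_tile ?T")
proof
  assume D: "dyadic_tile ?S"
  show "integer_tile ?T"
    unfolding integer_tile_def
  proof
    fix y :: real
    have "(\<exists>!j::int. 2 powi j * 2 powr y \<in> ?S) \<longleftrightarrow> (\<exists>!j::int. log 2 (2 powr y) + of_int j \<in> ?T)"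
      by (simp only: log_mem_half_open_union[OF p, where x = "2 powr y"] powr_gt_zero)
    moreover have "\<exists>!j::int. 2 powi j * 2 powr y \<in> ?S" using D by (simp add: dyadic_tile_def)
    ultimately show "\<exists>!j::int. y + of_int j \<in> ?T" by simp
  qed
next
  assume T: "integer_tile ?T"
  show "dyadic_tile ?S"
    unfolding dyadic_tile_def
  proof (intro allI impI)
    fix x :: real assume "x > 0"
    have "\<exists>!j::int. log 2 x + of_int j \<in> ?T" using T unfolding integer_tile_def by (rule spec)
    then show "\<exists>!j::int. 2 powi j * x \<in> ?S" by (simp only: log_mem_half_open_union[OF p \<open>x > 0\<close>])
  qed
qed

lemma dyadic_tile_of_dense:
  assumes p: "\<forall>r\<le>m. 0 < p r" "\<forall>r\<le>m. 0 < q r"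
    and dense: "\<And>x \<epsilon>. x > 0 \<Longrightarrow> \<epsilon> > 0 \<Longrightarrow> \<exists>y\<in>{x<..<x + \<epsilon>}. \<exists>!j::int. 2 powi j * y \<in> half_open_union m p q"
  shows "dyadic_tile (half_open_union m p q)"
  unfolding dyadic_tile_iff_log[OF p]
proof (rule integer_tile_of_dense)
  fix y \<epsilon> :: real assume "\<epsilon> > 0"
  define d where "d = 2 powr (y + \<epsilon>) - 2 powr y"
  have "d > 0" using \<open>\<epsilon> > 0\<close> by (simp add: d_def)
  from dense[OF _ this, of "2 powr y"] obtain x where x: "x \<in> {2 powr y<..<2 powr y + d}"
    "\<exists>!j::int. 2 powi j * x \<in> half_open_union m p q" by (auto simp del: greaterThanLessThan_iff elim!: bexE)
  have "0 < (2::real) powr y" "2 powr y < x" using x(1) by simp_all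
  then have "x > 0" by (rule less_trans)
  have "y < log 2 x" "log 2 x < y + \<epsilon>"
    using x(1) \<open>x > 0\<close> by (auto simp: d_def less_log_iff log_less_iff)
  then have "log 2 x \<in> {y<..<y + \<epsilon>}" by simp
  moreover have "\<exists>!j::int. log 2 x + of_int j \<in> half_open_union m (\<lambda>r. log 2 (p r)) (\<lambda>r. log 2 (q r))"
    using x(2) by (simp only: log_mem_half_open_union[OF p \<open>x > 0\<close>])
  ultimately show "\<exists>z\<in>{y<..<y + \<epsilon>}. \<exists>!j::int. z + of_int j \<in> half_open_union m (\<lambda>r. log 2 (p r)) (\<lambda>r. log 2 (q r))"
    by (intro bexI)
qed

lemma integer_tile_iff_chain:
  assumes "\<forall>r\<le>m. a r < b r" "\<forall>r<m. b r < a (r + 1)"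
  shows "integer_tile (half_open_union m a b) \<longleftrightarrow> (\<exists>\<rho> k. translation_chain m a b \<rho> k)"
  using integer_tile_imp_chain[of m a b] chain_imp_integer_tile[of m a b] assms by blast

text \<open>Both sides say the same about endpoints, since \<open>log\<^sub>2 x - n = log\<^sub>2 (x / 2\<^sup>n)\<close>. For the equality of unions this
  uses that all sets on the right consist of positive numbers, on which \<open>log\<^sub>2\<close> is a bijection onto the line.\<close>
lemma log_chain_iff:
  fixes p q :: "nat \<Rightarrow> real"
  assumes pos: "\<forall>r\<le>m. 0 < p r" "\<forall>r\<le>m. 0 < q r"
  shows "translation_chain m (\<lambda>r. log 2 (p r)) (\<lambda>r. log 2 (q r)) \<sigma> r \<longleftrightarrow> \<sigma> permutes {1..m} \<and>
       {p 0..q 0} \<union> (\<Union>i\<in>{1..m}. (\<lambda>x. x / 2 ^ r i) ` {p (\<sigma> i)..q (\<sigma> i)}) = {p 0..2 * p 0} \<and>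
       (1 \<le> m \<longrightarrow> q 0 = p (\<sigma> 1) / 2 ^ r 1) \<and>
       (\<forall>i\<in>{1..<m}. q (\<sigma> i) / 2 ^ r i = p (\<sigma> (i + 1)) / 2 ^ r (i + 1))"
proof (cases "\<sigma> permutes {1..m}")
  case True
  have \<sigma>_le: "\<sigma> i \<le> m" if "i \<in> {1..m}" for i
    using permutes_in_image[OF True, of i] that by auto
  have \<sigma>_pos: "0 < p (\<sigma> i)" "0 < q (\<sigma> i)" if "i \<in> {1..m}" for i
    using pos \<sigma>_le[OF that] by auto
  have log_scale: "log 2 x - real n = log 2 (x / 2 ^ n)" if "x > 0" for x n
    using that by (simp add: log_divide log_nat_power)
  have log_eq: "log 2 x = log 2 y \<longleftrightarrow> x = y" if "x > 0" "y > 0" for x y :: real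
    using that by (simp add: order_eq_iff)
  have "(1 \<le> m \<longrightarrow> log 2 (q 0) = log 2 (p (\<sigma> 1)) - real (r 1)) \<longleftrightarrow> (1 \<le> m \<longrightarrow> q 0 = p (\<sigma> 1) / 2 ^ r 1)"
    using \<sigma>_pos[of 1] pos(2) by (auto simp: log_scale log_eq)
  moreover have "(\<forall>i\<in>{1..<m}. log 2 (q (\<sigma> i)) - real (r i) = log 2 (p (\<sigma> (i + 1))) - real (r (i + 1)))
      \<longleftrightarrow> (\<forall>i\<in>{1..<m}. q (\<sigma> i) / 2 ^ r i = p (\<sigma> (i + 1)) / 2 ^ r (i + 1))"
  proof (intro ball_cong refl)
    fix i assume "i \<in> {1..<m}"
    then have *: "0 < q (\<sigma> i)" "0 < p (\<sigma> (i + 1))" using \<sigma>_pos[of i] \<sigma>_pos[of "i + 1"] by auto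
    then have "0 < q (\<sigma> i) / 2 ^ r i" "0 < p (\<sigma> (i + 1)) / 2 ^ r (i + 1)" by simp_all
    from log_eq[OF this] show "(log 2 (q (\<sigma> i)) - real (r i) = log 2 (p (\<sigma> (i + 1))) - real (r (i + 1)))
      \<longleftrightarrow> (q (\<sigma> i) / 2 ^ r i = p (\<sigma> (i + 1)) / 2 ^ r (i + 1))"
      by (simp only: log_scale[OF *(1)] log_scale[OF *(2)])
  qed
  moreover have "{log 2 (p 0)..log 2 (q 0)} \<union> (\<Union>i\<in>{1..m}. {log 2 (p (\<sigma> i)) - real (r i)..log 2 (q (\<sigma> i)) - real (r i)})
        = {log 2 (p 0)..log 2 (p 0) + 1}
      \<longleftrightarrow> {p 0..q 0} \<union> (\<Union>i\<in>{1..m}. (\<lambda>x. x / 2 ^ r i) ` {p (\<sigma> i)..q (\<sigma> i)}) = {p 0..2 * p 0}"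
    (is "?V = ?V' \<longleftrightarrow> ?U = ?U'")
  proof -
    have img: "(\<lambda>x. x / 2 ^ n) ` {u..v} = {u / 2 ^ n..v / 2 ^ n}" for u v :: real and n
      by (subst image_divide_atLeastAtMost) auto
    have mem: "x \<in> ?U \<longleftrightarrow> log 2 x \<in> ?V" if "x > 0" for x
    proof -
      have "x \<in> {p 0..q 0} \<longleftrightarrow> log 2 x \<in> {log 2 (p 0)..log 2 (q 0)}"
        using that pos by simp
      moreover have "x \<in> {p (\<sigma> i) / 2 ^ r i..q (\<sigma> i) / 2 ^ r i}
          \<longleftrightarrow> log 2 x \<in> {log 2 (p (\<sigma> i)) - real (r i)..log 2 (q (\<sigma> i)) - real (r i)}" if "i \<in> {1..m}" for i
        using \<open>x > 0\<close> \<sigma>_pos[OF that] by (simp add: log_scale)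
      ultimately show ?thesis by (simp only: img Un_iff UN_iff) blast
    qed
    have mem': "x \<in> ?U' \<longleftrightarrow> log 2 x \<in> ?V'" if "x > 0" for x
    proof -
      have "0 < p 0" using pos(1) by simp
      then have "log 2 (p 0) + 1 = log 2 (2 * p 0)" by (simp add: log_mult)
      then show ?thesis using that pos(1) by simp
    qed
    have U_pos: "x > 0" if "x \<in> ?U \<or> x \<in> ?U'" for x
    proof -
      have "x \<ge> p 0 \<or> (\<exists>i\<in>{1..m}. p (\<sigma> i) / 2 ^ r i \<le> x)"
        using that by (auto simp: img)
      moreover have "0 < p 0" using pos(1) by simp
      moreover have "0 < p (\<sigma> i) / 2 ^ r i" if "i \<in> {1..m}" for i using \<sigma>_pos(1)[OF that] by simp
      ultimately show ?thesis by (meson less_le_trans)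
    qed
    show ?thesis
    proof
      assume eq: "?V = ?V'"
      show "?U = ?U'"
      proof (rule set_eqI)
        fix x
        show "x \<in> ?U \<longleftrightarrow> x \<in> ?U'"
        proof (cases "x > 0")
          case True
          show ?thesis unfolding mem[OF True] mem'[OF True] eq ..
        next
          case False
          then show ?thesis using U_pos[of x] by blast
        qed
      qed
    next
      assume eq: "?U = ?U'"
      show "?V = ?V'"
      proof (rule set_eqI)
        fix y :: real
        have "2 powr y \<in> ?U \<longleftrightarrow> 2 powr y \<in> ?U'" unfolding eq ..
        then have "log 2 (2 powr y) \<in> ?V \<longleftrightarrow> log 2 (2 powr y) \<in> ?V'"
          using mem[of "2 powr y"] mem'[of "2 powr y"] by simp
        then show "y \<in> ?V \<longleftrightarrow> y \<in> ?V'" by simp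
      qed
    qed
  qed
  ultimately show ?thesis unfolding translation_chain_def by blast
qed (auto simp: translation_chain_def)

theorem proposition11:
  fixes m :: nat and p q :: "nat \<Rightarrow> real" and K :: "real set"
  assumes "0 < p 0"
    and "\<And>r. r \<le> m \<Longrightarrow> p r < q r"
    and "\<And>r. r < m \<Longrightarrow> q r < p (r + 1)"
    and "K = (\<Union>r\<le>m. {p r..q r})"
  shows "H2_wavelet_set K \<longleftrightarrow>
    (\<exists>\<rho> (k :: nat \<Rightarrow> nat). \<rho> permutes {1..m} \<and>
       {p 0..q 0} \<union> (\<Union>i\<in>{1..m}. (\<lambda>x. x - real (k i)) ` {p (\<rho> i)..q (\<rho> i)}) = {p 0..p 0 + 1} \<and>
       (1 \<le> m \<longrightarrow> q 0 = p (\<rho> 1) - real (k 1)) \<and>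
       (\<forall>i\<in>{1..<m}. q (\<rho> i) - real (k i) = p (\<rho> (i + 1)) - real (k (i + 1)))) \<and>
    (\<exists>\<sigma> (r :: nat \<Rightarrow> nat). \<sigma> permutes {1..m} \<and>
       {p 0..q 0} \<union> (\<Union>i\<in>{1..m}. (\<lambda>x. x / 2 ^ r i) ` {p (\<sigma> i)..q (\<sigma> i)}) = {p 0..2 * p 0} \<and>
       (1 \<le> m \<longrightarrow> q 0 = p (\<sigma> 1) / 2 ^ r 1) \<and>
       (\<forall>i\<in>{1..<m}. q (\<sigma> i) / 2 ^ r i = p (\<sigma> (i + 1)) / 2 ^ r (i + 1)))"
proof -
  define S where "S = half_open_union m p q"
  have p_pos: "0 < p r" if "r \<le> m" for r
    using intervals_ordered[of m p q 0 r, OF assms(2,3)] assms(1) assms(2)[of 0] that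
    by (cases "r = 0") auto
  have q_pos: "0 < q r" if "r \<le> m" for r
    using p_pos[OF that] assms(2)[OF that] by simp
  have pos: "\<forall>r\<le>m. 0 < p r" "\<forall>r\<le>m. 0 < q r" using p_pos q_pos by blast+
  have ordered: "\<forall>r\<le>m. p r < q r" "\<forall>r<m. q r < p (r + 1)" using assms(2,3) by blast+
  have S: "S \<in> sets lebesgue" "bounded S" "right_open S"
    unfolding S_def by (rule half_open_union_sets half_open_union_bounded half_open_union_right_open)+
  have S_pos: "S \<subseteq> {0<..}"
    using p_pos by (force simp: S_def half_open_union_def)
  have K: "K \<in> sets lebesgue" "K \<subseteq> {0<..}"
  proof -
    show "K \<in> sets lebesgue" unfolding assms(4) by (intro sets.finite_UN) auto
    show "K \<subseteq> {0<..}" using p_pos by (force simp: assms(4))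
  qed
  have KS: "AE x in lebesgue. x \<in> K \<longleftrightarrow> x \<in> S"
    unfolding assms(4) S_def by (rule half_open_union_AE)
  have "H2_wavelet_set K \<longleftrightarrow> integer_tile S \<and> dyadic_tile S"
  proof
    assume wav: "H2_wavelet_set K"
    note dense = wavelet_set_imp_tiles[OF wav S(1,2) S_pos S(3) KS]
    show "integer_tile S \<and> dyadic_tile S"
      unfolding S_def
    proof
      show "integer_tile (half_open_union m p q)"
        by (rule integer_tile_of_dense) (rule dense(1)[unfolded S_def])
      show "dyadic_tile (half_open_union m p q)"
        by (rule dyadic_tile_of_dense[OF pos]) (assumption | rule dense(2)[unfolded S_def])+
    qed
  next
    assume "integer_tile S \<and> dyadic_tile S"
    then show "H2_wavelet_set K"
      by (intro tiles_imp_wavelet_set[OF S(1,2) S_pos _ _ K KS]) auto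
  qed
  moreover have "integer_tile S \<longleftrightarrow> (\<exists>\<rho> (k :: nat \<Rightarrow> nat). \<rho> permutes {1..m} \<and>
       {p 0..q 0} \<union> (\<Union>i\<in>{1..m}. (\<lambda>x. x - real (k i)) ` {p (\<rho> i)..q (\<rho> i)}) = {p 0..p 0 + 1} \<and>
       (1 \<le> m \<longrightarrow> q 0 = p (\<rho> 1) - real (k 1)) \<and>
       (\<forall>i\<in>{1..<m}. q (\<rho> i) - real (k i) = p (\<rho> (i + 1)) - real (k (i + 1))))"
    unfolding S_def integer_tile_iff_chain[OF ordered] translation_chain_def
      image_minus_const_atLeastAtMost' ..
  moreover have "dyadic_tile S \<longleftrightarrow> (\<exists>\<sigma> (r :: nat \<Rightarrow> nat). \<sigma> permutes {1..m} \<and>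
       {p 0..q 0} \<union> (\<Union>i\<in>{1..m}. (\<lambda>x. x / 2 ^ r i) ` {p (\<sigma> i)..q (\<sigma> i)}) = {p 0..2 * p 0} \<and>
       (1 \<le> m \<longrightarrow> q 0 = p (\<sigma> 1) / 2 ^ r 1) \<and>
       (\<forall>i\<in>{1..<m}. q (\<sigma> i) / 2 ^ r i = p (\<sigma> (i + 1)) / 2 ^ r (i + 1)))"
  proof -
    have "\<forall>r\<le>m. log 2 (p r) < log 2 (q r)" "\<forall>r<m. log 2 (q r) < log 2 (p (r + 1))"
      using pos ordered by simp_all
    then show ?thesis
      unfolding S_def dyadic_tile_iff_log[OF pos] log_chain_iff[OF pos, symmetric]
      by (rule integer_tile_iff_chain)
  qed
  ultimately show ?thesis by (simp only:)
qed

end
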